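(* Consider the two-dimensional Ariza-Ortiz energy $H_{\mathrm{AO}}$ on the triangular lattice $\mathcal T$, in the box $\Lambda=\Lambda^{(N)}$ with Dirichlet boundary conditions ($\Lambda\to\mathcal T$ meaning $N\to\infty$). Let $$E_{\mathrm{dip}}(n)=\lim_{\Lambda\to\mathcal T}\min\big\{H_{\mathrm{AO}}(u,\sigma):\ \mathrm d\sigma=q^n_{\mathrm{dip}}\big\},$$ $$E_{\mathrm{grain}}(n,m)=\lim_{M\to\infty}\frac1{\sqrt3\,mM}\Big[\lim_{\Lambda\to\mathcal T}\min\big\{H_{\mathrm{AO}}(u,\sigma):\ \mathrm d\sigma=q^{M,n,m}_{\mathrm{grain}}\big\}\Big]$$ be the energy of a dislocation dipole and the energy density of a grain boundary per unit length, in the thermodynamic limit. Then $$E_{\mathrm{dip}}(n)=\frac{\log n}{2\pi\sqrt3}+O(1),\qquad n\gg1,$$ and $$\lim_{n\to\infty}E_{\mathrm{grain}}(n,m)=\frac{\log m}{6\pi m}+O(1/m),\qquad m\gg1.$$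
   Context: **Lattice.** $\mathcal T=\{n_1b_1+n_2b_2:\ n_1,n_2\in\mathbb Z\}\subset\mathbb R^2$ is the triangular lattice with $b_1=(1,0)$, $b_2=\frac12(-1,\sqrt3)$; also $b_3=-b_1-b_2=\frac12(-1,-\sqrt3)$. Write $x\sim y$ if $|x-y|=1$. $\Lambda=\Lambda^{(N)}=\{n_1b_1+n_2b_2:\ n_i=\lfloor -N/2+1\rfloor,\ldots,\lfloor N/2\rfloor,\ i=1,2\}$. **Fields and energy.** Displacements $u:\mathcal T\to\mathbb R^2$ satisfy $u(x)=0$ for $x\notin\Lambda$. Slip fields $\sigma:\{(x,y)\in\mathcal T^2: x\sim y\}\to\mathcal T$ are lattice-valued, satisfy $\sigma(x,y)=-\sigma(y,x)$, and $\sigma(x,y)=0$ if $x,y\notin\Lambda$. The energy is $$H_{\mathrm{AO}}(u,\sigma)=\frac12\sum_{x\sim y}\big[(u(y)-u(x)-\sigma(x,y))\cdot(y-x)\big]^2,$$ summed over unordered nearest neighbor pairs. The minima are over pairs $(u,\sigma)$ of such fields. **Charges.** Oriented faces are 3-cycles $(x_1,x_2,x_3)$ of nearest neighbor sites (cyclic order matters, up to cyclic permutation), and $\mathrm d\sigma(x_1,x_2,x_3)=\sigma(x_1,x_2)+\sigma(x_2,x_3)+\sigma(x_3,x_1)$. Functions on oriented faces are odd under orientation flip; $\mathbf 1_f$ denotes the function equal to $1$ on $f$, $-1$ on $f$ with reversed orientation, and $0$ on all other faces. For $n\ge0$, $f_n=(0,b_1,-b_3)+nb_1$ (translate of the face $(0,b_1,-b_3)$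 by $nb_1$). For integers $n,m,M\ge1$, $$q^n_{\mathrm{dip}}=(\mathbf 1_{f_0}-\mathbf 1_{f_n})\,b_1,\qquad q^{M,n,m}_{\mathrm{grain}}(f)=\sum_{j=1}^M q^n_{\mathrm{dip}}\big(f-jm(b_2-b_3)\big),$$ where $f-z$ is the translate of the face $f$ by $-z$. *)

theory Defs
  imports "HOL-Analysis.Analysis" "HOL-Library.Landau_Symbols"
begin

type_synonym pt = "real ^ 2"

definition b1 :: pt where "b1 = vector [1, 0]"
definition b2 :: pt where "b2 = vector [- 1 / 2, sqrt 3 / 2]"
definition b3 :: pt where "b3 = - b1 - b2"

definition lattice_pt :: "int \<Rightarrow> int \<Rightarrow> pt" where
  "lattice_pt n1 n2 = of_int n1 *\<^sub>R b1 + of_int n2 *\<^sub>R b2"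

definition tri_lattice :: "pt set" where
  "tri_lattice = {lattice_pt n1 n2 | n1 n2. True}"

definition nn :: "pt \<Rightarrow> pt \<Rightarrow> bool" where
  "nn x y \<longleftrightarrow> x \<in> tri_lattice \<and> y \<in> tri_lattice \<and> norm (x - y) = 1"

definition Lam :: "nat \<Rightarrow> pt set" where
  "Lam N = {lattice_pt n1 n2 | n1 n2.
     n1 \<in> {\<lfloor>- real N / 2 + 1\<rfloor>..\<lfloor>real N / 2\<rfloor>} \<and>
     n2 \<in> {\<lfloor>- real N / 2 + 1\<rfloor>..\<lfloor>real N / 2\<rfloor>}}"

(* Fields are total functions. Values of displacements off the lattice, of slip fields off
   nearest neighbor pairs, and of charges off faces are never inspected. *)

definition displacement :: "nat \<Rightarrow> (pt \<Rightarrow> pt) \<Rightarrow> bool" where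
  "displacement N u \<longleftrightarrow> (\<forall>x \<in> tri_lattice. x \<notin> Lam N \<longrightarrow> u x = 0)"

definition slip_field :: "nat \<Rightarrow> (pt \<Rightarrow> pt \<Rightarrow> pt) \<Rightarrow> bool" where
  "slip_field N \<sigma> \<longleftrightarrow>
     (\<forall>x y. nn x y \<longrightarrow> \<sigma> x y \<in> tri_lattice \<and> \<sigma> x y = - \<sigma> y x \<and>
        (x \<notin> Lam N \<and> y \<notin> Lam N \<longrightarrow> \<sigma> x y = 0))"

(* The inner factor 1/2 turns the sum over ordered pairs into the sum over unordered pairs:
   for antisymmetric \<sigma> the summand is symmetric. For fields satisfying the boundary
   conditions only finitely many summands are nonzero. *)

definition H_AO :: "(pt \<Rightarrow> pt) \<Rightarrow> (pt \<Rightarrow> pt \<Rightarrow> pt) \<Rightarrow> real" where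
  "H_AO u \<sigma> = 1 / 2 * (1 / 2 *
     (\<Sum>\<^sub>\<infinity>(x, y) \<in> {(x, y). nn x y}. ((u y - u x - \<sigma> x y) \<bullet> (y - x))\<^sup>2))"

(* An oriented face is represented by any of the three cyclic rotations of a triple. *)

type_synonym face = "pt \<times> pt \<times> pt"

definition faces :: "face set" where
  "faces = {(x1, x2, x3). nn x1 x2 \<and> nn x2 x3 \<and> nn x3 x1}"

definition d_slip :: "(pt \<Rightarrow> pt \<Rightarrow> pt) \<Rightarrow> face \<Rightarrow> pt" where
  "d_slip \<sigma> = (\<lambda>(x1, x2, x3). \<sigma> x1 x2 + \<sigma> x2 x3 + \<sigma> x3 x1)"

definition rotations :: "face \<Rightarrow> face set" where
  "rotations = (\<lambda>(x1, x2, x3). {(x1, x2, x3), (x2, x3, x1), (x3, x1, x2)})"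

definition flip :: "face \<Rightarrow> face" where
  "flip = (\<lambda>(x1, x2, x3). (x3, x2, x1))"

definition ind_face :: "face \<Rightarrow> face \<Rightarrow> real" where
  "ind_face f g = (if g \<in> rotations f then 1 else if g \<in> rotations (flip f) then - 1 else 0)"

definition shift :: "pt \<Rightarrow> face \<Rightarrow> face" where
  "shift z = (\<lambda>(x1, x2, x3). (x1 + z, x2 + z, x3 + z))"

definition face_at :: "nat \<Rightarrow> face" where
  "face_at n = shift (real n *\<^sub>R b1) (0, b1, - b3)"

definition q_dip :: "nat \<Rightarrow> face \<Rightarrow> pt" where
  "q_dip n f = (ind_face (face_at 0) f - ind_face (face_at n) f) *\<^sub>R b1"

definition q_grain :: "nat \<Rightarrow> nat \<Rightarrow> nat \<Rightarrow> face \<Rightarrow> pt" where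
  "q_grain M n m f = (\<Sum>j = 1..M. q_dip n (shift (- (real (j * m) *\<^sub>R (b2 - b3))) f))"

definition energies :: "nat \<Rightarrow> (face \<Rightarrow> pt) \<Rightarrow> real set" where
  "energies N q = {H_AO u \<sigma> | u \<sigma>.
     displacement N u \<and> slip_field N \<sigma> \<and> (\<forall>f \<in> faces. d_slip \<sigma> f = q f)}"

definition min_attained :: "nat \<Rightarrow> (face \<Rightarrow> pt) \<Rightarrow> bool" where
  "min_attained N q \<longleftrightarrow> (\<exists>e \<in> energies N q. \<forall>e' \<in> energies N q. e \<le> e')"

(* The minimum; a meaningful value only if min_attained N q holds. In particular, for small N
   the charge q may not fit into the box and energies N q is empty. *)

definition min_energy :: "nat \<Rightarrow> (face \<Rightarrow> pt) \<Rightarrow> real" where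
  "min_energy N q = (LEAST e. e \<in> energies N q)"

definition has_thermo_limit :: "(face \<Rightarrow> pt) \<Rightarrow> bool" where
  "has_thermo_limit q \<longleftrightarrow>
     (\<forall>\<^sub>F N in sequentially. min_attained N q) \<and> convergent (\<lambda>N. min_energy N q)"

definition thermo_energy :: "(face \<Rightarrow> pt) \<Rightarrow> real" where
  "thermo_energy q = lim (\<lambda>N. min_energy N q)"

definition E_dip :: "nat \<Rightarrow> real" where
  "E_dip n = thermo_energy (q_dip n)"

definition grain_density :: "nat \<Rightarrow> nat \<Rightarrow> nat \<Rightarrow> real" where
  "grain_density n m M = 1 / (sqrt 3 * real m * real M) * thermo_energy (q_grain M n m)"

definition E_grain :: "nat \<Rightarrow> nat \<Rightarrow> real" where
  "E_grain n m = lim (\<lambda>M. grain_density n m M)"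

end

theory Submission
  imports Defs
begin

text \<open>
  Gauge invariance reduces the minimum over slip fields with prescribed charge to one fixed slip field
  \<open>\<sigma>\<close>, supported on a cut; the energy is then a least squares problem in the displacement alone, and the
  thermodynamic limit is the squared distance from \<open>\<sigma>\<close> to the gradients of finitely supported fields.
  Fourier series compute it: at each frequency the strains of displacements fill the plane orthogonal to one
  explicit vector, so the energy is the integral of the squared component of \<open>\<sigma>\<close> along this vector.
  Up to a bounded error the kernel in this integral is \<open>4 b\<^sup>2 / (b\<^sup>2 + 3 a\<^sup>2)\<^sup>2\<close>.
  Integrating it over \<open>b\<close> leaves a multiple of \<open>1 / \<bar>a\<bar>\<close> against \<open>sin\<^sup>2 (n a)\<close>, hence the logarithm of
  the dipole. For the grain boundary the array of charges acts as a Fejer kernel in \<open>b\<close>, which turns the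
  integral into a sum over the frequencies \<open>pi k / m\<close>; the integral over \<open>a\<close> is of order \<open>m / \<bar>k\<bar>\<close>
  there, and the harmonic sum gives \<open>log m\<close>.
\<close>

section \<open>Characters of the lattice\<close>

text \<open>Near the origin of the two-dimensional frequency space the kernel is of size
  \<open>1 / r\<^sup>2\<close>, which is not integrable. The factor
  \<open>sin\<^sup>2 (n a)\<close>, due to the finite width of the dipoles, makes the integrals
  converge for fixed n. This shapes the grain boundary: with n fixed the kernel integrated over a is
  continuous in b, so M can tend to infinity; only then does n grow, at each of the finitely many
  nodes \<open>pi k / m\<close> separately, where \<open>sin\<^sup>2\<close> averages to 1/2. The
  node k = 0 costs only a constant because the leading part of the kernel vanishes on b = 0.

  Origin of the constants: averaging the kernel over b leaves
  \<open>1 / (sqrt 3 * \<bar>a\<bar>)\<close>, whose average against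
  \<open>sin\<^sup>2 (n a)\<close> is about \<open>log n / (pi sqrt 3)\<close>; the energy is half
  of it. Averaging over a leaves \<open>2 / (sqrt 3 * \<bar>b\<bar>)\<close>; half of this, summed
  over \<open>b = pi k / m\<close> with \<open>0 < \<bar>k\<bar> \<le> m\<close>, is about
  \<open>2 m log m / (sqrt 3 pi)\<close>, and the prefactor \<open>1 / (4 sqrt 3 m\<^sup>2)\<close>
  turns it into \<open>log m / (6 pi m)\<close>.\<close>

definition unif :: "real \<Rightarrow> real measure" where
  "unif r = density lborel (\<lambda>x. ennreal (indicator {-r..r} x / (2 * r)))"

lemma sets_unif [simp, measurable_cong]: "sets (unif r) = sets borel"
  by (simp add: unif_def)

lemma space_unif [simp]: "space (unif r) = UNIV"
  by (simp add: unif_def)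

lemma emeasure_unif: "r > 0 \<Longrightarrow> emeasure (unif r) UNIV = 1"
proof -
  assume r: "r > 0"
  have "emeasure (unif r) UNIV = (\<integral>\<^sup>+x. ennreal (1 / (2*r)) * indicator {-r..r} x \<partial>lborel)"
    unfolding unif_def
    by (subst emeasure_density) (auto intro!: nn_integral_cong split: split_indicator)
  also have "\<dots> = 1"
    using r by (simp add: nn_integral_cmult_indicator ennreal_mult[symmetric])
  finally show ?thesis .
qed

interpretation unif: finite_measure "unif r"
proof (cases "r > 0")
  case True
  then show "finite_measure (unif r)"
    by (intro finite_measureI) (simp add: emeasure_unif)
next
  case False
  \<comment> \<open>For r < 0 the interval is empty and for r = 0 the division by zero gives 0, so
    the measure is null.\<close>
  then have *: "ennreal (indicator {-r..r} x / (2 * r)) = 0" for x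
    by (auto split: split_indicator simp: ennreal_neg divide_nonneg_nonpos)
  show "finite_measure (unif r)"
    by (intro finite_measureI) (simp add: unif_def emeasure_density *)
qed

lemma measure_unif [simp]: "r > 0 \<Longrightarrow> measure (unif r) UNIV = 1"
  by (simp add: measure_def emeasure_unif)

lemma integral_unif:
  fixes f :: "real \<Rightarrow> 'a::{banach, second_countable_topology}"
  assumes "r > 0" and [measurable]: "f \<in> borel_measurable borel"
  shows "integral\<^sup>L (unif r) f = (1 / (2 * r)) *\<^sub>R (\<integral>x. indicator {-r..r} x *\<^sub>R f x \<partial>lborel)"
proof -
  have "integral\<^sup>L (unif r) f = (\<integral>x. (indicator {-r..r} x / (2 * r)) *\<^sub>R f x \<partial>lborel)"
    unfolding unif_def using assms(1) by (intro integral_density) auto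
  also have "\<dots> = (\<integral>x. (1 / (2 * r)) *\<^sub>R (indicator {-r..r} x *\<^sub>R f x) \<partial>lborel)"
    by (intro Bochner_Integration.integral_cong) auto
  also have "\<dots> = (1 / (2 * r)) *\<^sub>R (\<integral>x. indicator {-r..r} x *\<^sub>R f x \<partial>lborel)"
    by (rule integral_scaleR_right)
  finally show ?thesis .
qed

lemma integral_unif_FTC:
  fixes f :: "real \<Rightarrow> 'a::euclidean_space"
  assumes "r > 0" and [measurable]: "f \<in> borel_measurable borel"
    and "\<And>x. -r \<le> x \<Longrightarrow> x \<le> r \<Longrightarrow> (F has_vector_derivative f x) (at x within {-r..r})"
    and "continuous_on {-r..r} f"
  shows "integral\<^sup>L (unif r) f = (1 / (2 * r)) *\<^sub>R (F r - F (-r))"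
proof -
  have "(\<integral>x. indicator {-r..r} x *\<^sub>R f x \<partial>lborel) = F r - F (-r)"
    using assms by (intro integral_FTC_Icc) auto
  then show ?thesis using assms(1) by (subst integral_unif) auto
qed

lemma AE_unif_bounds: "AE x in unif r. -r \<le> x \<and> x \<le> r"
  unfolding unif_def by (subst AE_density) (auto split: split_indicator)

lemma AE_unif_neq: "AE x in unif r. x \<noteq> c"
proof -
  have "AE x in lborel. x \<noteq> c" by (rule AE_lborel_singleton)
  then show ?thesis
    unfolding unif_def by (subst AE_density) (auto elim: eventually_mono)
qed

lemma integral_unif_cis:
  assumes "r > 0" "t \<noteq> 0"
  shows "integral\<^sup>L (unif r) (\<lambda>x. cis (t * x)) = of_real (sin (t * r) / (t * r))"
proof -
  define F where "F = (\<lambda>x. cis (t * x) / (\<i> * of_real t))"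
  have "(F has_vector_derivative cis (t * x)) (at x within S)" for x S
  proof -
    have "((\<lambda>z. exp (\<i> * (of_real t * z)) / (\<i> * of_real t)) has_field_derivative
       exp (\<i> * (of_real t * of_real x))) (at (of_real x))"
      using assms by (auto intro!: derivative_eq_intros simp: field_simps)
    then have "((\<lambda>x. exp (\<i> * (of_real t * of_real x)) / (\<i> * of_real t)) has_vector_derivative
       exp (\<i> * (of_real t * of_real x))) (at x within S)"
      by (rule has_vector_derivative_real_field)
    then show ?thesis by (simp add: F_def cis_conv_exp)
  qed
  then have "integral\<^sup>L (unif r) (\<lambda>x. cis (t * x)) = (1 / (2 * r)) *\<^sub>R (F r - F (-r))"
    using assms by (intro integral_unif_FTC borel_measurable_continuous_onI) (auto intro!: continuous_intros)
  also have "F r - F (-r) = 2 * of_real (sin (t * r)) / of_real t"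
    using assms by (simp add: F_def complex_eq_iff Re_divide Im_divide field_simps power2_eq_square)
  finally show ?thesis using assms by (simp add: scaleR_conv_of_real field_simps)
qed

abbreviation zone :: "(real \<times> real) measure" where
  "zone \<equiv> unif (pi/2) \<Otimes>\<^sub>M unif pi"

interpretation zone: pair_sigma_finite "unif (pi/2)" "unif pi" ..

interpretation zone: finite_measure zone
  by (rule finite_measure_pair_measure) (rule unif.finite_measure_axioms)+

lemma sets_zone: "sets zone = sets (borel :: (real \<times> real) measure)"
  using sets_pair_measure_cong[OF sets_unif[of "pi/2"] sets_unif[of pi]] by (simp only: borel_prod)

lemma measurable_zoneI: "continuous_on UNIV f \<Longrightarrow> f \<in> borel_measurable zone"
  using borel_measurable_continuous_onI measurable_cong_sets[OF sets_zone refl] by blast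

lemma AE_zone_fst: "(AE x in unif (pi/2). Q x) \<Longrightarrow> AE k in zone. Q (fst k)"
proof -
  assume "AE x in unif (pi/2). Q x"
  then obtain N where N: "N \<in> null_sets (unif (pi/2))" "{x. \<not> Q x} \<subseteq> N"
    by (auto elim!: AE_E simp: null_sets_def)
  have "N \<times> UNIV \<in> null_sets zone"
    using N by (auto simp: null_sets_def unif.emeasure_pair_measure_Times)
  then show ?thesis
    by (rule AE_I') (use N in auto)
qed

text \<open>The frequencies \<open>k = (a, b)\<close> are chosen such that \<open>b1\<close> only sees \<open>a\<close> and the direction
  \<open>b2 - b3\<close> of a grain boundary, with coordinates \<open>(1, 2)\<close>, only sees \<open>b\<close>.\<close>

definition chi :: "int \<times> int \<Rightarrow> real \<times> real \<Rightarrow> complex" where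
  "chi n k = cis (2 * of_int (fst n) * fst k + of_int (snd n) * (snd k - fst k))"

lemma chi_zero [simp]: "chi 0 k = 1" "chi (0, 0) k = 1"
  by (auto simp: chi_def)

lemma chi_add: "chi (n + m) k = chi n k * chi m k"
  by (simp add: chi_def cis_mult algebra_simps)

lemma cnj_chi: "cnj (chi n k) = chi (- n) k"
  by (simp add: chi_def cis_cnj algebra_simps)

lemma norm_chi [simp]: "norm (chi n k) = 1"
  by (simp add: chi_def)

lemma continuous_chi [continuous_intros]: "continuous_on S (chi n)"
  unfolding chi_def by (intro continuous_intros)

lemma integrable_chi: "integrable zone (chi n)"
  by (rule zone.integrable_const_bound[where B = 1]) (auto intro!: measurable_zoneI continuous_intros)

text \<open>The a-frequency \<open>2 * fst n - snd n\<close> may be odd, and odd frequencies do not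
  integrate to 0 over an interval of length pi. The integral over b is therefore taken first: it
  forces \<open>snd n = 0\<close>, after which the a-frequency is even.\<close>

lemma integral_chi: "integral\<^sup>L zone (chi n) = (if n = 0 then 1 else 0)"
proof -
  have 1: "integral\<^sup>L (unif pi) (\<lambda>b. cis (of_int j * b)) = (if j = 0 then 1 else 0)" for j :: int
    using integral_unif_cis[of pi "of_int j"] by (auto simp: sin_zero_iff_int2)
  have 2: "integral\<^sup>L (unif (pi/2)) (\<lambda>b. cis (of_int (2 * j) * b)) = (if j = 0 then 1 else 0)" for j :: int
  proof -
    have "sin (of_int (2 * j) * (pi / 2)) = 0" by (auto simp: sin_zero_iff_int2)
    then show ?thesis using integral_unif_cis[of "pi/2" "of_int (2 * j)"] by auto
  qed
  have "integral\<^sup>L zone (chi n) = (\<integral>a. \<integral>b. chi n (a, b) \<partial>unif pi \<partial>unif (pi/2))"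
    by (rule zone.integral_fst'[symmetric, OF integrable_chi])
  also have "\<dots> = (\<integral>a. cis (of_int (2 * fst n - snd n) * a) * (\<integral>b. cis (of_int (snd n) * b) \<partial>unif pi) \<partial>unif (pi/2))"
    by (subst integral_mult_right_zero[symmetric])
       (intro Bochner_Integration.integral_cong refl, simp add: chi_def cis_mult algebra_simps)
  also have "\<dots> = (if n = 0 then 1 else 0)"
    using 2[of "fst n"] by (auto simp: 1 prod_eq_iff)
  finally show ?thesis .
qed

section \<open>Trigonometric polynomials and the strain energy\<close>

definition finsupp :: "(int \<times> int \<Rightarrow> real) \<Rightarrow> bool" where
  "finsupp f \<longleftrightarrow> finite {n. f n \<noteq> 0}"

definition four :: "(int \<times> int \<Rightarrow> real) \<Rightarrow> real \<times> real \<Rightarrow> complex" where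
  "four f k = (\<Sum>n | f n \<noteq> 0. of_real (f n) * chi n k)"

definition nrm2 :: "(int \<times> int \<Rightarrow> real) \<Rightarrow> real" where
  "nrm2 f = (\<Sum>n | f n \<noteq> 0. (f n)\<^sup>2)"

text \<open>The coefficients are real because near-minimisers must be read back as real fields.
  Conjugation stays inside the class since it reflects the index of a real coefficient
  sequence.\<close>

definition trig :: "(real \<times> real \<Rightarrow> complex) \<Rightarrow> bool" where
  "trig g \<longleftrightarrow> (\<exists>f. finsupp f \<and> g = four f)"

lemma finsuppI: "finite S \<Longrightarrow> (\<And>n. n \<notin> S \<Longrightarrow> f n = 0) \<Longrightarrow> finsupp f"
  unfolding finsupp_def by (rule finite_subset[of _ S]) auto

lemma finsupp_add: "finsupp f \<Longrightarrow> finsupp g \<Longrightarrow> finsupp (\<lambda>n. f n + g n)"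
  by (rule finsuppI[of "{n. f n \<noteq> 0} \<union> {n. g n \<noteq> 0}"]) (auto simp: finsupp_def)

lemma finsupp_diff: "finsupp f \<Longrightarrow> finsupp g \<Longrightarrow> finsupp (\<lambda>n. f n - g n)"
  by (rule finsuppI[of "{n. f n \<noteq> 0} \<union> {n. g n \<noteq> 0}"]) (auto simp: finsupp_def)

lemma finsupp_uminus: "finsupp f \<Longrightarrow> finsupp (\<lambda>n. - f n)"
  by (simp add: finsupp_def)

lemma finsupp_cmult: "finsupp f \<Longrightarrow> finsupp (\<lambda>n. c * f n)"
  by (rule finsuppI[of "{n. f n \<noteq> 0}"]) (auto simp: finsupp_def)

lemma finsupp_inj: "finsupp f \<Longrightarrow> inj h \<Longrightarrow> finsupp (\<lambda>n. f (h n))"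
  unfolding finsupp_def using finite_vimageI[of "{n. f n \<noteq> 0}" h] by (simp add: vimage_def)

lemma finsupp_shift: "finsupp f \<Longrightarrow> finsupp (\<lambda>n. f (n + e))"
  by (rule finsupp_inj) (auto simp: inj_def)

lemmas finsupp_intros = finsupp_add finsupp_diff finsupp_uminus finsupp_cmult finsupp_shift

lemma four_eq:
  assumes "finite S" "\<And>n. n \<notin> S \<Longrightarrow> f n = 0"
  shows "four f k = (\<Sum>n\<in>S. of_real (f n) * chi n k)"
  unfolding four_def using assms by (intro sum.mono_neutral_left) auto

lemma nrm2_eq:
  assumes "finite S" "\<And>n. n \<notin> S \<Longrightarrow> f n = 0"
  shows "nrm2 f = (\<Sum>n\<in>S. (f n)\<^sup>2)"
  unfolding nrm2_def using assms by (intro sum.mono_neutral_left) auto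

lemma four_add:
  assumes "finsupp f" "finsupp g"
  shows "four (\<lambda>n. f n + g n) k = four f k + four g k"
proof -
  define S where "S = {n. f n \<noteq> 0} \<union> {n. g n \<noteq> 0}"
  have S: "finite S" using assms by (simp add: S_def finsupp_def)
  show ?thesis
    by (subst (1 2 3) four_eq[OF S]) (auto simp: S_def sum.distrib algebra_simps)
qed

lemma four_cmult:
  assumes "finsupp f"
  shows "four (\<lambda>n. c * f n) k = of_real c * four f k"
  by (subst (1 2) four_eq[of "{n. f n \<noteq> 0}"])
     (use assms in \<open>auto simp: finsupp_def sum_distrib_left algebra_simps\<close>)

lemma four_uminus: "finsupp f \<Longrightarrow> four (\<lambda>n. - f n) k = - four f k"
  using four_cmult[of f "-1" k] by simp

lemma four_diff: "finsupp f \<Longrightarrow> finsupp g \<Longrightarrow> four (\<lambda>n. f n - g n) k = four f k - four g k"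
  using four_add[of f "\<lambda>n. - g n" k] by (simp add: four_uminus finsupp_uminus)

lemma four_shift: "four (\<lambda>n. f (n + e)) k = chi (- e) k * four f k"
proof -
  have "four (\<lambda>n. f (n + e)) k = (\<Sum>n | f n \<noteq> 0. of_real (f n) * chi (n - e) k)"
    unfolding four_def
    by (rule sum.reindex_bij_witness[of _ "\<lambda>n. n - e" "\<lambda>n. n + e"]) auto
  also have "\<dots> = (\<Sum>n | f n \<noteq> 0. chi (- e) k * (of_real (f n) * chi n k))"
    by (intro sum.cong) (simp_all add: mult_ac flip: chi_add)
  finally show ?thesis by (simp add: four_def sum_distrib_left)
qed

lemma cnj_four: "cnj (four f k) = four (\<lambda>n. f (- n)) k"
  unfolding four_def cnj_sum
  by (rule sum.reindex_bij_witness[of _ "\<lambda>n. - n" "\<lambda>n. - n"]) (auto simp: cnj_chi)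

lemma continuous_four [continuous_intros]: "continuous_on S (four f)"
proof -
  have "four f = (\<lambda>k. \<Sum>n | f n \<noteq> 0. of_real (f n) * chi n k)"
    by (auto simp: four_def)
  then show ?thesis by (auto intro!: continuous_intros)
qed

lemma norm_four_le: "norm (four f k) \<le> (\<Sum>n | f n \<noteq> 0. \<bar>f n\<bar>)"
  unfolding four_def by (rule sum_norm_le) (simp add: norm_mult)

lemma integrable_four_sq: "integrable zone (\<lambda>k. (norm (four f k))\<^sup>2)"
proof (rule zone.integrable_const_bound)
  show "AE k in zone. norm ((norm (four f k))\<^sup>2) \<le> (\<Sum>n | f n \<noteq> 0. \<bar>f n\<bar>)\<^sup>2"
    by (auto intro!: power_mono norm_four_le)
qed (auto intro!: measurable_zoneI continuous_intros)

lemma parseval: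
  assumes "finsupp f"
  shows "(\<integral>k. (norm (four f k))\<^sup>2 \<partial>zone) = nrm2 f"
proof -
  let ?S = "{n. f n \<noteq> 0}"
  have fin: "finite ?S" using assms by (simp add: finsupp_def)
  have "complex_of_real (\<integral>k. (norm (four f k))\<^sup>2 \<partial>zone) = (\<integral>k. of_real ((norm (four f k))\<^sup>2) \<partial>zone)"
    by (rule integral_complex_of_real[symmetric])
  also have "\<dots> = (\<integral>k. (\<Sum>n\<in>?S. \<Sum>m\<in>?S. of_real (f n * f m) * chi (n - m) k) \<partial>zone)"
  proof (rule Bochner_Integration.integral_cong[OF refl])
    fix k
    have "of_real ((norm (four f k))\<^sup>2) = four f k * cnj (four f k)"
      by (rule complex_norm_square)
    also have "\<dots> = (\<Sum>n\<in>?S. \<Sum>m\<in>?S. of_real (f n * f m) * (chi n k * chi (- m) k))"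
      unfolding four_def by (simp add: sum_product cnj_sum cnj_chi mult_ac)
    finally show "of_real ((norm (four f k))\<^sup>2) = (\<Sum>n\<in>?S. \<Sum>m\<in>?S. of_real (f n * f m) * chi (n - m) k)"
      by (simp flip: chi_add)
  qed
  also have "\<dots> = (\<Sum>n\<in>?S. \<Sum>m\<in>?S. of_real (f n * f m) * (if n - m = 0 then 1 else 0))"
    by (subst Bochner_Integration.integral_sum integral_mult_right_zero,
        intro Bochner_Integration.integrable_sum integrable_mult_right integrable_chi)
       (auto intro!: sum.cong simp: integral_chi integrable_chi)
  also have "\<dots> = (\<Sum>n\<in>?S. \<Sum>m\<in>?S. if n = m then of_real (f n * f m) else 0)"
    by (intro sum.cong) auto
  also have "\<dots> = of_real (nrm2 f)"
    using fin by (simp add: nrm2_def power2_eq_square)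
  finally show ?thesis using of_real_eq_iff by blast
qed

section \<open>The algebra of trigonometric polynomials with real coefficients\<close>

lemma trig_four: "finsupp f \<Longrightarrow> trig (four f)"
  by (auto simp: trig_def)

lemma trig_add: "trig g \<Longrightarrow> trig h \<Longrightarrow> trig (\<lambda>k. g k + h k)"
  unfolding trig_def using finsupp_add four_add by (auto simp: fun_eq_iff) metis

lemma trig_cmult: "trig g \<Longrightarrow> trig (\<lambda>k. of_real c * g k)"
  unfolding trig_def using finsupp_cmult four_cmult by (auto simp: fun_eq_iff) metis

lemma trig_diff: "trig g \<Longrightarrow> trig h \<Longrightarrow> trig (\<lambda>k. g k - h k)"
  using trig_add[of g "\<lambda>k. of_real (-1) * h k"] trig_cmult[of h "-1"] by simp

lemma trig_cnj: "trig g \<Longrightarrow> trig (\<lambda>k. cnj (g k))"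
  unfolding trig_def using finsupp_inj[of _ uminus] cnj_four
  by (metis (no_types, lifting) ext inj_uminus)

lemma trig_chi: "trig (chi n)"
proof -
  have "chi n = four (\<lambda>m. if m = n then 1 else 0)"
    by (rule ext, subst four_eq[of "{n}"]) auto
  then show ?thesis by (auto intro!: trig_four finsuppI[of "{n}"] split: if_splits)
qed

lemma trig_const: "trig (\<lambda>k. of_real c)"
  using trig_cmult[OF trig_chi[of 0], of c] by simp

lemma trig_chi_mult: "trig g \<Longrightarrow> trig (\<lambda>k. chi n k * g k)"
proof -
  assume "trig g"
  then obtain f where "finsupp f" "g = four f" by (auto simp: trig_def)
  then show ?thesis
    using four_shift[of f "- n"] finsupp_shift[of f "- n"] trig_four[of "\<lambda>m. f (m + - n)"]
    by (auto simp: fun_eq_iff trig_def)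
qed

lemma trig_sum: "finite S \<Longrightarrow> (\<And>n. n \<in> S \<Longrightarrow> trig (g n)) \<Longrightarrow> trig (\<lambda>k. \<Sum>n\<in>S. g n k)"
  by (induction S rule: finite_induct) (use trig_const[of 0] in \<open>auto intro!: trig_add\<close>)

lemma trig_mult: "trig g \<Longrightarrow> trig h \<Longrightarrow> trig (\<lambda>k. g k * h k)"
proof -
  assume "trig g" and h: "trig h"
  then obtain f where f: "finsupp f" "g = four f" by (auto simp: trig_def)
  have "(\<lambda>k. g k * h k) = (\<lambda>k. \<Sum>n | f n \<noteq> 0. of_real (f n) * (chi n k * h k))"
    by (auto simp: f four_def sum_distrib_left sum_distrib_right mult_ac)
  moreover have "trig \<dots>"
    using f(1) h by (intro trig_sum trig_cmult trig_chi_mult) (auto simp: finsupp_def)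
  ultimately show ?thesis by simp
qed

lemma trig_power: "trig g \<Longrightarrow> trig (\<lambda>k. g k ^ j)"
  by (induction j) (use trig_const[of 1] in \<open>auto intro!: trig_mult\<close>)

lemma trig_one: "trig (\<lambda>k. 1)" using trig_const[of 1] by simp

lemmas trig_intros = trig_four trig_add trig_diff trig_cnj trig_chi trig_one trig_mult trig_power trig_cmult trig_sum

text \<open>Multipliers of the differences along \<open>b1\<close>, \<open>b2\<close>, \<open>b3\<close>. A strain \<open>(d\<^sub>i w\<^sub>i)\<^sub>i\<close> with
  \<open>w\<^sub>1 + w\<^sub>2 + w\<^sub>3 = 0\<close> pairs to zero with \<open>(d\<^sub>2 d\<^sub>3, d\<^sub>1 d\<^sub>3, d\<^sub>1 d\<^sub>2)\<close>; \<open>symb\<close> is the squared norm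
  of this vector, and \<open>eta\<close> its pairing with the slip field.\<close>

definition d1 where "d1 k = chi (-1, 0) k - 1"
definition d2 where "d2 k = chi (0, -1) k - 1"
definition d3 where "d3 k = chi (1, 1) k - 1"

definition symb :: "real \<times> real \<Rightarrow> real" where
  "symb k = (norm (d2 k * d3 k))\<^sup>2 + (norm (d1 k * d3 k))\<^sup>2 + (norm (d1 k * d2 k))\<^sup>2"

definition eta where
  "eta s1 s2 s3 k = four s1 k * (d2 k * d3 k) + four s2 k * (d1 k * d3 k) + four s3 k * (d1 k * d2 k)"

text \<open>Here \<open>w\<^sub>i = u \<bullet> b\<^sub>i\<close> and \<open>s\<^sub>i = \<sigma> \<bullet> b\<^sub>i\<close> on the bonds in direction \<open>b\<^sub>i\<close>, so that
  \<open>w\<^sub>3 = - w\<^sub>1 - w\<^sub>2\<close>.\<close>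

definition strain :: "(int \<times> int \<Rightarrow> real) \<Rightarrow> _ \<Rightarrow> _ \<Rightarrow> (int \<times> int \<Rightarrow> real) \<Rightarrow> (int \<times> int \<Rightarrow> real) \<Rightarrow> real" where
  "strain s1 s2 s3 w1 w2 =
     nrm2 (\<lambda>n. w1 (n + (1, 0)) - w1 n - s1 n) + nrm2 (\<lambda>n. w2 (n + (0, 1)) - w2 n - s2 n) +
     nrm2 (\<lambda>n. w1 n + w2 n - w1 (n + (-1, -1)) - w2 (n + (-1, -1)) - s3 n)"

lemma trig_d: "trig d1" "trig d2" "trig d3"
  unfolding d1_def d2_def d3_def by (intro trig_intros)+

lemma continuous_d [continuous_intros]: "continuous_on S d1" "continuous_on S d2" "continuous_on S d3"
  unfolding d1_def d2_def d3_def by (intro continuous_intros)+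

lemma continuous_symb [continuous_intros]: "continuous_on S symb"
  unfolding symb_def by (intro continuous_intros)

lemma continuous_eta [continuous_intros]: "continuous_on S (eta s1 s2 s3)"
  unfolding eta_def by (intro continuous_intros)

lemma symb_nonneg: "symb k \<ge> 0" by (simp add: symb_def)

lemma norm_d_le: "norm (d1 k) \<le> 2" "norm (d2 k) \<le> 2" "norm (d3 k) \<le> 2"
  unfolding d1_def d2_def d3_def by (rule order_trans[OF norm_triangle_ineq4]; simp)+

lemma symb_le: "symb k \<le> 48"
proof -
  have *: "(norm (x * y))\<^sup>2 \<le> 16" if "norm x \<le> 2" "norm y \<le> 2" for x y :: complex
  proof -
    have "norm (x * y) \<le> 2 * 2" unfolding norm_mult using that by (intro mult_mono) auto
    then have "(norm (x * y))\<^sup>2 \<le> 4\<^sup>2" by (intro power_mono) auto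
    then show ?thesis by simp
  qed
  show ?thesis unfolding symb_def
    using *[OF norm_d_le(2,3), of k k] *[OF norm_d_le(1,3), of k k] *[OF norm_d_le(1,2), of k k] by simp
qed

text \<open>Cauchy-Schwarz in three complex dimensions: the triangle inequality passes to moduli,
  and Lagrange's identity exhibits the defect as a sum of three squares.\<close>

lemma cauchy3:
  fixes m1 m2 m3 g1 g2 g3 :: complex
  shows "(norm (m1 * g1 + m2 * g2 + m3 * g3))\<^sup>2 \<le>
    ((norm m1)\<^sup>2 + (norm m2)\<^sup>2 + (norm m3)\<^sup>2) * ((norm g1)\<^sup>2 + (norm g2)\<^sup>2 + (norm g3)\<^sup>2)"
proof -
  let ?a = "norm m1" and ?b = "norm m2" and ?c = "norm m3"
  let ?x = "norm g1" and ?y = "norm g2" and ?z = "norm g3"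
  have "norm (m1 * g1 + m2 * g2 + m3 * g3) \<le> ?a * ?x + ?b * ?y + ?c * ?z"
    by (metis norm_mult norm_triangle_le add_mono norm_triangle_ineq order_refl)
  then have "(norm (m1 * g1 + m2 * g2 + m3 * g3))\<^sup>2 \<le> (?a * ?x + ?b * ?y + ?c * ?z)\<^sup>2"
    by (intro power_mono) auto
  also have "\<dots> = (?a\<^sup>2 + ?b\<^sup>2 + ?c\<^sup>2) * (?x\<^sup>2 + ?y\<^sup>2 + ?z\<^sup>2) -
      ((?a * ?y - ?b * ?x)\<^sup>2 + (?a * ?z - ?c * ?x)\<^sup>2 + (?b * ?z - ?c * ?y)\<^sup>2)"
    by (simp add: power2_eq_square algebra_simps)
  also have "\<dots> \<le> (?a\<^sup>2 + ?b\<^sup>2 + ?c\<^sup>2) * (?x\<^sup>2 + ?y\<^sup>2 + ?z\<^sup>2)"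
    using zero_le_power2[of "?a * ?y - ?b * ?x"] zero_le_power2[of "?a * ?z - ?c * ?x"]
      zero_le_power2[of "?b * ?z - ?c * ?y"] by linarith
  finally show ?thesis .
qed

text \<open>Parseval in each of the three bond directions. Translating the argument by e multiplies
  the transform by \<open>chi (- e)\<close>, which is how differences become the multipliers
  \<open>d1\<close>, \<open>d2\<close>, \<open>d3\<close>.\<close>

lemma strain_eq_integral:
  assumes "finsupp s1" "finsupp s2" "finsupp s3" "finsupp w1" "finsupp w2"
  shows "strain s1 s2 s3 w1 w2 = (\<integral>k. ((norm (d1 k * four w1 k - four s1 k))\<^sup>2 +
      (norm (d2 k * four w2 k - four s2 k))\<^sup>2 +
      (norm (d3 k * (- four w1 k - four w2 k) - four s3 k))\<^sup>2) \<partial>zone)"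
    and "integrable zone (\<lambda>k. (norm (d1 k * four w1 k - four s1 k))\<^sup>2 +
      (norm (d2 k * four w2 k - four s2 k))\<^sup>2 +
      (norm (d3 k * (- four w1 k - four w2 k) - four s3 k))\<^sup>2)"
proof -
  let ?g1 = "\<lambda>n. w1 (n + (1, 0)) - w1 n - s1 n"
  let ?g2 = "\<lambda>n. w2 (n + (0, 1)) - w2 n - s2 n"
  let ?g3 = "\<lambda>n. w1 n + w2 n - w1 (n + (-1, -1)) - w2 (n + (-1, -1)) - s3 n"
  have fs: "finsupp ?g1" "finsupp ?g2" "finsupp ?g3"
    using assms by (auto intro!: finsupp_intros)
  have "four ?g1 k = d1 k * four w1 k - four s1 k" for k
    using assms by (simp add: four_diff four_add four_shift finsupp_intros d1_def algebra_simps)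
  moreover have "four ?g2 k = d2 k * four w2 k - four s2 k" for k
    using assms by (simp add: four_diff four_add four_shift finsupp_intros d2_def algebra_simps)
  moreover have "four ?g3 k = d3 k * (- four w1 k - four w2 k) - four s3 k" for k
    using assms by (simp add: four_diff four_add four_shift finsupp_intros d3_def algebra_simps)
  ultimately show "strain s1 s2 s3 w1 w2 = (\<integral>k. ((norm (d1 k * four w1 k - four s1 k))\<^sup>2 +
      (norm (d2 k * four w2 k - four s2 k))\<^sup>2 +
      (norm (d3 k * (- four w1 k - four w2 k) - four s3 k))\<^sup>2) \<partial>zone)"
    and "integrable zone (\<lambda>k. (norm (d1 k * four w1 k - four s1 k))\<^sup>2 +
      (norm (d2 k * four w2 k - four s2 k))\<^sup>2 +
      (norm (d3 k * (- four w1 k - four w2 k) - four s3 k))\<^sup>2)"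
    using parseval[OF fs(1)] parseval[OF fs(2)] parseval[OF fs(3)]
      integrable_four_sq[of ?g1] integrable_four_sq[of ?g2] integrable_four_sq[of ?g3]
    by (simp_all add: strain_def)
qed

text \<open>In the zone \<open>d1\<close> vanishes only for a = 0. The three bond characters
  multiply to 1 because the directions sum to 0, so \<open>d2\<close> and \<open>d3\<close> cannot
  both vanish where \<open>d1\<close> does not.\<close>

lemma symb_pos:
  assumes "fst k \<noteq> 0" "\<bar>fst k\<bar> \<le> pi / 2"
  shows "symb k > 0"
proof -
  have 1: "d1 k \<noteq> 0"
  proof
    assume "d1 k = 0"
    then have "cos (2 * fst k) = 1" by (simp add: d1_def chi_def complex_eq_iff)
    then have "sin (fst k) = 0" by (simp add: cos_double_sin)
    then have "fst k = 0"
      using assms sin_eq_0_pi[of "fst k"] pi_gt_zero by (simp add: abs_le_iff)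
    then show False using assms by simp
  qed
  have "chi (-1, 0) k * chi (0, -1) k * chi (1, 1) k = 1"
    by (simp add: chi_def cis_mult)
  then have "d2 k \<noteq> 0 \<or> d3 k \<noteq> 0" using 1 by (auto simp: d1_def d2_def d3_def)
  then have "(norm (d1 k * d2 k))\<^sup>2 > 0 \<or> (norm (d1 k * d3 k))\<^sup>2 > 0" using 1 by auto
  then show ?thesis
    unfolding symb_def
    using zero_le_power2[of "norm (d1 k * d2 k)"] zero_le_power2[of "norm (d1 k * d3 k)"]
      zero_le_power2[of "norm (d2 k * d3 k)"] by linarith
qed

lemma AE_symb_pos: "AE k in zone. symb k > 0"
proof -
  have "AE k in zone. fst k \<noteq> 0" by (rule AE_zone_fst[OF AE_unif_neq])
  moreover have "AE k in zone. - (pi/2) \<le> fst k \<and> fst k \<le> pi / 2" by (rule AE_zone_fst[OF AE_unif_bounds])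
  ultimately show ?thesis by eventually_elim (rule symb_pos, auto simp: abs_le_iff)
qed

section \<open>Projection of a slip field onto the strains of displacements\<close>

context
  fixes s1 s2 s3 :: "int \<times> int \<Rightarrow> real"
  assumes s: "finsupp s1" "finsupp s2" "finsupp s3"
begin

text \<open>Pairing the residual with \<open>(d2 d3, d1 d3, d1 d2)\<close> cancels every
  contribution of the displacement and leaves minus \<open>eta\<close>; Cauchy-Schwarz then bounds
  the residual from below. The numbers \<open>w1\<close>, \<open>w2\<close> are arbitrary: Fourier
  values give the lower bound on the strain, zeros give an integrable majorant. Where
  \<open>symb k = 0\<close> the quotient is 0.\<close>

lemma eta_le: "(norm (eta s1 s2 s3 k))\<^sup>2 / symb k \<le>
   (norm (d1 k * w1 - four s1 k))\<^sup>2 + (norm (d2 k * w2 - four s2 k))\<^sup>2 +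
      (norm (d3 k * (- w1 - w2) - four s3 k))\<^sup>2" (is "?l \<le> ?r")
proof (cases "symb k = 0")
  case False
  then have p: "symb k > 0" using symb_nonneg[of k] by simp
  have "- eta s1 s2 s3 k = (d2 k * d3 k) * (d1 k * w1 - four s1 k) + (d1 k * d3 k) * (d2 k * w2 - four s2 k)
      + (d1 k * d2 k) * (d3 k * (- w1 - w2) - four s3 k)"
    by (simp add: eta_def algebra_simps)
  then have "(norm (eta s1 s2 s3 k))\<^sup>2 \<le> symb k * ?r"
    using cauchy3 unfolding symb_def by (metis norm_minus_cancel)
  then show ?thesis using p by (simp add: divide_le_eq mult.commute)
qed simp

lemma integrable_eta: "integrable zone (\<lambda>k. (norm (eta s1 s2 s3 k))\<^sup>2 / symb k)"
proof (rule Bochner_Integration.integrable_bound)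
  show "integrable zone (\<lambda>k. (norm (four s1 k))\<^sup>2 + (norm (four s2 k))\<^sup>2 + (norm (four s3 k))\<^sup>2)"
    by (intro Bochner_Integration.integrable_add integrable_four_sq)
  show "(\<lambda>k. (norm (eta s1 s2 s3 k))\<^sup>2 / symb k) \<in> borel_measurable zone"
    by (intro borel_measurable_divide measurable_zoneI continuous_intros)
  show "AE k in zone. norm ((norm (eta s1 s2 s3 k))\<^sup>2 / symb k)
      \<le> norm ((norm (four s1 k))\<^sup>2 + (norm (four s2 k))\<^sup>2 + (norm (four s3 k))\<^sup>2)"
    using eta_le[of _ 0 0] by (intro AE_I2) (simp add: symb_nonneg)
qed

lemma strain_ge:
  assumes "finsupp w1" "finsupp w2"
  shows "(\<integral>k. (norm (eta s1 s2 s3 k))\<^sup>2 / symb k \<partial>zone) \<le> strain s1 s2 s3 w1 w2"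
  unfolding strain_eq_integral(1)[OF s assms]
  by (rule integral_mono[OF integrable_eta strain_eq_integral(2)[OF s assms] eta_le])

text \<open>The minimising field is \<open>w\<^sub>i = N\<^sub>i / symb\<close>, which is not a trigonometric polynomial; it is
  approximated by replacing \<open>1 / symb\<close> with the partial sums of its Neumann series.\<close>

lemma strain_approx:
  shows "\<exists>w1 w2. (\<forall>K::nat. finsupp (w1 K) \<and> finsupp (w2 K)) \<and>
    (\<lambda>K. strain s1 s2 s3 (w1 K) (w2 K)) \<longlonglongrightarrow> (\<integral>k. (norm (eta s1 s2 s3 k))\<^sup>2 / symb k \<partial>zone)"
proof -
  let ?s1 = "four s1" and ?s2 = "four s2" and ?s3 = "four s3" and ?e = "eta s1 s2 s3"
  define m1 m2 m3 where "m1 k = d2 k * d3 k" and "m2 k = d1 k * d3 k" and "m3 k = d1 k * d2 k" for k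
  \<comment> \<open>Since \<open>symb\<close> is at most 48, dividing by 49 puts
    \<open>1 - symb k / 49\<close> between 1/49 and 1, strictly below 1 where \<open>symb\<close> is
    positive; there \<open>p\<close> converges to \<open>1 / symb\<close>.\<close>
  define p where "p K k = (1/49) * (\<Sum>j<K. (1 - symb k / 49) ^ j)" for K :: nat and k
  \<comment> \<open>The residual of the projection is \<open>- eta * cnj m\<^sub>i / symb\<close>.
    Solving for the first strain gives \<open>symb * d1 * w1 = m2 * (s1 * cnj m2 - s2 * cnj m1) + m3
    * (s1 * cnj m3 - s3 * cnj m1)\<close>; both \<open>m2\<close> and \<open>m3\<close> contain
    \<open>d1\<close>, so the division by \<open>d1\<close> leaves a polynomial. The same works for
    \<open>N2\<close>.\<close>
  define N1 where "N1 k = d3 k * (?s1 k * cnj (m2 k) - ?s2 k * cnj (m1 k)) +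
    d2 k * (?s1 k * cnj (m3 k) - ?s3 k * cnj (m1 k))" for k
  define N2 where "N2 k = d1 k * (?s2 k * cnj (m3 k) - ?s3 k * cnj (m2 k)) +
    d3 k * (?s2 k * cnj (m1 k) - ?s1 k * cnj (m2 k))" for k
  have symc: "of_real (symb k) = m1 k * cnj (m1 k) + m2 k * cnj (m2 k) + m3 k * cnj (m3 k)" for k
    unfolding symb_def m1_def m2_def m3_def of_real_add by (simp only: complex_norm_square)
  have tm: "trig m1" "trig m2" "trig m3"
    unfolding m1_def m2_def m3_def by (intro trig_intros trig_d)+
  have ts: "trig (\<lambda>k. of_real (symb k))"
    unfolding symc by (intro trig_intros tm)
  have "trig (\<lambda>k. of_real (1/49) * (\<Sum>j<K. (1 - of_real (1/49) * of_real (symb k)) ^ j))" for K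
    by (intro trig_intros ts) auto
  then have tp: "trig (\<lambda>k. of_real (p K k))" for K
    by (simp add: p_def)
  have tN: "trig N1" "trig N2"
    unfolding N1_def N2_def by (intro trig_intros tm s trig_d)+
  have "\<exists>w1. finsupp w1 \<and> (\<lambda>k. N1 k * of_real (p K k)) = four w1" for K
    using trig_mult[OF tN(1) tp[of K]] by (simp add: trig_def)
  then obtain w1 where w1: "finsupp (w1 K)" "(\<lambda>k. N1 k * of_real (p K k)) = four (w1 K)" for K
    by metis
  have "\<exists>w2. finsupp w2 \<and> (\<lambda>k. N2 k * of_real (p K k)) = four w2" for K
    using trig_mult[OF tN(2) tp[of K]] by (simp add: trig_def)
  then obtain w2 where w2: "finsupp (w2 K)" "(\<lambda>k. N2 k * of_real (p K k)) = four (w2 K)" for K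
    by metis
  define t where "t K k = symb k * p K k" for K k
  have t: "t K k = 1 - (1 - symb k / 49) ^ K" for K k
    using power_diff_1_eq[of "1 - symb k / 49" K] by (simp add: t_def p_def)
  have t01: "0 \<le> t K k" "t K k \<le> 1" for K k
    using symb_nonneg[of k] symb_le[of k] by (auto simp: t intro!: power_le_one)
  let ?F = "\<lambda>K k. ((norm (d1 k * four (w1 K) k - ?s1 k))\<^sup>2 +
      (norm (d2 k * four (w2 K) k - ?s2 k))\<^sup>2 +
      (norm (d3 k * (- four (w1 K) k - four (w2 K) k) - ?s3 k))\<^sup>2)"
  \<comment> \<open>The negated residual of the K-th approximant: the slip field itself where
    \<open>t = 0\<close>, the projection residual where \<open>t = 1\<close>.\<close>
  define r where "r S m K k = of_real (1 - t K k) * S + ?e k * cnj m * of_real (p K k)" for S m K k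
  have r1: "d1 k * four (w1 K) k - ?s1 k = - r (?s1 k) (m1 k) K k" for K k
    unfolding r_def t_def of_real_mult of_real_diff symc w1(2)[symmetric, THEN fun_cong] N1_def eta_def
    by (simp add: m1_def m2_def m3_def algebra_simps)
  have r2: "d2 k * four (w2 K) k - ?s2 k = - r (?s2 k) (m2 k) K k" for K k
    unfolding r_def t_def of_real_mult of_real_diff symc w2(2)[symmetric, THEN fun_cong] N2_def eta_def
    by (simp add: m1_def m2_def m3_def algebra_simps)
  have r3: "d3 k * (- four (w1 K) k - four (w2 K) k) - ?s3 k = - r (?s3 k) (m3 k) K k" for K k
    unfolding r_def t_def of_real_mult of_real_diff symc w1(2)[symmetric, THEN fun_cong]
      w2(2)[symmetric, THEN fun_cong] N1_def N2_def eta_def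
    by (simp add: m1_def m2_def m3_def algebra_simps)
  define B where "B = (\<Sum>n | s1 n \<noteq> 0. \<bar>s1 n\<bar>) + (\<Sum>n | s2 n \<noteq> 0. \<bar>s2 n\<bar>) + (\<Sum>n | s3 n \<noteq> 0. \<bar>s3 n\<bar>)"
  have B0: "B \<ge> 0" unfolding B_def by (intro add_nonneg_nonneg sum_nonneg) auto
  have nn: "(\<Sum>n | f n \<noteq> 0. \<bar>f n\<bar>) \<ge> 0" for f :: "int \<times> int \<Rightarrow> real"
    by (intro sum_nonneg) auto
  have sB: "norm (?s1 k) \<le> B" "norm (?s2 k) \<le> B" "norm (?s3 k) \<le> B" for k
    using norm_four_le[of s1 k] norm_four_le[of s2 k] norm_four_le[of s3 k] nn[of s1] nn[of s2] nn[of s3]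
    unfolding B_def by linarith+
  \<comment> \<open>The domination. As K grows, \<open>p\<close> blows up at the zeros of
    \<open>symb\<close>, but it always comes multiplied by \<open>eta\<close> and some
    \<open>m\<^sub>i\<close>, whose product is at most \<open>sqrt 3 * B * symb\<close>, hence at
    most \<open>2 * B * symb\<close>. With \<open>symb * p = t \<le> 1\<close> the residual is at
    most \<open>B + 2 * B\<close>.\<close>
  have rB: "(norm (r S m K k))\<^sup>2 \<le> (3 * B)\<^sup>2"
    if k: "symb k > 0" and S: "norm S \<le> B" and m: "(norm m)\<^sup>2 \<le> symb k" for S m K k
  proof -
    have "(norm (?e k))\<^sup>2 / symb k \<le> B\<^sup>2 + B\<^sup>2 + B\<^sup>2"
      using eta_le[of k 0 0] power_mono[OF sB(1)[of k], of 2] power_mono[OF sB(2)[of k], of 2] power_mono[OF sB(3)[of k], of 2] by simp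
    then have 1: "(norm (?e k))\<^sup>2 \<le> 3 * B\<^sup>2 * symb k" using k by (simp add: field_simps)
    have "(norm (?e k) * norm m)\<^sup>2 \<le> 3 * B\<^sup>2 * symb k * symb k"
      unfolding power_mult_distrib using 1 m k by (intro mult_mono) auto
    also have "\<dots> \<le> (2 * B * symb k)\<^sup>2" using B0 k by (simp add: power2_eq_square)
    finally have 2: "norm (?e k) * norm m \<le> 2 * B * symb k"
      by (rule power2_le_imp_le) (use B0 k in simp)
    have p0: "p K k \<ge> 0" using t01(1)[of K k] k by (simp add: t_def zero_le_mult_iff)
    have "norm (r S m K k) \<le> norm (of_real (1 - t K k) * S) + norm (?e k * cnj m * of_real (p K k))"
      unfolding r_def by (rule norm_triangle_ineq)
    also have "\<dots> = (1 - t K k) * norm S + norm (?e k) * norm m * p K k"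
      using t01[of K k] p0 unfolding norm_mult norm_of_real complex_mod_cnj by simp
    also have "\<dots> \<le> 1 * B + 2 * B * symb k * p K k"
      using t01[of K k] mult_right_mono[OF 2 p0]
        mult_mono[of "1 - t K k" 1 "norm S" B] S B0 by (simp add: mult_ac)
    also have "\<dots> = B + 2 * B * t K k" by (simp add: t_def)
    also have "\<dots> \<le> B + 2 * B * 1" using t01[of K k] B0 by (intro add_left_mono mult_left_mono) auto
    finally show ?thesis by (intro power_mono) auto
  qed
  have mk: "(norm (m1 k))\<^sup>2 \<le> symb k" "(norm (m2 k))\<^sup>2 \<le> symb k" "(norm (m3 k))\<^sup>2 \<le> symb k" for k
    by (simp_all add: symb_def m1_def m2_def m3_def)
  have tl: "(\<lambda>K. t K k) \<longlonglongrightarrow> 1" if "symb k > 0" for k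
  proof -
    have "(\<lambda>K. (1 - symb k / 49) ^ K) \<longlonglongrightarrow> 0"
      using that symb_le[of k] by (intro LIMSEQ_power_zero) auto
    from tendsto_diff[OF tendsto_const[of 1] this] show ?thesis by (simp add: t)
  qed
  have pl: "(\<lambda>K. p K k) \<longlonglongrightarrow> 1 / symb k" if "symb k > 0" for k
  proof -
    have "p K k = t K k / symb k" for K using that by (simp add: t_def)
    with tendsto_divide[OF tl[OF that] tendsto_const[of "symb k"]] that show ?thesis by simp
  qed
  have rl: "(\<lambda>K. r S m K k) \<longlonglongrightarrow> ?e k * cnj m / of_real (symb k)" if "symb k > 0" for S m k
  proof -
    have "(\<lambda>K. r S m K k) \<longlonglongrightarrow> of_real (1 - 1) * S + ?e k * cnj m * of_real (1 / symb k)"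
      unfolding r_def by (intro tendsto_intros tl pl that)
    then show ?thesis by simp
  qed
  have "(\<lambda>K. \<integral>k. ?F K k \<partial>zone) \<longlonglongrightarrow> (\<integral>k. (norm (?e k))\<^sup>2 / symb k \<partial>zone)"
  proof (rule integral_dominated_convergence[where w = "\<lambda>k. 3 * (3 * B)\<^sup>2"])
    show "AE k in zone. (\<lambda>K. ?F K k) \<longlonglongrightarrow> (norm (?e k))\<^sup>2 / symb k"
      using AE_symb_pos
    proof eventually_elim
      fix k assume k: "symb k > 0"
      have "(\<lambda>K. ?F K k) \<longlonglongrightarrow> (norm (?e k * cnj (m1 k) / of_real (symb k)))\<^sup>2 +
         (norm (?e k * cnj (m2 k) / of_real (symb k)))\<^sup>2 + (norm (?e k * cnj (m3 k) / of_real (symb k)))\<^sup>2"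
        unfolding r1 r2 r3 norm_minus_cancel by (intro tendsto_intros rl k)
      moreover have "(norm (?e k * cnj (m1 k) / of_real (symb k)))\<^sup>2 +
         (norm (?e k * cnj (m2 k) / of_real (symb k)))\<^sup>2 + (norm (?e k * cnj (m3 k) / of_real (symb k)))\<^sup>2
         = (norm (?e k))\<^sup>2 * ((norm (m1 k))\<^sup>2 + (norm (m2 k))\<^sup>2 + (norm (m3 k))\<^sup>2) / (symb k)\<^sup>2"
        using k by (simp add: norm_mult norm_divide power_mult_distrib power_divide add_divide_distrib distrib_left)
      moreover have "(norm (m1 k))\<^sup>2 + (norm (m2 k))\<^sup>2 + (norm (m3 k))\<^sup>2 = symb k"
        by (simp add: symb_def m1_def m2_def m3_def)
      moreover have "(norm (?e k))\<^sup>2 * symb k / (symb k)\<^sup>2 = (norm (?e k))\<^sup>2 / symb k"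
        using k by (simp add: power2_eq_square)
      ultimately show "(\<lambda>K. ?F K k) \<longlonglongrightarrow> (norm (?e k))\<^sup>2 / symb k" by simp
    qed
    show "AE k in zone. norm (?F K k) \<le> 3 * (3 * B)\<^sup>2" for K
      using AE_symb_pos
    proof eventually_elim
      fix k assume k: "symb k > 0"
      show "norm (?F K k) \<le> 3 * (3 * B)\<^sup>2"
        unfolding r1 r2 r3 norm_minus_cancel
        using rB[OF k sB(1) mk(1), of k K] rB[OF k sB(2) mk(2), of k K] rB[OF k sB(3) mk(3), of k K] by simp
    qed
    show "(\<lambda>k. (norm (?e k))\<^sup>2 / symb k) \<in> borel_measurable zone"
      by (intro borel_measurable_divide measurable_zoneI continuous_intros)
    show "?F K \<in> borel_measurable zone" for K
      by (intro measurable_zoneI continuous_intros)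
  qed simp
  then show ?thesis
    using w1(1) w2(1) strain_eq_integral(1)[OF s w1(1) w2(1)]
    by (intro exI[of _ w1] exI[of _ w2]) simp
qed

end

section \<open>Least squares and the thermodynamic limit\<close>

text \<open>Gram-Schmidt, one column at a time. The induction hypothesis is applied to two
  right-hand sides: to \<open>s\<close>, and to the new column \<open>A i\<close>, which it splits
  into a combination of the old columns and a part \<open>t\<close> orthogonal to them. Correcting
  the residual along \<open>t\<close> keeps orthogonality to the old columns and adds it for the new
  one.\<close>

lemma normal_equations:
  fixes A :: "'j \<Rightarrow> 'e \<Rightarrow> real" and s :: "'e \<Rightarrow> real"
  assumes "finite J" "finite E"
  shows "\<exists>c. \<forall>k\<in>J. (\<Sum>e\<in>E. (s e - (\<Sum>j\<in>J. c j * A j e)) * A k e) = 0"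
  using assms(1)
proof (induction J arbitrary: s rule: finite_induct)
  case (insert i J)
  obtain c where c: "\<forall>k\<in>J. (\<Sum>e\<in>E. (s e - (\<Sum>j\<in>J. c j * A j e)) * A k e) = 0"
    using insert.IH by blast
  obtain a where a: "\<forall>k\<in>J. (\<Sum>e\<in>E. (A i e - (\<Sum>j\<in>J. a j * A j e)) * A k e) = 0"
    using insert.IH by blast
  define r where "r e = s e - (\<Sum>j\<in>J. c j * A j e)" for e
  define t where "t e = A i e - (\<Sum>j\<in>J. a j * A j e)" for e
  \<comment> \<open>If the new column depends on the old ones, then \<open>t\<close> vanishes on
    \<open>E\<close>, and \<open>l\<close> is 0 by division by zero.\<close>
  define l where "l = (\<Sum>e\<in>E. r e * t e) / (\<Sum>e\<in>E. t e * t e)"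
  have l: "(\<Sum>e\<in>E. (r e - l * t e) * t e) = 0"
  proof (cases "(\<Sum>e\<in>E. t e * t e) = 0")
    case True
    then have "t e = 0" if "e \<in> E" for e
      using that assms(2) by (subst (asm) sum_nonneg_eq_0_iff) auto
    then show ?thesis by simp
  next
    case False
    have "(\<Sum>e\<in>E. (r e - l * t e) * t e) = (\<Sum>e\<in>E. r e * t e) - l * (\<Sum>e\<in>E. t e * t e)"
      by (simp add: left_diff_distrib sum_subtractf mult.assoc sum_distrib_left)
    with False show ?thesis by (simp add: l_def)
  qed
  have k: "(\<Sum>e\<in>E. (r e - l * t e) * A k e) = 0" if "k \<in> J" for k
    using c a that by (simp add: r_def[symmetric] t_def[symmetric] left_diff_distrib sum_subtractf
        mult.assoc sum_distrib_left[symmetric])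
  have i: "(\<Sum>e\<in>E. (r e - l * t e) * A i e) = 0"
  proof -
    have "(\<Sum>e\<in>E. (r e - l * t e) * A i e) =
        (\<Sum>e\<in>E. (r e - l * t e) * t e + (\<Sum>j\<in>J. a j * ((r e - l * t e) * A j e)))"
    proof (rule sum.cong[OF refl])
      fix e
      have "A i e = t e + (\<Sum>j\<in>J. a j * A j e)" by (simp add: t_def)
      then show "(r e - l * t e) * A i e = (r e - l * t e) * t e + (\<Sum>j\<in>J. a j * ((r e - l * t e) * A j e))"
        by (simp only: distrib_left sum_distrib_left) (simp add: mult_ac)
    qed
    also have "\<dots> = (\<Sum>e\<in>E. (r e - l * t e) * t e) + (\<Sum>j\<in>J. a j * (\<Sum>e\<in>E. (r e - l * t e) * A j e))"
      by (simp add: sum.distrib sum_distrib_left sum.swap[of _ E J])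
    finally show ?thesis using l k by simp
  qed
  define c' where "c' j = (if j = i then l else c j - l * a j)" for j
  have "s e - (\<Sum>j\<in>insert i J. c' j * A j e) = r e - l * t e" for e
  proof -
    have "(\<Sum>j\<in>J. c' j * A j e) = (\<Sum>j\<in>J. c j * A j e) - l * (\<Sum>j\<in>J. a j * A j e)"
      using insert.hyps unfolding sum_distrib_left sum_subtractf[symmetric]
      by (intro sum.cong) (auto simp: c'_def algebra_simps)
    then show ?thesis
      using insert.hyps by (simp add: c'_def r_def t_def algebra_simps)
  qed
  then show ?case using i k by (intro exI[of _ c']) auto
qed simp

text \<open>The residual of a solution of the normal equations is orthogonal to all columns, so the
  cross term disappears when the competitor is expanded around it.\<close>

lemma least_squares:
  fixes A :: "'j \<Rightarrow> 'e \<Rightarrow> real" and s :: "'e \<Rightarrow> real"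
  assumes "finite J" "finite E"
  shows "\<exists>c. \<forall>c'. (\<Sum>e\<in>E. ((\<Sum>j\<in>J. c j * A j e) - s e)\<^sup>2) \<le> (\<Sum>e\<in>E. ((\<Sum>j\<in>J. c' j * A j e) - s e)\<^sup>2)"
proof -
  obtain c where c: "\<And>k. k \<in> J \<Longrightarrow> (\<Sum>e\<in>E. (s e - (\<Sum>j\<in>J. c j * A j e)) * A k e) = 0"
    using normal_equations[OF assms, of s A] by blast
  show ?thesis
  proof (intro exI allI)
    fix c'
    define h where "h e = (\<Sum>j\<in>J. (c' j - c j) * A j e)" for e
    define r where "r e = (\<Sum>j\<in>J. c j * A j e) - s e" for e
    have "(\<Sum>e\<in>E. r e * h e) = (\<Sum>j\<in>J. (c' j - c j) * (\<Sum>e\<in>E. r e * A j e))"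
      unfolding h_def sum_distrib_left by (subst sum.swap) (simp add: mult_ac)
    also have "\<dots> = (\<Sum>j\<in>J. (c' j - c j) * - (\<Sum>e\<in>E. (s e - (\<Sum>j\<in>J. c j * A j e)) * A j e))"
      unfolding r_def sum_negf[symmetric] by (simp add: algebra_simps)
    finally have "(\<Sum>e\<in>E. r e * h e) = 0" using c by simp
    moreover have "(\<Sum>j\<in>J. c' j * A j e) - s e = r e + h e" for e
      by (simp add: r_def h_def left_diff_distrib sum_subtractf)
    then have "(\<Sum>e\<in>E. ((\<Sum>j\<in>J. c' j * A j e) - s e)\<^sup>2) = (\<Sum>e\<in>E. (r e)\<^sup>2) + 2 * (\<Sum>e\<in>E. r e * h e) + (\<Sum>e\<in>E. (h e)\<^sup>2)"
      by (simp add: power2_sum sum.distrib sum_distrib_left mult_ac)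
    ultimately show "(\<Sum>e\<in>E. ((\<Sum>j\<in>J. c j * A j e) - s e)\<^sup>2) \<le> (\<Sum>e\<in>E. ((\<Sum>j\<in>J. c' j * A j e) - s e)\<^sup>2)"
      by (simp add: r_def sum_nonneg)
  qed
qed

lemma finsupp_supp: "finite B \<Longrightarrow> (\<And>n. n \<notin> B \<Longrightarrow> w n = 0) \<Longrightarrow> finsupp w"
  by (rule finsuppI) auto

text \<open>Attainment in a box, a least squares problem with finitely many unknowns. The unknown
  \<open>(b, p)\<close> is the value at the site \<open>p\<close> of the first component if
  \<open>b\<close> holds and of the second otherwise; the equation \<open>(i, n)\<close> belongs to
  the bond in direction i at \<open>n\<close>. \<open>S\<close> collects the slipped bonds and the
  bonds touching \<open>B\<close>.\<close>

lemma strain_min: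
  assumes s: "finsupp s1" "finsupp s2" "finsupp s3" and B: "finite B"
  shows "\<exists>w1 w2. (\<forall>n. n \<notin> B \<longrightarrow> w1 n = 0 \<and> w2 n = 0) \<and>
    (\<forall>v1 v2. (\<forall>n. n \<notin> B \<longrightarrow> v1 n = 0 \<and> v2 n = 0) \<longrightarrow>
       strain s1 s2 s3 w1 w2 \<le> strain s1 s2 s3 v1 v2)"
proof -
  define S where "S = {n. s1 n \<noteq> 0} \<union> {n. s2 n \<noteq> 0} \<union> {n. s3 n \<noteq> 0} \<union> B \<union> (\<lambda>n. n - (1, 0)) ` B
     \<union> (\<lambda>n. n - (0, 1)) ` B \<union> (\<lambda>n. n - (-1, -1)) ` B"
  have S: "finite S" using s B by (auto simp: S_def finsupp_def)
  define E where "E = {1::nat, 2, 3} \<times> S"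
  define J where "J = {True, False} \<times> B"
  define t where "t e = (if fst e = 1 then s1 (snd e) else if fst e = 2 then s2 (snd e) else s3 (snd e))" for e :: "nat \<times> _"
  define \<delta> where "\<delta> p n = (if p = n then 1 else 0 :: real)" for p n :: "int \<times> int"
  define A where "A j e = (case j of (b, p) \<Rightarrow> case e of (i, n) \<Rightarrow>
     if i = 1 then (if b then \<delta> p (n + (1, 0)) - \<delta> p n else 0)
     else if i = 2 then (if b then 0 else \<delta> p (n + (0, 1)) - \<delta> p n)
     else \<delta> p n - \<delta> p (n + (-1, -1)))" for j and e :: "nat \<times> int \<times> int"
  let ?Q = "\<lambda>c. \<Sum>e\<in>E. ((\<Sum>j\<in>J. c j * A j e) - t e)\<^sup>2"
  have \<delta>: "(\<Sum>p\<in>B. w p * \<delta> p n) = w n" if "\<forall>n. n \<notin> B \<longrightarrow> w n = 0" for w n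
  proof -
    have "(\<Sum>p\<in>B. w p * \<delta> p n) = (\<Sum>p\<in>B. if p = n then w p else 0)"
      by (intro sum.cong) (auto simp: \<delta>_def)
    then show ?thesis using that[THEN spec, of n] B by (cases "n \<in> B") (simp_all only: sum.delta if_True if_False simp_thms)
  qed
  have eq: "?Q c = strain s1 s2 s3 (\<lambda>p. c (True, p)) (\<lambda>p. c (False, p))"
    if c: "\<forall>n. n \<notin> B \<longrightarrow> c (True, n) = 0 \<and> c (False, n) = 0" for c
  proof -
    have d: "(\<Sum>p\<in>B. c (b, p) * \<delta> p n) = c (b, n)" for b n
      using \<delta>[of "\<lambda>p. c (b, p)" n] c by (cases b) simp_all
    have Js: "(\<Sum>j\<in>J. f j) = (\<Sum>p\<in>B. f (True, p)) + (\<Sum>p\<in>B. f (False, p))" for f :: "_ \<Rightarrow> real"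
      unfolding J_def sum.cartesian_product' by simp
    have Es: "(\<Sum>e\<in>E. f e) = (\<Sum>n\<in>S. f (1, n)) + (\<Sum>n\<in>S. f (2, n)) + (\<Sum>n\<in>S. f (3, n))" for f :: "_ \<Rightarrow> real"
      unfolding E_def sum.cartesian_product' by simp
    have off: "c (b, n) = 0" if "n \<notin> B" for b n using c[THEN spec, of n] that by (cases b) simp_all
    have z: "c (b, n) = 0" "c (b, n + (1, 0)) = 0" "c (b, n + (0, 1)) = 0" "c (b, n + (-1, -1)) = 0"
       "s1 n = 0" "s2 n = 0" "s3 n = 0" if "n \<notin> S" for b n
    proof -
      have "n + e \<notin> B" if "n \<notin> (\<lambda>n. n - e) ` B" for e
        using that image_eqI[of n "\<lambda>n. n - e" "n + e" B] by auto
      then show "c (b, n + (1, 0)) = 0" "c (b, n + (0, 1)) = 0" "c (b, n + (-1, -1)) = 0"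
        using that unfolding S_def by (blast intro: off)+
      show "c (b, n) = 0" "s1 n = 0" "s2 n = 0" "s3 n = 0"
        using that unfolding S_def by (blast intro: off)+
    qed
    have A: "(\<Sum>j\<in>J. c j * A j (1, n)) = c (True, n + (1, 0)) - c (True, n)"
      "(\<Sum>j\<in>J. c j * A j (2, n)) = c (False, n + (0, 1)) - c (False, n)"
      "(\<Sum>j\<in>J. c j * A j (3, n)) = c (True, n) + c (False, n) - c (True, n + (-1, -1)) - c (False, n + (-1, -1))" for n
      unfolding Js by (simp_all add: A_def right_diff_distrib sum_subtractf d)
    have N: "nrm2 (\<lambda>n. c (True, n + (1, 0)) - c (True, n) - s1 n) = (\<Sum>n\<in>S. (c (True, n + (1, 0)) - c (True, n) - s1 n)\<^sup>2)"
      "nrm2 (\<lambda>n. c (False, n + (0, 1)) - c (False, n) - s2 n) = (\<Sum>n\<in>S. (c (False, n + (0, 1)) - c (False, n) - s2 n)\<^sup>2)"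
      "nrm2 (\<lambda>n. c (True, n) + c (False, n) - c (True, n + (-1, -1)) - c (False, n + (-1, -1)) - s3 n) =
        (\<Sum>n\<in>S. (c (True, n) + c (False, n) - c (True, n + (-1, -1)) - c (False, n + (-1, -1)) - s3 n)\<^sup>2)"
      by (rule nrm2_eq[OF S], simp add: z)+
    show ?thesis
      unfolding strain_def N Es A by (simp add: t_def)
  qed
  obtain c where c: "\<And>c'. ?Q c \<le> ?Q c'"
    using least_squares[of J E A t] S B by (auto simp: E_def J_def)
  \<comment> \<open>Least squares leaves the coefficients outside \<open>B\<close> undetermined;
    they are set to 0 so that the solution is an admissible field.\<close>
  define r where "r f j = (if snd j \<in> B then f j else 0)" for f :: "bool \<times> int \<times> int \<Rightarrow> real" and j
  have Qr: "?Q (r f) = ?Q f" for f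
  proof -
    have "(\<Sum>j\<in>J. r f j * A j e) = (\<Sum>j\<in>J. f j * A j e)" for e
      by (intro sum.cong refl) (simp add: r_def J_def mem_Times_iff)
    then show ?thesis by simp
  qed
  show ?thesis
  proof (rule exI[of _ "\<lambda>p. r c (True, p)"], rule exI[of _ "\<lambda>p. r c (False, p)"], intro conjI allI impI)
    fix v1 v2 :: "int \<times> int \<Rightarrow> real" assume v: "\<forall>n. n \<notin> B \<longrightarrow> v1 n = 0 \<and> v2 n = 0"
    define c' where "c' j = (if fst j then v1 (snd j) else v2 (snd j))" for j
    have "?Q (r c) \<le> ?Q c'" using c Qr by simp
    also have "?Q c' = strain s1 s2 s3 v1 v2"
      using v by (subst eq) (simp_all add: c'_def)
    also have "?Q (r c) = strain s1 s2 s3 (\<lambda>p. r c (True, p)) (\<lambda>p. r c (False, p))"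
      by (rule eq) (simp add: r_def)
    finally show "strain s1 s2 s3 (\<lambda>p. r c (True, p)) (\<lambda>p. r c (False, p)) \<le> strain s1 s2 s3 v1 v2" .
  qed (auto simp: r_def)
qed

section \<open>Exhaustion of the lattice by boxes\<close>

definition ibox :: "nat \<Rightarrow> (int \<times> int) set" where
  "ibox N = {\<lfloor>- real N / 2 + 1\<rfloor>..\<lfloor>real N / 2\<rfloor>} \<times> {\<lfloor>- real N / 2 + 1\<rfloor>..\<lfloor>real N / 2\<rfloor>}"

lemma finite_ibox: "finite (ibox N)" by (simp add: ibox_def)

lemma ibox_exhausts:
  assumes "finite S"
  shows "\<exists>N0. \<forall>N\<ge>N0. S \<subseteq> ibox N"
  using assms
proof (induction S rule: finite_induct)
  case (insert x S)
  then obtain N0 where N0: "\<And>N. N \<ge> N0 \<Longrightarrow> S \<subseteq> ibox N" by blast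
  obtain a b where x: "x = (a, b)" by (cases x)
  define M where "M = nat (2 * \<bar>a\<bar> + 2 * \<bar>b\<bar> + 2)"
  have "x \<in> ibox N" if "N \<ge> M" for N
  proof -
    have "2 * \<bar>a\<bar> + 2 * \<bar>b\<bar> + 2 \<le> int N" using that by (simp add: M_def)
    then have "real_of_int (2 * \<bar>a\<bar> + 2 * \<bar>b\<bar> + 2) \<le> real_of_int (int N)" by (simp only: of_int_le_iff)
    then have "2 * \<bar>real_of_int a\<bar> + 2 * \<bar>real_of_int b\<bar> + 2 \<le> real N" by simp
    then show ?thesis by (auto simp: ibox_def x floor_le_iff le_floor_iff)
  qed
  then show ?case using N0 by (intro exI[of _ "max N0 M"]) auto
qed simp

text \<open>Competitors in a box are finitely supported, so the integral bounds every box minimum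
  from below. Conversely a near-minimiser on the whole lattice has finite support and is admissible
  in all large boxes.\<close>

lemma thermo_limit_from_strain:
  assumes s: "finsupp s1" "finsupp s2" "finsupp s3"
    and en: "\<And>N. N \<ge> N0 \<Longrightarrow> energies N q =
      {strain s1 s2 s3 w1 w2 / 2 | w1 w2. \<forall>n. n \<notin> ibox N \<longrightarrow> w1 n = 0 \<and> w2 n = 0}"
  shows "has_thermo_limit q"
    and "thermo_energy q = 1/2 * (\<integral>k. (norm (eta s1 s2 s3 k))\<^sup>2 / symb k \<partial>zone)"
proof -
  let ?I = "\<integral>k. (norm (eta s1 s2 s3 k))\<^sup>2 / symb k \<partial>zone"
  have att: "\<exists>e\<in>energies N q. \<forall>e'\<in>energies N q. e \<le> e'" if "N \<ge> N0" for N
  proof -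
    obtain w1 w2 where w: "\<forall>n. n \<notin> ibox N \<longrightarrow> w1 n = 0 \<and> w2 n = 0"
      and m: "\<And>v1 v2. \<forall>n. n \<notin> ibox N \<longrightarrow> v1 n = 0 \<and> v2 n = 0 \<Longrightarrow>
        strain s1 s2 s3 w1 w2 \<le> strain s1 s2 s3 v1 v2"
      using strain_min[OF s finite_ibox[of N]] by blast
    show ?thesis
      unfolding en[OF that]
    proof (rule bexI[of _ "strain s1 s2 s3 w1 w2 / 2"], rule ballI)
      fix e assume "e \<in> {strain s1 s2 s3 w1 w2 / 2 | w1 w2. \<forall>n. n \<notin> ibox N \<longrightarrow> w1 n = 0 \<and> w2 n = 0}"
      then obtain v1 v2 where "e = strain s1 s2 s3 v1 v2 / 2" "\<forall>n. n \<notin> ibox N \<longrightarrow> v1 n = 0 \<and> v2 n = 0"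
        by blast
      with m[of v1 v2] show "strain s1 s2 s3 w1 w2 / 2 \<le> e" by simp
    qed (use w in blast)
  qed
  have min: "min_energy N q \<in> energies N q" "\<And>e. e \<in> energies N q \<Longrightarrow> min_energy N q \<le> e"
    if N: "N \<ge> N0" for N
  proof -
    obtain e where e: "e \<in> energies N q" "\<And>e'. e' \<in> energies N q \<Longrightarrow> e \<le> e'"
      using att[OF N] by blast
    have "min_energy N q = e"
      unfolding min_energy_def using e by (intro Least_equality) auto
    with e show "min_energy N q \<in> energies N q" "\<And>e. e \<in> energies N q \<Longrightarrow> min_energy N q \<le> e" by auto
  qed
  have "(\<lambda>N. min_energy N q) \<longlonglongrightarrow> ?I / 2"
  proof (rule order_tendstoI)
    fix a assume a: "a < ?I / 2"
    have "a < min_energy N q" if N: "N \<ge> N0" for N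
    proof -
      obtain w1 w2 where w: "min_energy N q = strain s1 s2 s3 w1 w2 / 2"
        "\<forall>n. n \<notin> ibox N \<longrightarrow> w1 n = 0 \<and> w2 n = 0"
        using min(1)[OF N] unfolding en[OF N] by blast
      have "finsupp w1" "finsupp w2"
        by (rule finsupp_supp[OF finite_ibox[of N]], use w(2) in blast)+
      from strain_ge[OF s this] show ?thesis using a w(1) by simp
    qed
    then show "\<forall>\<^sub>F N in sequentially. a < min_energy N q"
      by (auto simp: eventually_sequentially)
  next
    fix a assume a: "?I / 2 < a"
    obtain w1 w2 where w: "\<And>K::nat. finsupp (w1 K)" "\<And>K. finsupp (w2 K)"
       "(\<lambda>K. strain s1 s2 s3 (w1 K) (w2 K)) \<longlonglongrightarrow> ?I"
      using strain_approx[OF s] by blast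
    have "\<forall>\<^sub>F K in sequentially. strain s1 s2 s3 (w1 K) (w2 K) < 2 * a"
      using order_tendstoD(2)[OF w(3), of "2 * a"] a by simp
    then obtain K where K: "strain s1 s2 s3 (w1 K) (w2 K) < 2 * a"
      by (auto simp: eventually_sequentially)
    obtain N1 where N1: "\<And>N. N \<ge> N1 \<Longrightarrow> {n. w1 K n \<noteq> 0} \<union> {n. w2 K n \<noteq> 0} \<subseteq> ibox N"
      using ibox_exhausts[of "{n. w1 K n \<noteq> 0} \<union> {n. w2 K n \<noteq> 0}"] w(1,2)[of K] by (auto simp: finsupp_def)
    have "min_energy N q < a" if N: "N \<ge> max N0 N1" for N
    proof -
      have N0: "N \<ge> N0" and N1': "N \<ge> N1" using N by auto
      have "strain s1 s2 s3 (w1 K) (w2 K) / 2 \<in> energies N q"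
        unfolding en[OF N0] using N1[OF N1'] by blast
      from min(2)[OF N0 this] K show ?thesis by simp
    qed
    then show "\<forall>\<^sub>F N in sequentially. min_energy N q < a"
      unfolding eventually_sequentially by blast
  qed
  moreover have "\<forall>\<^sub>F N in sequentially. min_attained N q"
    unfolding eventually_sequentially min_attained_def using att by blast
  ultimately show "has_thermo_limit q" "thermo_energy q = 1/2 * ?I"
    by (auto simp: has_thermo_limit_def thermo_energy_def convergent_def limI)
qed

section \<open>Lattice fields and faces\<close>

abbreviation lat :: "int \<times> int \<Rightarrow> pt" where
  "lat n \<equiv> lattice_pt (fst n) (snd n)"

definition dirs :: "(int \<times> int) set" where
  "dirs = {(1, 0), (-1, 0), (0, 1), (0, -1), (1, 1), (-1, -1)}"

lemma inner_b: "b1 \<bullet> b1 = 1" "b1 \<bullet> b2 = -1/2" "b2 \<bullet> b1 = -1/2" "b2 \<bullet> b2 = 1"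
  by (simp_all add: b1_def b2_def inner_vec_def sum_2)

lemma lat_add: "lat (n + m) = lat n + lat m"
  by (simp add: lattice_pt_def algebra_simps)

lemma lat_diff: "lat (n - m) = lat n - lat m"
  by (simp add: lattice_pt_def algebra_simps)

lemma lat_uminus: "lat (- n) = - lat n"
  by (simp add: lattice_pt_def algebra_simps)

lemma lat_basis: "lattice_pt 1 0 = b1" "lattice_pt 0 1 = b2" "lattice_pt (-1) (-1) = b3" "lattice_pt 0 0 = 0"
  by (simp_all add: lattice_pt_def b3_def)

lemma inner_lat: "lat n \<bullet> lat n = of_int ((fst n)\<^sup>2 - fst n * snd n + (snd n)\<^sup>2)"
  by (simp add: lattice_pt_def inner_add_left inner_add_right inner_b power2_eq_square algebra_simps)

text \<open>Completing the square makes the norm form of the lattice visibly positive definite. This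
  yields both the uniqueness of coordinates and the finite list of unit vectors.\<close>

lemma quad_form: "4 * ((a::int)\<^sup>2 - a * b + b\<^sup>2) = (2 * a - b)\<^sup>2 + 3 * b\<^sup>2"
  by (simp add: power2_eq_square algebra_simps)

lemma lat_eq_iff: "lat n = lat m \<longleftrightarrow> n = m"
proof
  assume "lat n = lat m"
  then have "lat (n - m) \<bullet> lat (n - m) = 0" by (simp only: lat_diff) simp
  then have "4 * ((fst (n - m))\<^sup>2 - fst (n - m) * snd (n - m) + (snd (n - m))\<^sup>2) = 0"
    unfolding inner_lat by (simp only: of_int_eq_0_iff)
  then have *: "(2 * fst (n - m) - snd (n - m))\<^sup>2 + 3 * (snd (n - m))\<^sup>2 = 0"
    by (simp only: quad_form)
  then have "(snd (n - m))\<^sup>2 = 0"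
    using zero_le_power2[of "2 * fst (n - m) - snd (n - m)"] zero_le_power2[of "snd (n - m)"] by linarith
  with * show "n = m" by (simp add: prod_eq_iff)
qed simp

lemma int_unit_form: "(a::int)\<^sup>2 - a * b + b\<^sup>2 = 1 \<longleftrightarrow> (a, b) \<in> dirs"
proof
  assume h: "a\<^sup>2 - a * b + b\<^sup>2 = 1"
  have sq: "x \<in> {-1, 0, 1}" if "3 * x\<^sup>2 \<le> 4" for x :: int
  proof -
    have "\<bar>x\<bar> < 2"
    proof (rule ccontr)
      assume "\<not> \<bar>x\<bar> < 2"
      then have "2\<^sup>2 \<le> \<bar>x\<bar>\<^sup>2" by (intro power_mono) auto
      with that show False by simp
    qed
    then show ?thesis by auto
  qed
  have "b \<in> {-1, 0, 1}" using quad_form[of a b, unfolded h] zero_le_power2[of "2 * a - b"] by (intro sq) linarith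
  moreover have "a \<in> {-1, 0, 1}"
  proof (rule sq)
    have "b\<^sup>2 - b * a + a\<^sup>2 = 1" using h by (simp add: algebra_simps)
    from quad_form[of b a, unfolded this] show "3 * a\<^sup>2 \<le> 4" using zero_le_power2[of "2 * b - a"] by linarith
  qed
  ultimately show "(a, b) \<in> dirs" using h by (auto simp: dirs_def)
qed (auto simp: dirs_def)

lemma nn_lat: "nn (lat n) (lat m) \<longleftrightarrow> m - n \<in> dirs"
proof -
  have "nn (lat n) (lat m) \<longleftrightarrow> norm (lat (m - n)) = 1"
    unfolding nn_def lat_diff tri_lattice_def by (auto simp: norm_minus_commute)
  also have "\<dots> \<longleftrightarrow> lat (m - n) \<bullet> lat (m - n) = 1" by (rule norm_eq_1)
  also have "\<dots> \<longleftrightarrow> (fst (m - n))\<^sup>2 - fst (m - n) * snd (m - n) + (snd (m - n))\<^sup>2 = 1"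
    unfolding inner_lat by (simp only: of_int_eq_1_iff)
  finally show ?thesis by (simp only: int_unit_form prod.collapse)
qed

lemma tri_lattice_lat: "tri_lattice = range lat"
  unfolding tri_lattice_def image_def by force

lemma nnE:
  assumes "nn x y"
  obtains n d where "x = lat n" "y = lat (n + d)" "d \<in> dirs"
proof -
  from assms obtain n m where *: "x = lat n" "y = lat m"
    unfolding nn_def tri_lattice_lat by blast
  with assms have "m - n \<in> dirs" by (simp only: nn_lat)
  with * that[of n "m - n"] show thesis by simp
qed

lemma Lam_lat: "lat n \<in> Lam N \<longleftrightarrow> n \<in> ibox N"
proof
  assume "lat n \<in> Lam N"
  then obtain m where "lat n = lat m" "m \<in> ibox N"
    unfolding Lam_def ibox_def by force
  then show "n \<in> ibox N" by (simp only: lat_eq_iff)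
next
  assume "n \<in> ibox N"
  then show "lat n \<in> Lam N"
    unfolding Lam_def ibox_def by (cases n) auto
qed

section \<open>The energy in lattice coordinates\<close>

definition jump :: "(pt \<Rightarrow> pt) \<Rightarrow> (pt \<Rightarrow> pt \<Rightarrow> pt) \<Rightarrow> int \<times> int \<Rightarrow> int \<times> int \<Rightarrow> real" where
  "jump u \<sigma> d n = (u (lat (n + d)) - u (lat n) - \<sigma> (lat n) (lat (n + d))) \<bullet> lat d"

lemma nrm2_shift: "nrm2 (\<lambda>n. f (n - d)) = nrm2 f"
  unfolding nrm2_def
  by (rule sum.reindex_bij_witness[of _ "\<lambda>n. n + d" "\<lambda>n. n - d"]) auto

lemma dirs_uminus: "d \<in> dirs \<Longrightarrow> - d \<in> dirs"
  by (auto simp: dirs_def)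

text \<open>The ordered pairs are parametrised by a direction in \<open>dirs\<close> and a site. By
  antisymmetry of the slip field, direction \<open>- d\<close> repeats the values of direction
  \<open>d\<close> at a translated site, so three directions suffice and the factor 2 cancels the
  inner 1/2 of \<open>H_AO\<close>. Bonds with both ends outside the box contribute 0, which makes
  the sum finite.\<close>

lemma H_AO_eq:
  assumes \<sigma>: "slip_field N \<sigma>" and u: "displacement N u"
  shows "H_AO u \<sigma> = 1/2 * (nrm2 (jump u \<sigma> (1, 0)) + nrm2 (jump u \<sigma> (0, 1)) + nrm2 (jump u \<sigma> (-1, -1)))"
    and "d \<in> dirs \<Longrightarrow> finsupp (jump u \<sigma> d)"
proof -
  define S where "S = ibox N \<union> (\<Union>d\<in>dirs. (\<lambda>n. n - d) ` ibox N)"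
  have S: "finite S" by (simp add: S_def finite_ibox dirs_def)
  have z: "jump u \<sigma> d n = 0" if "d \<in> dirs" "n \<notin> S" for d n
  proof -
    have "n \<notin> ibox N" using that by (auto simp: S_def)
    moreover have "n + d \<notin> ibox N"
      using that image_eqI[of n "\<lambda>n. n - d" "n + d" "ibox N"] by (auto simp: S_def)
    moreover have "nn (lat n) (lat (n + d))" using that by (simp only: nn_lat) simp
    ultimately have "\<sigma> (lat n) (lat (n + d)) = 0"
      using \<sigma> unfolding slip_field_def Lam_lat[symmetric] by blast
    moreover have "u (lat n) = 0" "u (lat (n + d)) = 0"
      using u \<open>n \<notin> ibox N\<close> \<open>n + d \<notin> ibox N\<close> unfolding displacement_def tri_lattice_lat Lam_lat[symmetric] by blast+
    ultimately show ?thesis unfolding jump_def by simp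
  qed
  show fs: "finsupp (jump u \<sigma> d)" if "d \<in> dirs" for d
    using z[OF that] S by (intro finsuppI[of S]) auto
  let ?h = "\<lambda>(x, y). ((u y - u x - \<sigma> x y) \<bullet> (y - x))\<^sup>2"
  let ?g = "\<lambda>(d, n). (lat n, lat (n + d))"
  have bij: "bij_betw ?g (dirs \<times> UNIV) {(x, y). nn x y}"
  proof (rule bij_betwI')
    fix p q :: "(int \<times> int) \<times> (int \<times> int)"
    show "(?g p = ?g q) \<longleftrightarrow> p = q"
      by (cases p; cases q) (simp only: prod.case prod.inject lat_eq_iff, auto)
  next
    fix p assume "p \<in> dirs \<times> (UNIV :: (int \<times> int) set)"
    then show "?g p \<in> {(x, y). nn x y}"
      by (cases p) (simp only: prod.case mem_Collect_eq nn_lat, simp)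
  next
    fix y assume "y \<in> {(x, y). nn x y}"
    then obtain a b where y: "y = (a, b)" "nn a b" by auto
    from y(2) show "\<exists>p\<in>dirs \<times> UNIV. y = ?g p" by (rule nnE) (use y(1) in force)
  qed
  have neg: "nrm2 (jump u \<sigma> (- d)) = nrm2 (jump u \<sigma> d)" if d: "d \<in> dirs" for d
  proof -
    have "jump u \<sigma> (- d) n = jump u \<sigma> d (n - d)" for n
    proof -
      have "nn (lat n) (lat (n - d))" using dirs_uminus[OF d] by (simp only: nn_lat) simp
      then have "\<sigma> (lat n) (lat (n - d)) = - \<sigma> (lat (n - d)) (lat n)"
        using \<sigma> unfolding slip_field_def by blast
      then show ?thesis unfolding jump_def lat_uminus
        by (simp add: inner_diff_left inner_add_left)
    qed
    then have "jump u \<sigma> (- d) = (\<lambda>n. jump u \<sigma> d (n - d))" by (rule ext)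
    then show ?thesis using nrm2_shift[of "jump u \<sigma> d" d] by simp
  qed
  have "(\<Sum>\<^sub>\<infinity>p\<in>{(x, y). nn x y}. ?h p) = (\<Sum>\<^sub>\<infinity>p\<in>dirs \<times> UNIV. ?h (?g p))"
    by (rule infsum_reindex_bij_betw[OF bij, symmetric])
  also have "\<dots> = (\<Sum>\<^sub>\<infinity>p\<in>dirs \<times> UNIV. (jump u \<sigma> (fst p) (snd p))\<^sup>2)"
    by (intro infsum_cong) (auto simp: jump_def lattice_pt_def algebra_simps)
  also have "\<dots> = (\<Sum>\<^sub>\<infinity>p\<in>dirs \<times> S. (jump u \<sigma> (fst p) (snd p))\<^sup>2)"
    by (intro infsum_cong_neutral) (simp_all add: mem_Times_iff z, blast)
  also have "\<dots> = (\<Sum>p\<in>dirs \<times> S. (jump u \<sigma> (fst p) (snd p))\<^sup>2)"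
    using S by (intro infsum_finite) (auto simp: dirs_def)
  also have "\<dots> = (\<Sum>d\<in>dirs. \<Sum>n\<in>S. (jump u \<sigma> d n)\<^sup>2)"
    by (simp add: sum.cartesian_product')
  also have "\<dots> = (\<Sum>d\<in>dirs. nrm2 (jump u \<sigma> d))"
    using z by (intro sum.cong refl nrm2_eq[OF S, symmetric]) auto
  also have "\<dots> = 2 * (nrm2 (jump u \<sigma> (1, 0)) + nrm2 (jump u \<sigma> (0, 1)) + nrm2 (jump u \<sigma> (-1, -1)))"
    using neg[of "(1, 0)"] neg[of "(0, 1)"] neg[of "(-1, -1)"] by (simp add: dirs_def)
  finally show "H_AO u \<sigma> = 1/2 * (nrm2 (jump u \<sigma> (1, 0)) + nrm2 (jump u \<sigma> (0, 1)) + nrm2 (jump u \<sigma> (-1, -1)))"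
    unfolding H_AO_def by simp
qed

section \<open>Faces and gauge invariance\<close>

definition up_face :: "int \<times> int \<Rightarrow> face" where
  "up_face n = (lat n, lat (n + (1, 0)), lat (n + (1, 1)))"

text \<open>Oriented clockwise, whereas \<open>up_face\<close> is counterclockwise. Both go from
  \<open>n\<close> to \<open>n + (1, 1)\<close> in two steps and return along the diagonal, so a
  closed field takes the same value on both paths and on the diagonal.\<close>

definition down_face :: "int \<times> int \<Rightarrow> face" where
  "down_face n = (lat n, lat (n + (0, 1)), lat (n + (1, 1)))"

lemma up_down_faces: "up_face n \<in> faces" "down_face n \<in> faces"
  unfolding up_face_def down_face_def faces_def mem_Collect_eq prod.case nn_lat
  by (auto simp: dirs_def)

text \<open>A curl-free slip field vanishing off the box is the gradient of its row sums.\<close>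

lemma closed_slip_is_gradient:
  fixes \<tau> :: "pt \<Rightarrow> pt \<Rightarrow> pt"
  assumes anti: "\<And>x y. nn x y \<Longrightarrow> \<tau> x y = - \<tau> y x"
    and off: "\<And>x y. nn x y \<Longrightarrow> x \<notin> Lam N \<Longrightarrow> y \<notin> Lam N \<Longrightarrow> \<tau> x y = 0"
    and closed: "\<And>f. f \<in> faces \<Longrightarrow> d_slip \<tau> f = 0"
  shows "\<exists>v. displacement N v \<and> (\<forall>x y. nn x y \<longrightarrow> v y - v x = \<tau> x y)"
proof -
  define lo hi where "lo = \<lfloor>- real N / 2 + 1\<rfloor>" and "hi = \<lfloor>real N / 2\<rfloor>"
  have box: "n \<in> ibox N \<longleftrightarrow> lo \<le> fst n \<and> fst n \<le> hi \<and> lo \<le> snd n \<and> snd n \<le> hi" for n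
    by (auto simp: ibox_def lo_def hi_def mem_Times_iff)
  define t1 t2 t3 where "t1 a b = \<tau> (lat (a, b)) (lat (a + 1, b))" and "t2 a b = \<tau> (lat (a, b)) (lat (a, b + 1))"
    and "t3 a b = \<tau> (lat (a, b)) (lat (a + 1, b + 1))" for a b
  have out: "\<tau> (lat n) (lat m) = 0" if "m - n \<in> dirs" "n \<notin> ibox N" "m \<notin> ibox N" for n m
    by (rule off) (use that in \<open>simp_all only: nn_lat Lam_lat not_False_eq_True\<close>)
  have an: "\<tau> (lat m) (lat n) = - \<tau> (lat n) (lat m)" if "m - n \<in> dirs" for n m
    by (rule anti) (simp only: nn_lat, use dirs_uminus[OF that] in simp)
  have up: "t1 a b + t2 (a + 1) b = t3 a b" for a b
    using closed[OF up_down_faces(1)[of "(a, b)"]] an[of "(a + 1, b + 1)" "(a, b)"]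
    by (simp add: d_slip_def up_face_def t1_def t2_def t3_def dirs_def)
  have down: "t2 a b + t1 a (b + 1) = t3 a b" for a b
    using closed[OF up_down_faces(2)[of "(a, b)"]] an[of "(a + 1, b + 1)" "(a, b)"]
    by (simp add: d_slip_def down_face_def t1_def t2_def t3_def dirs_def)
  \<comment> \<open>The bond starting at \<open>lo - 1\<close> is the first in its row that can meet
    the box; further left the range is empty and the sum is 0.\<close>
  define V where "V a b = (\<Sum>k\<in>{lo - 1..<a}. t1 k b)" for a b
  have t1_out: "t1 a b = 0" if "a + 1 < lo \<or> a > hi \<or> b < lo \<or> b > hi" for a b
    unfolding t1_def by (rule out) (use that in \<open>auto simp: box dirs_def\<close>)
  have t2_out: "t2 a b = 0" if "a < lo \<or> a > hi \<or> b + 1 < lo \<or> b > hi" for a b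
    unfolding t2_def by (rule out) (use that in \<open>auto simp: box dirs_def\<close>)
  have V1: "V (a + 1) b - V a b = t1 a b" for a b
  proof (cases "a \<ge> lo - 1")
    case True
    then have "{lo - 1..<a + 1} = insert a {lo - 1..<a}" by auto
    then show ?thesis by (simp add: V_def)
  next
    case False
    then show ?thesis by (simp add: V_def t1_out)
  qed
  \<comment> \<open>Induction from left to right: the two triangles of a parallelogram relate the
    vertical bonds of neighbouring columns to the horizontal bonds between them.\<close>
  have V2: "V a (b + 1) - V a b = t2 a b" for a b
  proof (cases "a \<ge> lo - 1")
    case True
    then show ?thesis
    proof (induction a rule: int_ge_induct)
      case base
      show ?case by (simp add: V_def t2_out)
    next
      case (step a)
      have "V (a + 1) (b + 1) - V (a + 1) b = t2 a b + t1 a (b + 1) - t1 a b"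
        using step.IH V1[of a b] V1[of a "b + 1"] by (simp add: algebra_simps)
      then show ?case using up[of a b] down[of a b] by (metis add_diff_cancel_left')
    qed
  next
    case False
    then show ?thesis by (simp add: V_def t2_out)
  qed
  have V3: "V (a + 1) (b + 1) - V a b = t3 a b" for a b
    using V1[of a b] V2[of "a + 1" b] up[of a b] by (simp add: algebra_simps)
  have V_out: "V a b = 0" if "(a, b) \<notin> ibox N" for a b
  proof -
    consider "b < lo" | "b > hi" | "a < lo" | "a > hi" using \<open>(a, b) \<notin> ibox N\<close> by (auto simp: box)
    then show ?thesis
    proof cases
      \<comment> \<open>To the right of the box \<open>V\<close> is a full row sum, which is not
        visibly 0. There all vertical bonds vanish, so \<open>V\<close> is constant along the
        column, and below the box it is 0.\<close>
      case 4
      show ?thesis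
      proof (cases "b \<ge> lo - 1")
        case True
        then show ?thesis
        proof (induction b rule: int_ge_induct)
          case base
          show ?case by (simp add: V_def t1_out)
        next
          case (step b)
          then show ?case using V2[of a b] 4 by (simp add: t2_out)
        qed
      next
        case False
        then show ?thesis by (simp add: V_def t1_out)
      qed
    qed (auto simp: V_def intro!: sum.neutral t1_out)
  qed
  define v where "v x = (THE z. \<exists>a b. x = lat (a, b) \<and> z = V a b)" for x
  have v: "v (lat n) = V (fst n) (snd n)" for n
    unfolding v_def
  proof (rule the_equality)
    fix z assume "\<exists>a b. lat n = lat (a, b) \<and> z = V a b"
    then obtain a b where "lat n = lat (a, b)" "z = V a b" by blast
    moreover from this(1) have "n = (a, b)" by (rule lat_eq_iff[THEN iffD1])
    ultimately show "z = V (fst n) (snd n)" by simp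
  qed (metis prod.collapse)
  have "displacement N v"
    unfolding displacement_def tri_lattice_lat
  proof (intro ballI impI)
    fix x assume "x \<in> range lat" "x \<notin> Lam N"
    then obtain n where n: "x = lat n" "n \<notin> ibox N" using Lam_lat by blast
    then show "v x = 0" unfolding n(1) v using V_out[of "fst n" "snd n"] by simp
  qed
  moreover have "v y - v x = \<tau> x y" if "nn x y" for x y
    using that
  proof (rule nnE)
    fix n d assume nd: "x = lat n" "y = lat (n + d)" "d \<in> dirs"
    obtain a b where n: "n = (a, b)" by (cases n)
    have r: "\<tau> (lat (a, b)) (lat (a - 1, b)) = - t1 (a - 1) b" "\<tau> (lat (a, b)) (lat (a, b - 1)) = - t2 a (b - 1)"
       "\<tau> (lat (a, b)) (lat (a - 1, b - 1)) = - t3 (a - 1) (b - 1)"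
      using an[of "(a, b)" "(a - 1, b)"] an[of "(a, b)" "(a, b - 1)"] an[of "(a, b)" "(a - 1, b - 1)"]
      by (simp_all add: t1_def t2_def t3_def dirs_def)
    show ?thesis
      using nd(3) V1[of a b] V1[of "a - 1" b] V2[of a b] V2[of a "b - 1"] V3[of a b] V3[of "a - 1" "b - 1"] r
      unfolding nd(1,2) v n by (auto simp: dirs_def t1_def t2_def t3_def algebra_simps)
  qed
  ultimately show ?thesis by blast
qed

lemma H_AO_strain:
  assumes "slip_field N \<sigma>" "displacement N u"
  shows "H_AO u \<sigma> = strain (\<lambda>n. \<sigma> (lat n) (lat (n + (1, 0))) \<bullet> b1) (\<lambda>n. \<sigma> (lat n) (lat (n + (0, 1))) \<bullet> b2)
    (\<lambda>n. \<sigma> (lat n) (lat (n + (-1, -1))) \<bullet> b3) (\<lambda>n. u (lat n) \<bullet> b1) (\<lambda>n. u (lat n) \<bullet> b2) / 2"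
proof -
  have "jump u \<sigma> (1, 0) = (\<lambda>n. u (lat (n + (1, 0))) \<bullet> b1 - u (lat n) \<bullet> b1 - \<sigma> (lat n) (lat (n + (1, 0))) \<bullet> b1)"
    by (simp add: fun_eq_iff jump_def inner_diff_left lat_basis)
  moreover have "jump u \<sigma> (0, 1) = (\<lambda>n. u (lat (n + (0, 1))) \<bullet> b2 - u (lat n) \<bullet> b2 - \<sigma> (lat n) (lat (n + (0, 1))) \<bullet> b2)"
    by (simp add: fun_eq_iff jump_def inner_diff_left lat_basis)
  moreover have "jump u \<sigma> (-1, -1) = (\<lambda>n. u (lat n) \<bullet> b1 + u (lat n) \<bullet> b2 - u (lat (n + (-1, -1))) \<bullet> b1
      - u (lat (n + (-1, -1))) \<bullet> b2 - \<sigma> (lat n) (lat (n + (-1, -1))) \<bullet> b3)"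
    by (simp add: fun_eq_iff jump_def inner_diff_left inner_diff_right lat_basis) (simp add: b3_def inner_diff_right)
  ultimately show ?thesis
    unfolding H_AO_eq(1)[OF assms] strain_def by simp
qed

text \<open>The coefficients form the inverse of the Gram matrix of \<open>b1\<close>,
  \<open>b2\<close>. Hence the two components of a displacement can be prescribed freely.\<close>

lemma pt_of_inner:
  "\<exists>z::pt. z \<bullet> b1 = x \<and> z \<bullet> b2 = y"
proof -
  define z where "z = (4/3 * x + 2/3 * y) *\<^sub>R b1 + (2/3 * x + 4/3 * y) *\<^sub>R b2"
  have "z \<bullet> b1 = x" "z \<bullet> b2 = y"
    by (simp_all add: z_def inner_add_left inner_b algebra_simps)
  then show ?thesis by blast
qed

text \<open>Two slip fields with the same charge differ by a closed field, which is the gradient of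
  some displacement \<open>v\<close>. Replacing \<open>u\<close> by \<open>u - v\<close> transfers
  the energy to the fixed slip field without changing any bond. The converse inclusion rebuilds a
  displacement from its two components.\<close>

lemma energies_eq_strain:
  assumes slip: "slip_field N \<sigma>" and d: "\<And>f. f \<in> faces \<Longrightarrow> d_slip \<sigma> f = q f"
  shows "energies N q = {strain (\<lambda>n. \<sigma> (lat n) (lat (n + (1, 0))) \<bullet> b1) (\<lambda>n. \<sigma> (lat n) (lat (n + (0, 1))) \<bullet> b2)
    (\<lambda>n. \<sigma> (lat n) (lat (n + (-1, -1))) \<bullet> b3) w1 w2 / 2 | w1 w2. \<forall>n. n \<notin> ibox N \<longrightarrow> w1 n = 0 \<and> w2 n = 0}"
    (is "_ = ?R")
proof (intro set_eqI iffI)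
  fix e assume "e \<in> energies N q"
  then obtain u \<sigma>' where e: "e = H_AO u \<sigma>'" and u: "displacement N u" and slip': "slip_field N \<sigma>'"
    and d': "\<And>f. f \<in> faces \<Longrightarrow> d_slip \<sigma>' f = q f"
    by (auto simp: energies_def)
  define \<tau> where "\<tau> x y = \<sigma>' x y - \<sigma> x y" for x y
  have "\<exists>v. displacement N v \<and> (\<forall>x y. nn x y \<longrightarrow> v y - v x = \<tau> x y)"
  proof (rule closed_slip_is_gradient)
    fix x y assume "nn x y"
    then have "\<sigma>' x y = - \<sigma>' y x" "\<sigma> x y = - \<sigma> y x" using slip slip' unfolding slip_field_def by blast+
    then show "\<tau> x y = - \<tau> y x" by (simp add: \<tau>_def)
  next
    fix x y assume "nn x y" "x \<notin> Lam N" "y \<notin> Lam N"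
    then have "\<sigma>' x y = 0" "\<sigma> x y = 0" using slip slip' unfolding slip_field_def by blast+
    then show "\<tau> x y = 0" by (simp add: \<tau>_def)
  next
    fix f assume "f \<in> faces"
    moreover have "d_slip \<tau> f = d_slip \<sigma>' f - d_slip \<sigma> f"
      by (cases f) (simp add: d_slip_def \<tau>_def)
    ultimately show "d_slip \<tau> f = 0" using d d' by simp
  qed
  then obtain v where v: "displacement N v" "\<And>x y. nn x y \<Longrightarrow> v y - v x = \<tau> x y" by blast
  define u' where "u' x = u x - v x" for x
  have u': "displacement N u'" using u v(1) by (simp add: displacement_def u'_def)
  have "u y - u x - \<sigma>' x y = u' y - u' x - \<sigma> x y" if "nn x y" for x y
    using v(2)[OF that] by (simp add: u'_def \<tau>_def algebra_simps)
  then have "H_AO u \<sigma>' = H_AO u' \<sigma>"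
    unfolding H_AO_def by (intro arg_cong[where f = "\<lambda>x. 1/2 * (1/2 * x)"] infsum_cong) auto
  then have "e = strain (\<lambda>n. \<sigma> (lat n) (lat (n + (1, 0))) \<bullet> b1) (\<lambda>n. \<sigma> (lat n) (lat (n + (0, 1))) \<bullet> b2)
    (\<lambda>n. \<sigma> (lat n) (lat (n + (-1, -1))) \<bullet> b3) (\<lambda>n. u' (lat n) \<bullet> b1) (\<lambda>n. u' (lat n) \<bullet> b2) / 2"
    using e H_AO_strain[OF slip u'] by simp
  moreover have "u' (lat n) = 0" if "n \<notin> ibox N" for n
    using u' that unfolding displacement_def tri_lattice_lat Lam_lat[symmetric] by blast
  then have "\<forall>n. n \<notin> ibox N \<longrightarrow> u' (lat n) \<bullet> b1 = 0 \<and> u' (lat n) \<bullet> b2 = 0" by simp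
  ultimately show "e \<in> ?R" by blast
next
  fix e assume "e \<in> ?R"
  then obtain w1 w2 where e: "e = strain (\<lambda>n. \<sigma> (lat n) (lat (n + (1, 0))) \<bullet> b1) (\<lambda>n. \<sigma> (lat n) (lat (n + (0, 1))) \<bullet> b2)
    (\<lambda>n. \<sigma> (lat n) (lat (n + (-1, -1))) \<bullet> b3) w1 w2 / 2" and w: "\<forall>n. n \<notin> ibox N \<longrightarrow> w1 n = 0 \<and> w2 n = 0"
    by blast
  obtain z where z: "\<And>x y. z x y \<bullet> b1 = x" "\<And>x y. z x y \<bullet> b2 = y"
    using pt_of_inner by metis
  have inj: "inj (\<lambda>n. lat n)" by (rule injI) (rule lat_eq_iff[THEN iffD1])
  define u where "u x = (let n = inv (\<lambda>n. lat n) x in if n \<in> ibox N then z (w1 n) (w2 n) else 0)" for x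
  have u: "u (lat n) = (if n \<in> ibox N then z (w1 n) (w2 n) else 0)" for n
    using inv_f_f[OF inj, of n] by (simp add: u_def)
  have du: "displacement N u"
    unfolding displacement_def tri_lattice_lat using u by (auto simp only: Lam_lat) simp
  have "w1 = (\<lambda>n. u (lat n) \<bullet> b1)" "w2 = (\<lambda>n. u (lat n) \<bullet> b2)"
    unfolding u fun_eq_iff using w by (simp_all only: z split: if_split) simp_all
  then have "e = H_AO u \<sigma>" using e H_AO_strain[OF slip du] by simp
  then show "e \<in> energies N q" unfolding energies_def using du slip d by blast
qed

text \<open>Two unit steps are closed by a third one only after a turn by 120 degrees to the left or
  to the right: six first steps, two turns each.\<close>

lemma dirs_triangle:
  "\<forall>d\<in>dirs. \<forall>d'\<in>dirs. - d - d' \<in> dirs \<longrightarrow>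
    (d, d') \<in> {((1, 0), (0, 1)), ((0, 1), (-1, -1)), ((-1, -1), (1, 0)), ((0, 1), (1, 0)), ((1, 0), (-1, -1)),
      ((-1, -1), (0, 1)), ((0, -1), (-1, 0)), ((-1, 0), (1, 1)), ((1, 1), (0, -1)), ((-1, 0), (0, -1)), ((0, -1), (1, 1)),
      ((1, 1), (-1, 0))}"
  by (simp add: dirs_def zero_prod_def)

text \<open>The twelve triangles with a given first vertex are exhausted by two shapes, three
  rotations and two orientations. Identities between functions that respect rotation and orientation
  thus need checking on two families only.\<close>

lemma face_cases:
  assumes f: "f \<in> faces"
    and up: "\<And>n. P (up_face n)" and down: "\<And>n. P (down_face n)"
    and rot: "\<And>x y z. P (x, y, z) \<Longrightarrow> P (y, z, x)"
    and flip: "\<And>x y z. P (x, y, z) \<Longrightarrow> P (z, y, x)"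
  shows "P f"
proof -
  obtain x y z where xyz: "f = (x, y, z)" by (cases f)
  with f have n: "nn x y" "nn y z" "nn z x" by (auto simp: faces_def)
  obtain n d where d: "x = lat n" "y = lat (n + d)" "d \<in> dirs" using n(1) by (rule nnE)
  obtain m d' where m: "y = lat m" "z = lat (m + d')" "d' \<in> dirs" using n(2) by (rule nnE)
  have "m = n + d" using d(2) m(1) lat_eq_iff[of m "n + d"] by simp
  then have z: "z = lat (n + d + d')" using m by simp
  have "n - (n + d + d') \<in> dirs" using n(3) unfolding z d(1) nn_lat .
  moreover have "n - (n + d + d') = - d - d'" by (simp add: prod_eq_iff)
  ultimately have dd: "- d - d' \<in> dirs" by (simp only:)
  obtain a b where ab: "n = (a, b)" by (cases n)
  have U: "P (lattice_pt a b, lattice_pt (a + 1) b, lattice_pt (a + 1) (b + 1))" for a b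
    using up[of "(a, b)"] by (simp add: up_face_def)
  have D: "P (lattice_pt a b, lattice_pt a (b + 1), lattice_pt (a + 1) (b + 1))" for a b
    using down[of "(a, b)"] by (simp add: down_face_def)
  \<comment> \<open>The offsets are chosen such that \<open>(a, b)\<close> is the first vertex of
    each of the twelve triples.\<close>
  note R = U[of a b] rot[OF U, of "a - 1" b] rot[OF rot[OF U], of "a - 1" "b - 1"]
    flip[OF U, of "a - 1" "b - 1"] flip[OF rot[OF U], of a b] flip[OF rot[OF rot[OF U]], of "a - 1" b]
    D[of a b] rot[OF D, of a "b - 1"] rot[OF rot[OF D], of "a - 1" "b - 1"]
    flip[OF D, of "a - 1" "b - 1"] flip[OF rot[OF D], of a b] flip[OF rot[OF rot[OF D]], of a "b - 1"]
  have R': "(d, d') \<in> {((1, 0), (0, 1)), ((0, 1), (-1, -1)), ((-1, -1), (1, 0)), ((0, 1), (1, 0)), ((1, 0), (-1, -1)),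
      ((-1, -1), (0, 1)), ((0, -1), (-1, 0)), ((-1, 0), (1, 1)), ((1, 1), (0, -1)), ((-1, 0), (0, -1)), ((0, -1), (1, 1)),
      ((1, 1), (-1, 0))}"
    by (rule dirs_triangle[rule_format, OF d(3) m(3) dd])
  then show ?thesis
    unfolding xyz z d(1,2) ab by (elim insertE emptyE) (use R in simp_all)
qed

section \<open>Cuts\<close>

text \<open>The charge of a dipole is the boundary of the horizontal segment joining its two faces.\<close>

definition cut_set :: "nat \<Rightarrow> int set \<Rightarrow> (int \<times> int) set" where
  "cut_set n J = (\<lambda>(k, t). (k + t, 2 * t)) ` ({1..int n} \<times> J)"

text \<open>The bonds that leave a site of the row upwards. The slip on them is \<open>b1\<close>,
  parallel to the row, and the row acts as the glide line joining the two dislocations.\<close>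

definition crosses :: "(int \<times> int) set \<Rightarrow> pt \<Rightarrow> pt \<Rightarrow> bool" where
  "crosses S x y \<longleftrightarrow> (\<exists>p\<in>S. x = lat p \<and> (y = lat (p + (0, 1)) \<or> y = lat (p + (1, 1))))"

definition cut_field :: "(int \<times> int) set \<Rightarrow> pt \<Rightarrow> pt \<Rightarrow> pt" where
  "cut_field S x y = (of_bool (crosses S x y) - of_bool (crosses S y x)) *\<^sub>R b1"

text \<open>Treats dipole and grain boundary together: \<open>J\<close> lists the multiples of
  \<open>b2 - b3\<close> by which the dipole is translated.\<close>

definition charge :: "nat \<Rightarrow> int set \<Rightarrow> face \<Rightarrow> pt" where
  "charge n J f = (\<Sum>t\<in>J. q_dip n (shift (- (of_int t *\<^sub>R (b2 - b3))) f))"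

lemma finite_cut_set: "finite J \<Longrightarrow> finite (cut_set n J)"
  by (simp add: cut_set_def)

lemma cut_set_iff: "(a, b) \<in> cut_set n J \<longleftrightarrow> (\<exists>t\<in>J. b = 2 * t \<and> a - t \<in> {1..int n})"
  by (force simp: cut_set_def image_iff)

lemma crosses_lat: "crosses S (lat p) (lat r) \<longleftrightarrow> p \<in> S \<and> (r = p + (0, 1) \<or> r = p + (1, 1))"
  unfolding crosses_def lat_eq_iff by blast

lemma slip_field_cut:
  assumes "S \<subseteq> ibox N"
  shows "slip_field N (cut_field S)"
proof -
  have "cut_field S x y \<in> tri_lattice" for x y
  proof -
    have "cut_field S x y = lat (of_bool (crosses S x y) - of_bool (crosses S y x), 0)"
      by (simp add: cut_field_def lattice_pt_def)
    then show ?thesis unfolding tri_lattice_lat by blast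
  qed
  moreover have "cut_field S x y = - cut_field S y x" for x y
    by (simp add: cut_field_def flip: scaleR_minus_left)
  moreover have "\<not> crosses S x y" if "x \<notin> Lam N" for x y
  proof
    assume "crosses S x y"
    then obtain p where "p \<in> S" "x = lat p" unfolding crosses_def by blast
    with assms that show False by (simp only: Lam_lat) blast
  qed
  then have "cut_field S x y = 0" if "x \<notin> Lam N" "y \<notin> Lam N" for x y
    using that by (simp add: cut_field_def)
  ultimately show ?thesis unfolding slip_field_def by blast
qed

lemma ind_up:
  "ind_face (up_face a) (up_face p) = of_bool (p = a)" "ind_face (up_face a) (down_face p) = 0"
  unfolding ind_face_def up_face_def down_face_def rotations_def flip_def prod.case insert_iff empty_iff prod.inject lat_eq_iff
  by (cases a; cases p; auto)+

lemma ind_rot: "ind_face g (y, z, x) = ind_face g (x, y, z)"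
  by (cases g) (auto simp: ind_face_def rotations_def flip_def)

text \<open>Oddness depends on the three vertices being distinct: otherwise rotations of the face
  and of its flip would overlap, and the first branch of \<open>ind_face\<close> would win for
  both.\<close>

lemma ind_flip: "ind_face (up_face a) (z, y, x) = - ind_face (up_face a) (x, y, z)"
proof -
  obtain p q r where "up_face a = (p, q, r)" "p \<noteq> q" "q \<noteq> r" "p \<noteq> r"
    unfolding up_face_def lat_eq_iff by (simp add: lat_eq_iff zero_prod_def del: fst_add snd_add)
  then show ?thesis by (auto simp: ind_face_def rotations_def flip_def)
qed

lemma face_at_up: "face_at k = up_face (int k, 0)"
  by (simp add: face_at_def up_face_def shift_def lattice_pt_def b3_def algebra_simps)

lemma shift_face: "shift (- (of_int t *\<^sub>R (b2 - b3))) (up_face p) = up_face (p - (t, 2 * t))"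
  "shift (- (of_int t *\<^sub>R (b2 - b3))) (down_face p) = down_face (p - (t, 2 * t))"
proof -
  have "of_int (2 * t) *\<^sub>R b2 = of_int t *\<^sub>R b2 + of_int t *\<^sub>R b2"
    by (simp flip: scaleR_add_left)
  then have "of_int t *\<^sub>R (b2 - b3) = lat (t, 2 * t)"
    unfolding lattice_pt_def b3_def fst_conv snd_conv by (simp add: scaleR_right_diff_distrib scaleR_right_distrib)
  then show "shift (- (of_int t *\<^sub>R (b2 - b3))) (up_face p) = up_face (p - (t, 2 * t))"
    "shift (- (of_int t *\<^sub>R (b2 - b3))) (down_face p) = down_face (p - (t, 2 * t))"
    unfolding up_face_def down_face_def shift_def prod.case lat_add lat_diff by (simp_all only:) (simp_all add: algebra_simps)
qed

text \<open>On an up face the curl is the discrete derivative of the indicator of the row: with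
  sites 1 to n it is +1 at the face at 0 and -1 at the face at n. On a down face both cut bonds
  start at the same site and cancel.\<close>

lemma d_slip_cut:
  assumes J: "finite J" and f: "f \<in> faces"
  shows "d_slip (cut_field (cut_set n J)) f = charge n J f"
  using f
proof (rule face_cases)
  let ?S = "cut_set n J"
  show "d_slip (cut_field ?S) (up_face p) = charge n J (up_face p)" for p
  proof -
    obtain a b where p: "p = (a, b)" by (cases p)
    have "d_slip (cut_field ?S) (up_face p) = (of_bool (p + (1, 0) \<in> ?S) - of_bool (p \<in> ?S)) *\<^sub>R b1"
      unfolding d_slip_def up_face_def prod.case cut_field_def crosses_lat
      by (cases p) (simp flip: scaleR_add_left)
    also have "of_bool (p + (1, 0) \<in> ?S) - of_bool (p \<in> ?S) =
       (\<Sum>t\<in>J. of_bool (p - (t, 2 * t) = (0, 0)) - of_bool (p - (t, 2 * t) = (int n, 0)) :: real)"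
    proof (cases "\<exists>t\<in>J. b = 2 * t")
      case True
      then obtain t0 where t0: "t0 \<in> J" "b = 2 * t0" by blast
      have "(\<Sum>t\<in>J. of_bool (p - (t, 2 * t) = (0, 0)) - of_bool (p - (t, 2 * t) = (int n, 0)) :: real) =
         (\<Sum>t\<in>J. if t = t0 then of_bool (a = t0) - of_bool (a = t0 + int n) else 0)"
        by (intro sum.cong) (auto simp: p t0)
      also have "\<dots> = of_bool (a = t0) - of_bool (a = t0 + int n)" using J t0 by simp
      finally show ?thesis using t0 by (auto simp: p cut_set_iff)
    next
      case False
      then have "(\<Sum>t\<in>J. of_bool (p - (t, 2 * t) = (0, 0)) - of_bool (p - (t, 2 * t) = (int n, 0)) :: real) = 0"
        by (intro sum.neutral) (auto simp: p)
      with False show ?thesis by (auto simp: p cut_set_iff)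
    qed
    finally show ?thesis
      by (simp add: charge_def q_dip_def shift_face face_at_up ind_up scaleR_sum_left zero_prod_def)
  qed
  show "d_slip (cut_field ?S) (down_face p) = charge n J (down_face p)" for p
  proof -
    have "d_slip (cut_field ?S) (down_face p) = 0"
      unfolding d_slip_def down_face_def prod.case cut_field_def crosses_lat
      by (cases p) (simp flip: scaleR_add_left)
    then show ?thesis
      by (simp add: charge_def q_dip_def shift_face face_at_up ind_up)
  qed
  show "d_slip (cut_field ?S) (y, z, x) = charge n J (y, z, x)"
    if "d_slip (cut_field ?S) (x, y, z) = charge n J (x, y, z)" for x y z
    using that by (simp add: d_slip_def charge_def q_dip_def shift_def ind_rot add_ac)
  show "d_slip (cut_field ?S) (z, y, x) = charge n J (z, y, x)"
    if "d_slip (cut_field ?S) (x, y, z) = charge n J (x, y, z)" for x y z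
  proof -
    have "d_slip (cut_field ?S) (z, y, x) = - d_slip (cut_field ?S) (x, y, z)"
      by (simp add: d_slip_def cut_field_def algebra_simps)
    moreover have "charge n J (z, y, x) = - charge n J (x, y, z)"
      unfolding charge_def sum_negf[symmetric] q_dip_def shift_def prod.case face_at_up
      by (intro sum.cong refl) (subst (1 2) ind_flip, simp add: algebra_simps)
    ultimately show ?thesis using that by simp
  qed
qed

text \<open>A slip \<open>b1\<close> has components -1/2 along both \<open>b2\<close> and
  \<open>b3\<close>. Bonds along \<open>b3\<close> traverse the cut downwards and are indexed by
  their upper end, hence the other sign and the translated index in \<open>s3\<close>; horizontal
  bonds are never cut.\<close>

lemma thermo_charge:
  fixes n :: nat and J :: "int set"
  assumes J: "finite J"
  defines "s2 \<equiv> \<lambda>p. - 1/2 * of_bool (p \<in> cut_set n J)"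
    and "s3 \<equiv> \<lambda>p. 1/2 * of_bool (p + (-1, -1) \<in> cut_set n J)"
  shows "has_thermo_limit (charge n J)"
    and "thermo_energy (charge n J) = 1/2 * (\<integral>k. (norm (eta (\<lambda>_. 0) s2 s3 k))\<^sup>2 / symb k \<partial>zone)"
proof -
  let ?S = "cut_set n J"
  have fin: "finite ?S" by (rule finite_cut_set[OF J])
  obtain N0 where N0: "\<And>N. N \<ge> N0 \<Longrightarrow> ?S \<subseteq> ibox N" using ibox_exhausts[OF fin] by blast
  have b3: "b1 \<bullet> b3 = -1/2" by (simp add: b3_def inner_diff_right inner_b)
  have e1: "(\<lambda>p. cut_field ?S (lat p) (lat (p + (1, 0))) \<bullet> b1) = (\<lambda>_. 0)"
    unfolding cut_field_def crosses_lat by (auto simp: fun_eq_iff zero_prod_def)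
  have e2: "(\<lambda>p. cut_field ?S (lat p) (lat (p + (0, 1))) \<bullet> b2) = s2"
    unfolding cut_field_def crosses_lat by (auto simp: fun_eq_iff inner_b s2_def zero_prod_def)
  have e3: "(\<lambda>p. cut_field ?S (lat p) (lat (p + (-1, -1))) \<bullet> b3) = s3"
    unfolding cut_field_def crosses_lat by (auto simp: fun_eq_iff b3 s3_def zero_prod_def)
  have f1: "finsupp (\<lambda>_. 0)" by (simp add: finsupp_def)
  have f2: "finsupp s2" by (rule finsupp_supp[OF fin]) (simp add: s2_def)
  have f3: "finsupp s3"
    unfolding s3_def by (intro finsupp_cmult finsupp_shift finsupp_supp[OF fin]) simp
  have en: "energies N (charge n J) = {strain (\<lambda>_. 0) s2 s3 w1 w2 / 2 | w1 w2.
      \<forall>n. n \<notin> ibox N \<longrightarrow> w1 n = 0 \<and> w2 n = 0}" if "N \<ge> N0" for N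
    using energies_eq_strain[OF slip_field_cut[OF N0[OF that]] d_slip_cut[OF J]] unfolding e1 e2 e3 .
  show "has_thermo_limit (charge n J)"
    "thermo_energy (charge n J) = 1/2 * (\<integral>k. (norm (eta (\<lambda>_. 0) s2 s3 k))\<^sup>2 / symb k \<partial>zone)"
    by (rule thermo_limit_from_strain[OF f1 f2 f3 en], assumption)+
qed

section \<open>The energy as an integral\<close>

definition Rden :: "real \<Rightarrow> real \<Rightarrow> real" where
  "Rden a b = 4 * (sin a)\<^sup>2 * (1 - cos a * cos b) + (cos a - cos b)\<^sup>2"

text \<open>The numerator is the squared modulus of \<open>cos a - cis b\<close>, what remains of
  \<open>eta\<close> once the geometric sums of the charge array are split off.\<close>

definition Rker :: "real \<Rightarrow> real \<Rightarrow> real" where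
  "Rker a b = (1 + (cos a)\<^sup>2 - 2 * cos a * cos b) / Rden a b"

definition expsum :: "int set \<Rightarrow> real \<Rightarrow> complex" where
  "expsum J b = (\<Sum>t\<in>J. cis (2 * of_int t * b))"

lemma norm_cis_diff1: "(norm (cis t - 1))\<^sup>2 = 2 - 2 * cos t"
proof -
  have "(norm (cis t - 1))\<^sup>2 = (cos t - 1)\<^sup>2 + (sin t)\<^sup>2"
    by (simp add: cmod_power2)
  also have "\<dots> = 2 - 2 * cos t" by (simp add: power2_eq_square algebra_simps sin_squared_eq[unfolded power2_eq_square])
  finally show ?thesis .
qed

lemma norm_cis_double_diff1: "(norm (cis (2 * t) - 1))\<^sup>2 = 4 * (sin t)\<^sup>2"
  by (simp add: norm_cis_diff1 cos_double_sin)

text \<open>The Dirichlet kernel, with the denominator multiplied out so that the zeros of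
  \<open>sin a\<close> are covered. For the dipole this factor is supplied by \<open>d1\<close>; the
  same identity later controls the sum over a wall.\<close>

lemma norm_geometric_cis:
  "(norm (\<Sum>k=1..n. cis (2 * real k * a)))\<^sup>2 * (sin a)\<^sup>2 = (sin (real n * a))\<^sup>2"
proof -
  have *: "(\<Sum>k=1..n. cis (2 * real k * a)) * (cis (2 * a) - 1) = cis (2 * a) * (cis (2 * (real n * a)) - 1)"
    by (induction n) (auto simp: algebra_simps cis_mult)
  have "(norm ((\<Sum>k=1..n. cis (2 * real k * a)) * (cis (2 * a) - 1)))\<^sup>2 = 4 * (sin (real n * a))\<^sup>2"
    unfolding * norm_mult power_mult_distrib norm_cis_double_diff1 by simp
  then show ?thesis
    unfolding norm_mult power_mult_distrib norm_cis_double_diff1 by simp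
qed

text \<open>The product of the squared moduli of \<open>d2\<close> and \<open>d3\<close> collapses
  to \<open>4 * (cos a - cos b)\<^sup>2\<close>, and their sum is
  \<open>4 * (1 - cos a * cos b)\<close>.\<close>

lemma symb_eq: "symb (a, b) = 4 * Rden a b"
proof -
  have 1: "(norm (d1 (a, b)))\<^sup>2 = 4 * (sin a)\<^sup>2"
    using norm_cis_double_diff1[of "- a"] by (simp add: d1_def chi_def)
  have 2: "(norm (d2 (a, b)))\<^sup>2 = 2 - 2 * cos (a - b)"
    using norm_cis_diff1[of "a - b"] by (simp add: d2_def chi_def)
  have 3: "(norm (d3 (a, b)))\<^sup>2 = 2 - 2 * cos (a + b)"
    using norm_cis_diff1[of "a + b"] by (simp add: d3_def chi_def algebra_simps)
  have "(sin a)\<^sup>2 = 1 - (cos a)\<^sup>2" "(sin b)\<^sup>2 = 1 - (cos b)\<^sup>2" by (rule sin_squared_eq)+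
  then show ?thesis
    unfolding symb_def norm_mult power_mult_distrib 1 2 3 Rden_def cos_add cos_diff by algebra
qed

text \<open>In the chosen frequencies \<open>chi (k + t, 2 * t)\<close> is
  \<open>cis (2 k a) * cis (2 t b)\<close>, so position in the row and height separate although
  successive rows are sheared.\<close>

lemma four_cut_set:
  assumes "finite J"
  shows "four (\<lambda>p. of_bool (p \<in> cut_set n J)) (a, b) = (\<Sum>k=1..n. cis (2 * real k * a)) * expsum J b"
proof -
  have "four (\<lambda>p. of_bool (p \<in> cut_set n J)) (a, b) = (\<Sum>p\<in>cut_set n J. chi p (a, b))"
    by (subst four_eq[OF finite_cut_set[OF assms, of n]]) auto
  also have "\<dots> = (\<Sum>(k, t)\<in>{1..int n} \<times> J. chi (k + t, 2 * t) (a, b))"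
    unfolding cut_set_def by (subst sum.reindex) (auto simp: inj_on_def case_prod_unfold)
  also have "\<dots> = (\<Sum>k\<in>{1..int n}. \<Sum>t\<in>J. cis (2 * of_int k * a) * cis (2 * of_int t * b))"
    unfolding sum.cartesian_product by (intro sum.cong refl) (auto simp: chi_def cis_mult algebra_simps)
  also have "\<dots> = (\<Sum>k\<in>{1..int n}. cis (2 * of_int k * a)) * expsum J b"
    by (simp add: expsum_def sum_product)
  also have "(\<Sum>k\<in>{1..int n}. cis (2 * of_int k * a)) = (\<Sum>k=1..n. cis (2 * real k * a))"
    by (rule sum.reindex_bij_witness[of _ int nat]) auto
  finally show ?thesis .
qed

lemma eta_cut_set:
  assumes "finite J"
  shows "(norm (eta (\<lambda>_. 0) (\<lambda>p. - 1/2 * of_bool (p \<in> cut_set n J))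
      (\<lambda>p. 1/2 * of_bool (p + (-1, -1) \<in> cut_set n J)) (a, b)))\<^sup>2 =
    4 * (sin (real n * a))\<^sup>2 * (norm (expsum J b))\<^sup>2 * (1 + (cos a)\<^sup>2 - 2 * cos a * cos b)"
proof -
  let ?i = "\<lambda>p. of_bool (p \<in> cut_set n J) :: real"
  let ?X = "four ?i (a, b)"
  have fs: "finsupp ?i" by (rule finsupp_supp[OF finite_cut_set[OF assms, of n]]) simp
  have s1: "four (\<lambda>_. 0) (a, b) = 0" by (simp add: four_def)
  have s2: "four (\<lambda>p. - 1/2 * ?i p) (a, b) = - ?X / 2" using four_cmult[OF fs, of "-1/2" "(a, b)"] by simp
  have s3: "four (\<lambda>p. 1/2 * ?i (p + (-1, -1))) (a, b) = chi (1, 1) (a, b) * ?X / 2"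
    using four_cmult[OF finsupp_shift[OF fs], of "1/2" "(-1, -1)" "(a, b)"] four_shift[of ?i "(-1, -1)" "(a, b)"]
    by simp
  \<comment> \<open>Both slipped directions carry the factor \<open>d1\<close>; the remainder is
    \<open>cis (2 * a) + 1 - 2 * cis (a + b)\<close>, in which the common phase \<open>cis a\<close>
    produces the cosine.\<close>
  have z: "chi (1, 1) (a, b) * d2 (a, b) - d3 (a, b) = 2 * cis a * (cos a - cis b)"
  proof -
    have 1: "chi (1, 1) (a, b) * chi (0, -1) (a, b) = cis (2 * a)" "chi (1, 1) (a, b) = cis a * cis b"
      by (simp_all add: chi_def cis_mult algebra_simps)
    have 2: "cis (2 * a) = 2 * cos a * cis a - 1"
      by (simp add: complex_eq_iff cos_double_cos sin_double power2_eq_square)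
    have "chi (1, 1) (a, b) * d2 (a, b) - d3 (a, b) = chi (1, 1) (a, b) * chi (0, -1) (a, b) + 1 - 2 * chi (1, 1) (a, b)"
      by (simp add: d2_def d3_def algebra_simps)
    also have "\<dots> = 2 * cis a * (cos a - cis b)" unfolding 1(1) 2 unfolding 1(2) by (simp add: algebra_simps)
    finally show ?thesis .
  qed
  have "eta (\<lambda>_. 0) (\<lambda>p. - 1/2 * ?i p) (\<lambda>p. 1/2 * ?i (p + (-1, -1))) (a, b) =
      ?X / 2 * d1 (a, b) * (chi (1, 1) (a, b) * d2 (a, b) - d3 (a, b))"
    unfolding eta_def s1 s2 s3 by (simp add: algebra_simps)
  also have "\<dots> = ?X * d1 (a, b) * (cis a * (cos a - cis b))" unfolding z by simp
  finally have "(norm (eta (\<lambda>_. 0) (\<lambda>p. - 1/2 * ?i p) (\<lambda>p. 1/2 * ?i (p + (-1, -1))) (a, b)))\<^sup>2 =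
      (norm ?X)\<^sup>2 * (norm (d1 (a, b)))\<^sup>2 * (norm (cos a - cis b))\<^sup>2"
    by (simp add: norm_mult power_mult_distrib)
  also have "(norm (d1 (a, b)))\<^sup>2 = 4 * (sin a)\<^sup>2"
    using norm_cis_double_diff1[of "- a"] by (simp add: d1_def chi_def)
  also have "(norm (cos a - cis b))\<^sup>2 = 1 + (cos a)\<^sup>2 - 2 * cos a * cos b"
    unfolding cmod_power2 using sin_squared_eq[of b] by (simp add: power2_eq_square algebra_simps)
  also have "(norm ?X)\<^sup>2 * (4 * (sin a)\<^sup>2) = 4 * ((norm (\<Sum>k=1..n. cis (2 * real k * a)))\<^sup>2 * (sin a)\<^sup>2) * (norm (expsum J b))\<^sup>2"
    unfolding four_cut_set[OF assms] by (simp add: norm_mult power_mult_distrib)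
  finally show ?thesis unfolding norm_geometric_cis by simp
qed

lemma thermo_charge_kernel:
  assumes "finite J"
  shows "thermo_energy (charge n J) =
    1/2 * (\<integral>k. (sin (real n * fst k))\<^sup>2 * Rker (fst k) (snd k) * (norm (expsum J (snd k)))\<^sup>2 \<partial>zone)"
proof -
  have "(norm (eta (\<lambda>_. 0) (\<lambda>p. - 1/2 * of_bool (p \<in> cut_set n J))
      (\<lambda>p. 1/2 * of_bool (p + (-1, -1) \<in> cut_set n J)) k))\<^sup>2 / symb k =
    (sin (real n * fst k))\<^sup>2 * Rker (fst k) (snd k) * (norm (expsum J (snd k)))\<^sup>2" for k
    using eta_cut_set[OF assms, of n "fst k" "snd k"] symb_eq[of "fst k" "snd k"] by (simp add: Rker_def)
  then show ?thesis using thermo_charge(2)[OF assms, of n] by simp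
qed

section \<open>Bounds on the kernel and its one-dimensional slices\<close>

lemma Rnum_nonneg:
  fixes a b :: real
  shows "0 \<le> 1 + (cos a)\<^sup>2 - 2 * cos a * cos b"
proof -
  have "1 + (cos a)\<^sup>2 - 2 * cos a * cos b = (cos a - cos b)\<^sup>2 + (sin b)\<^sup>2"
    using sin_squared_eq[of b] by (simp add: power2_eq_square algebra_simps)
  then show ?thesis by simp
qed

lemma cos_cos_le:
  fixes a b :: real
  shows "cos a * cos b \<le> 1"
  using mult_le_one[of "\<bar>cos a\<bar>" "\<bar>cos b\<bar>"] by (simp add: abs_mult[symmetric] abs_le_iff)

lemma Rden_nonneg: "Rden a b \<ge> 0"
  using cos_cos_le[of a b] by (simp add: Rden_def)

lemma Rker_nonneg: "Rker a b \<ge> 0"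
  using Rnum_nonneg[of a b] Rden_nonneg[of a b] by (simp add: Rker_def)

lemma sin_sq_Rker_le: "(sin a)\<^sup>2 * Rker a b \<le> 1/2"
proof (cases "Rden a b = 0")
  case False
  then have p: "Rden a b > 0" using Rden_nonneg[of a b] by simp
  have "(sin a)\<^sup>2 * (1 + (cos a)\<^sup>2 - 2 * cos a * cos b) \<le> (sin a)\<^sup>2 * (2 * (1 - cos a * cos b))"
    by (intro mult_left_mono) (auto simp: abs_square_le_1)
  also have "\<dots> \<le> Rden a b / 2" by (simp add: Rden_def algebra_simps)
  finally show ?thesis using p by (simp add: Rker_def divide_le_eq)
qed (simp add: Rker_def)

lemma abs_sin_mult_le: "\<bar>sin (real n * a)\<bar> \<le> real n * \<bar>sin a\<bar>"
proof (induction n)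
  case (Suc n)
  have "\<bar>sin (real (Suc n) * a)\<bar> = \<bar>sin (real n * a) * cos a + cos (real n * a) * sin a\<bar>"
    by (simp add: distrib_right sin_add algebra_simps)
  also have "\<dots> \<le> \<bar>sin (real n * a)\<bar> * \<bar>cos a\<bar> + \<bar>cos (real n * a)\<bar> * \<bar>sin a\<bar>"
    by (metis abs_mult abs_triangle_ineq)
  also have "\<dots> \<le> \<bar>sin (real n * a)\<bar> * 1 + 1 * \<bar>sin a\<bar>"
    by (intro add_mono mult_left_mono mult_right_mono) auto
  finally show ?case using Suc.IH by (simp add: algebra_simps)
qed simp

text \<open>The dipole factor compensates the singularity of the kernel. The bound depends on n,
  which is enough for Fubini and for continuity in b while n is fixed.\<close>

lemma sin_mult_sq_Rker_le: "(sin (real n * a))\<^sup>2 * Rker a b \<le> (real n)\<^sup>2 / 2"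
proof -
  have "(sin (real n * a))\<^sup>2 \<le> (real n)\<^sup>2 * (sin a)\<^sup>2"
    using power_mono[OF abs_sin_mult_le[of n a], of 2] by (simp add: power_mult_distrib)
  then have "(sin (real n * a))\<^sup>2 * Rker a b \<le> (real n)\<^sup>2 * ((sin a)\<^sup>2 * Rker a b)"
    using mult_right_mono[OF _ Rker_nonneg] by (simp add: mult.assoc[symmetric])
  also have "\<dots> \<le> (real n)\<^sup>2 * (1/2)"
    by (intro mult_left_mono sin_sq_Rker_le) auto
  finally show ?thesis by simp
qed

lemma continuous_expsum [continuous_intros]:
  "continuous_on S f \<Longrightarrow> continuous_on S (\<lambda>x. expsum J (f x))"
  unfolding expsum_def by (intro continuous_intros)

lemma norm_expsum_le: "norm (expsum J b) \<le> card J"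
  unfolding expsum_def using sum_norm_le[of J "\<lambda>t. cis (2 * of_int t * b)" "\<lambda>_. 1"] by simp

lemma measurable_Rker_zone: "(\<lambda>k. Rker (fst k) (snd k)) \<in> borel_measurable zone"
  unfolding Rker_def Rden_def by (intro borel_measurable_divide measurable_zoneI continuous_intros)

lemma measurable_Rker [measurable]:
  "(\<lambda>a. Rker a b) \<in> borel_measurable borel" "(\<lambda>b. Rker a b) \<in> borel_measurable borel"
  unfolding Rker_def Rden_def by measurable

lemma integrable_kernel:
  "integrable zone (\<lambda>(a, b). (sin (real n * a))\<^sup>2 * Rker a b * (norm (expsum J b))\<^sup>2)"
proof (rule zone.integrable_const_bound)
  show "AE k in zone. norm (case k of (a, b) \<Rightarrow> (sin (real n * a))\<^sup>2 * Rker a b * (norm (expsum J b))\<^sup>2)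
     \<le> (real n)\<^sup>2 / 2 * (real (card J))\<^sup>2"
  proof (intro AE_I2, clarify)
    fix a b
    have "(sin (real n * a))\<^sup>2 * Rker a b * (norm (expsum J b))\<^sup>2 \<le> (real n)\<^sup>2 / 2 * (real (card J))\<^sup>2"
      by (intro mult_mono sin_mult_sq_Rker_le power_mono norm_expsum_le) (auto simp: Rker_nonneg)
    then show "norm ((sin (real n * a))\<^sup>2 * Rker a b * (norm (expsum J b))\<^sup>2) \<le> (real n)\<^sup>2 / 2 * (real (card J))\<^sup>2"
      by (simp add: Rker_nonneg abs_mult)
  qed
  show "(\<lambda>(a, b). (sin (real n * a))\<^sup>2 * Rker a b * (norm (expsum J b))\<^sup>2) \<in> borel_measurable zone"
    unfolding case_prod_unfold
    by (rule borel_measurable_times[OF borel_measurable_times[OF measurable_zoneI measurable_Rker_zone] measurable_zoneI])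
       (intro continuous_intros)+
qed

text \<open>The slice seen by the grain boundary, whose wall sum depends on b alone. The dipole
  integrates b away first, so in \<open>Kker\<close> the factor depending on a can stay
  outside.\<close>

definition Gker :: "nat \<Rightarrow> real \<Rightarrow> real" where
  "Gker n b = (\<integral>a. (sin (real n * a))\<^sup>2 * Rker a b \<partial>unif (pi/2))"

definition Kker :: "real \<Rightarrow> real" where
  "Kker a = (\<integral>b. Rker a b \<partial>unif pi)"

lemma thermo_charge_Gker:
  assumes "finite J"
  shows "thermo_energy (charge n J) = 1/2 * (\<integral>b. (norm (expsum J b))\<^sup>2 * Gker n b \<partial>unif pi)"
proof -
  have "(\<integral>k. (sin (real n * fst k))\<^sup>2 * Rker (fst k) (snd k) * (norm (expsum J (snd k)))\<^sup>2 \<partial>zone) =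
     (\<integral>b. (\<integral>a. (sin (real n * a))\<^sup>2 * Rker a b * (norm (expsum J b))\<^sup>2 \<partial>unif (pi/2)) \<partial>unif pi)"
    using zone.integral_snd[OF integrable_kernel, of n J] by (simp add: case_prod_unfold)
  then show ?thesis
    unfolding thermo_charge_kernel[OF assms] by (simp add: Gker_def mult.commute)
qed

lemma thermo_charge_Kker:
  "thermo_energy (charge n {0}) = 1/2 * (\<integral>a. (sin (real n * a))\<^sup>2 * Kker a \<partial>unif (pi/2))"
  and integrable_Kker: "integrable (unif (pi/2)) (\<lambda>a. (sin (real n * a))\<^sup>2 * Kker a)"
proof -
  have e: "expsum {0} b = 1" for b by (simp add: expsum_def)
  have i: "integrable zone (\<lambda>(a, b). (sin (real n * a))\<^sup>2 * Rker a b)"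
    using integrable_kernel[of n "{0}"] by (simp add: e)
  have "(\<integral>k. (sin (real n * fst k))\<^sup>2 * Rker (fst k) (snd k) \<partial>zone) =
     (\<integral>a. (\<integral>b. (sin (real n * a))\<^sup>2 * Rker a b \<partial>unif pi) \<partial>unif (pi/2))"
    using zone.integral_fst'[OF i] by (simp add: case_prod_unfold)
  then show "thermo_energy (charge n {0}) = 1/2 * (\<integral>a. (sin (real n * a))\<^sup>2 * Kker a \<partial>unif (pi/2))"
    using thermo_charge_kernel[of "{0}" n] by (simp add: Kker_def[abs_def] e)
  show "integrable (unif (pi/2)) (\<lambda>a. (sin (real n * a))\<^sup>2 * Kker a)"
    using zone.integrable_fst'[OF i] by (simp add: Kker_def)
qed

lemma Rden_pos:
  assumes "a \<noteq> 0" "\<bar>a\<bar> \<le> pi / 2"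
  shows "Rden a b > 0"
  using symb_pos[of "(a, b)"] assms by (simp add: symb_eq)

lemma measurable_sin_sq_Rker: "(\<lambda>a. (sin (real n * a))\<^sup>2 * Rker a b) \<in> borel_measurable (unif r)"
proof -
  have "(\<lambda>a. (sin (real n * a))\<^sup>2) \<in> borel_measurable borel"
    by (intro borel_measurable_continuous_onI continuous_intros)
  from borel_measurable_times[OF this measurable_Rker(1)[of b]] show ?thesis
    unfolding measurable_cong_sets[OF sets_unif refl] .
qed

text \<open>Dominated convergence: for every nonzero a in the interval the denominator is positive,
  and \<open>n\<^sup>2 / 2\<close> dominates uniformly in b.\<close>

lemma continuous_Gker: "continuous_on UNIV (Gker n)"
proof (rule continuous_on_sequentiallyI)
  fix u :: "nat \<Rightarrow> real" and b assume u: "u \<longlonglongrightarrow> b"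
  have lim: "AE a in unif (pi/2). (\<lambda>j. (sin (real n * a))\<^sup>2 * Rker a (u j)) \<longlonglongrightarrow> (sin (real n * a))\<^sup>2 * Rker a b"
    using AE_unif_neq[of 0 "pi/2"] AE_unif_bounds[of "pi/2"]
  proof eventually_elim
    case (elim a)
    then have "\<bar>a\<bar> \<le> pi / 2" by (auto simp: abs_le_iff)
    with elim have "Rden a b \<noteq> 0" using Rden_pos[of a b] by simp
    then show ?case
      unfolding Rker_def Rden_def by (intro tendsto_intros u)
  qed
  have bd: "AE a in unif (pi/2). norm ((sin (real n * a))\<^sup>2 * Rker a (u j)) \<le> (real n)\<^sup>2 / 2" for j
    using sin_mult_sq_Rker_le by (simp add: Rker_nonneg abs_mult)
  show "(\<lambda>j. Gker n (u j)) \<longlonglongrightarrow> Gker n b"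
    unfolding Gker_def
    by (rule integral_dominated_convergence[OF measurable_sin_sq_Rker measurable_sin_sq_Rker _ lim bd]) simp
qed

section \<open>The singularity of the kernel\<close>

text \<open>The lower bound is the Maclaurin expansion of order four, the upper one the half-angle
  formula. Everything is expressed in \<open>t\<^sup>2 / 2\<close>, the variable to which
  \<open>1 - cos t\<close> is compared afterwards.\<close>

lemma cos_quartic_bounds:
  fixes t :: real
  shows "t\<^sup>2 / 2 - (t\<^sup>2 / 2)\<^sup>2 / 6 \<le> 1 - cos t" "1 - cos t \<le> t\<^sup>2 / 2" "0 \<le> 1 - cos t"
proof -
  obtain u where u: "cos t = (\<Sum>m<4. cos_coeff m * t ^ m) + cos (u + 1 / 2 * real 4 * pi) / fact 4 * t ^ 4"
    using Maclaurin_cos_expansion[of t 4] by blast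
  have "(\<Sum>m<4. cos_coeff m * t ^ m) = 1 - t\<^sup>2 / 2"
  proof -
    have "{..<4} = {0, 1, 2, 3::nat}" by auto
    then show ?thesis by (simp add: cos_coeff_def fact_numeral)
  qed
  moreover have "cos (u + 1 / 2 * real 4 * pi) / fact 4 * t ^ 4 \<le> 1 / fact 4 * t ^ 4"
    by (intro mult_right_mono divide_right_mono) auto
  ultimately have "cos t \<le> 1 - t\<^sup>2 / 2 + t ^ 4 / 24" using u by (simp add: fact_numeral)
  then show "t\<^sup>2 / 2 - (t\<^sup>2 / 2)\<^sup>2 / 6 \<le> 1 - cos t" by (simp add: power2_eq_square power4_eq_xxxx field_simps)
  have "cos t = 1 - 2 * (sin (t / 2))\<^sup>2" using cos_double_sin[of "t / 2"] by simp
  moreover have "(sin (t / 2))\<^sup>2 \<le> (t / 2)\<^sup>2"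
    using power_mono[OF abs_sin_x_le_abs_x[of "t/2"], of 2] by (simp add: power_divide)
  ultimately show "1 - cos t \<le> t\<^sup>2 / 2" by (simp add: power_divide)
qed simp

definition Rlim :: "real \<Rightarrow> real \<Rightarrow> real" where
  "Rlim a b = 4 * b\<^sup>2 / (b\<^sup>2 + 3 * a\<^sup>2)\<^sup>2"

text \<open>With \<open>x = 1 - cos a\<close> and \<open>y = 1 - cos b\<close> the kernel is a rational function whose leading
  homogeneous part at the origin is \<open>2 y / (y + 3 x)\<^sup>2\<close>.\<close>

lemma kernel_rational_bound:
  fixes x y :: real
  assumes x: "0 \<le> x" "x \<le> 1" and y: "0 \<le> y" "y \<le> 2" and p: "y + 3 * x > 0"
  defines "d \<equiv> (y - x)\<^sup>2 + 4 * x * (2 - x) * (x + y - x * y)"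
  shows "d \<ge> (y + 3 * x)\<^sup>2 / 20" "\<bar>(x\<^sup>2 + 2 * y - 2 * x * y) / d - 2 * y / (y + 3 * x)\<^sup>2\<bar> \<le> 80"
proof -
  let ?p = "y + 3 * x"
  have c: "x + y - x * y \<ge> (x + y) / 3"
  proof -
    have "(1 - x) * y \<ge> 0" "(2 - y) * x \<ge> 0" using x y by simp_all
    then have "x * y \<le> y" "x * y \<le> 2 * x" by (simp_all add: algebra_simps)
    then show ?thesis by (simp add: field_simps)
  qed
  have "x * ((2 - x) * (x + y - x * y)) \<ge> x * (1 * ((x + y) / 3))"
    using x y c by (intro mult_left_mono mult_mono) auto
  then have "d \<ge> (y - x)\<^sup>2 + 4 * (x * ((x + y) / 3))" unfolding d_def by (simp add: mult.assoc)
  \<comment> \<open>The constant 20 is generous enough to leave a positive definite form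
    \<open>19/20 y\<^sup>2 - 29/30 x y + 113/60 x\<^sup>2\<close>; completing the square in y gives
    the coefficient 58/114.\<close>
  moreover have "(y - x)\<^sup>2 + 4 * (x * ((x + y) / 3)) - ?p\<^sup>2 / 20 = (19/20) * (y - (58/114) * x)\<^sup>2 + (113/60 - (19/20) * (58/114)\<^sup>2) * x\<^sup>2"
    by (simp add: power2_eq_square field_simps)
  moreover have "\<dots> \<ge> 0" by (intro add_nonneg_nonneg mult_nonneg_nonneg) (auto simp: power2_eq_square)
  ultimately show d: "d \<ge> ?p\<^sup>2 / 20" by linarith
  have p2: "?p\<^sup>2 > 0" using p by simp
  have d0: "d > 0" using d p2 by linarith
  \<comment> \<open>The quadratic part of \<open>d\<close> is exactly
    \<open>(y + 3 * x)\<^sup>2\<close>; the rest is of order three, so after cross-multiplication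
    the error has order four, like the denominator.\<close>
  have deq: "d = ?p\<^sup>2 - 4 * x\<^sup>2 * (x + 3 * y - x * y)"
    by (simp add: d_def power2_eq_square algebra_simps)
  have num: "(x\<^sup>2 + 2 * y - 2 * x * y) * ?p\<^sup>2 - 2 * y * d = (x\<^sup>2 - 2 * x * y) * ?p\<^sup>2 + 8 * (x\<^sup>2 * (y * (x + 3 * y - x * y)))"
    unfolding deq by (simp add: algebra_simps)
  have xp: "x \<le> ?p / 3" "y \<le> ?p" using x y by auto
  have xy: "0 \<le> x * y" "0 \<le> x * x" "0 \<le> y * y" using x y by simp_all
  have b1: "\<bar>x\<^sup>2 - 2 * x * y\<bar> \<le> ?p\<^sup>2"
    unfolding abs_le_iff using xy by (simp add: power2_eq_square algebra_simps)
  have s: "0 \<le> x + 3 * y - x * y" "x + 3 * y - x * y \<le> 3 * ?p"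
    using c x y xy(1) by argo+
  have "x\<^sup>2 * (y * (x + 3 * y - x * y)) \<le> (?p / 3)\<^sup>2 * (?p * (3 * ?p))"
    using x y xp s by (intro mult_mono power_mono) auto
  also have "\<dots> = ?p\<^sup>2 * ?p\<^sup>2 / 3" by (simp add: power2_eq_square)
  finally have "x\<^sup>2 * (y * (x + 3 * y - x * y)) \<le> ?p\<^sup>2 * ?p\<^sup>2 / 3" .
  moreover have "0 \<le> ?p\<^sup>2 * ?p\<^sup>2" by simp
  ultimately have b2: "8 * (x\<^sup>2 * (y * (x + 3 * y - x * y))) \<le> 3 * (?p\<^sup>2 * ?p\<^sup>2)"
    by linarith
  have "\<bar>(x\<^sup>2 - 2 * x * y) * ?p\<^sup>2\<bar> \<le> ?p\<^sup>2 * ?p\<^sup>2"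
    unfolding abs_mult using b1 by (intro mult_mono) auto
  moreover have "0 \<le> 8 * (x\<^sup>2 * (y * (x + 3 * y - x * y)))" using x y s by (intro mult_nonneg_nonneg) auto
  ultimately have n: "\<bar>(x\<^sup>2 + 2 * y - 2 * x * y) * ?p\<^sup>2 - 2 * y * d\<bar> \<le> 4 * (?p\<^sup>2 * ?p\<^sup>2)"
    unfolding num using b2 by linarith
  have "(x\<^sup>2 + 2 * y - 2 * x * y) / d - 2 * y / ?p\<^sup>2 = ((x\<^sup>2 + 2 * y - 2 * x * y) * ?p\<^sup>2 - 2 * y * d) / (d * ?p\<^sup>2)"
    using d0 p2 by (intro diff_frac_eq) auto
  then have "\<bar>(x\<^sup>2 + 2 * y - 2 * x * y) / d - 2 * y / ?p\<^sup>2\<bar> = \<bar>(x\<^sup>2 + 2 * y - 2 * x * y) * ?p\<^sup>2 - 2 * y * d\<bar> / (d * ?p\<^sup>2)"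
    using d0 by (simp add: abs_mult)
  also have "\<dots> \<le> 4 * (?p\<^sup>2 * ?p\<^sup>2) / (?p\<^sup>2 / 20 * ?p\<^sup>2)"
    using n d p2 by (intro frac_le mult_right_mono) auto
  also have "\<dots> = 80" using p2 by simp
  finally show "\<bar>(x\<^sup>2 + 2 * y - 2 * x * y) / d - 2 * y / ?p\<^sup>2\<bar> \<le> 80" .
qed

text \<open>The function \<open>2 y / (y + 3 x)\<^sup>2\<close> has degree -1 and its derivatives
  degree -2, so a perturbation of second order changes it by a bounded amount. The bound 5 on
  \<open>X\<close> and \<open>Y\<close> gives \<open>x \<ge> X / 6\<close> and
  \<open>y \<ge> Y / 6\<close>; this keeps the denominators comparable and yields 72 = 2 *
  36.\<close>

lemma homogeneous_perturbation:
  fixes x y X Y :: real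
  assumes X: "0 \<le> X" "X \<le> 5" "X - X\<^sup>2 / 6 \<le> x" "x \<le> X"
    and Y: "0 \<le> Y" "Y \<le> 5" "Y - Y\<^sup>2 / 6 \<le> y" "y \<le> Y" and P: "Y + 3 * X > 0"
  shows "y + 3 * x > 0" "\<bar>2 * y / (y + 3 * x)\<^sup>2 - 2 * Y / (Y + 3 * X)\<^sup>2\<bar> \<le> 72"
proof -
  let ?P = "Y + 3 * X" and ?p = "y + 3 * x"
  have "X * X \<le> 5 * X" "Y * Y \<le> 5 * Y" using X Y by (auto intro!: mult_right_mono)
  then have xy: "x \<ge> X / 6" "y \<ge> Y / 6" using X Y by (auto simp: power2_eq_square)
  then have p: "?P / 6 \<le> ?p" by simp
  have "0 < ?P / 6" using P by simp
  then show p0: "?p > 0" using p by (rule less_le_trans)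
  have YP: "Y \<le> ?P" "X \<le> ?P / 3" using X Y by auto
  have Y2: "Y\<^sup>2 \<le> ?P\<^sup>2" "X\<^sup>2 \<le> (?P / 3)\<^sup>2" using X Y YP by (auto intro!: power_mono)
  have dy: "\<bar>y - Y\<bar> \<le> ?P\<^sup>2 / 6" using Y Y2 by auto
  have "X\<^sup>2 \<le> ?P\<^sup>2 / 9" using Y2(2) by (simp add: power_divide)
  then have "?P - ?p \<le> ?P\<^sup>2 / 6 + ?P\<^sup>2 / 18" using X(3) Y(3) Y2(1) by argo
  then have dp: "0 \<le> ?P - ?p" "?P - ?p \<le> ?P\<^sup>2 / 4" using X(4) Y(4) zero_le_power2[of ?P] by argo+
  have sp: "?P + ?p \<le> 2 * ?P" "0 \<le> ?P + ?p" using dp p0 P by auto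
  have "(?P - ?p) * (?P + ?p) \<le> (?P\<^sup>2 / 4) * (2 * ?P)" using dp sp by (intro mult_mono) auto
  then have "Y * ((?P - ?p) * (?P + ?p)) \<le> ?P * ((?P\<^sup>2 / 4) * (2 * ?P))"
    using YP Y dp sp by (intro mult_mono) auto
  also have "?P * ((?P\<^sup>2 / 4) * (2 * ?P)) = ?P\<^sup>2 * ?P\<^sup>2 / 2" by (simp add: power2_eq_square)
  finally have e2: "Y * ((?P - ?p) * (?P + ?p)) \<le> ?P\<^sup>2 * ?P\<^sup>2 / 2" .
  have e2': "0 \<le> Y * ((?P - ?p) * (?P + ?p))" using Y dp sp by (intro mult_nonneg_nonneg) auto
  have "\<bar>(y - Y) * ?P\<^sup>2\<bar> \<le> ?P\<^sup>2 / 6 * ?P\<^sup>2"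
    unfolding abs_mult using dy by (intro mult_mono) auto
  moreover have "y * ?P\<^sup>2 - Y * ?p\<^sup>2 = (y - Y) * ?P\<^sup>2 + Y * ((?P - ?p) * (?P + ?p))"
    by (simp add: power2_eq_square algebra_simps)
  moreover have "?P\<^sup>2 * ?P\<^sup>2 \<ge> 0" by simp
  ultimately have n: "\<bar>y * ?P\<^sup>2 - Y * ?p\<^sup>2\<bar> \<le> ?P\<^sup>2 * ?P\<^sup>2" using e2 e2' by linarith
  have "2 * y / ?p\<^sup>2 - 2 * Y / ?P\<^sup>2 = (2 * y * ?P\<^sup>2 - 2 * Y * ?p\<^sup>2) / (?p\<^sup>2 * ?P\<^sup>2)"
    using p0 P by (intro diff_frac_eq) auto
  also have "2 * y * ?P\<^sup>2 - 2 * Y * ?p\<^sup>2 = 2 * (y * ?P\<^sup>2 - Y * ?p\<^sup>2)" by simp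
  finally have "\<bar>2 * y / ?p\<^sup>2 - 2 * Y / ?P\<^sup>2\<bar> = 2 * \<bar>y * ?P\<^sup>2 - Y * ?p\<^sup>2\<bar> / (?p\<^sup>2 * ?P\<^sup>2)"
    by (simp only: abs_divide abs_mult abs_power2 abs_numeral)
  also have "\<dots> \<le> 2 * (?P\<^sup>2 * ?P\<^sup>2) / ((?P / 6)\<^sup>2 * ?P\<^sup>2)"
    using n p P by (intro frac_le mult_left_mono mult_right_mono power_mono) auto
  also have "\<dots> = 72" using P by (simp add: power2_eq_square)
  finally show "\<bar>2 * y / ?p\<^sup>2 - 2 * Y / ?P\<^sup>2\<bar> \<le> 72" .
qed

lemma pi_squared_le: "pi\<^sup>2 \<le> 10"
proof -
  have "pi \<le> 3.1416" using pi_approx by simp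
  then have "pi\<^sup>2 \<le> 3.1416\<^sup>2" by (intro power_mono) auto
  then show ?thesis by (simp add: power2_eq_square)
qed

text \<open>The error 152 is 80 for passing to the leading part in \<open>1 - cos\<close>, plus 72
  for replacing \<open>1 - cos t\<close> by \<open>t\<^sup>2 / 2\<close>. The bound
  \<open>pi\<^sup>2 \<le> 10\<close> is what confines \<open>X\<close> and \<open>Y\<close> to
  5.\<close>

lemma Rker_Rlim:
  assumes a: "\<bar>a\<bar> \<le> pi / 2" and b: "\<bar>b\<bar> \<le> pi" and ab: "a \<noteq> 0 \<or> b \<noteq> 0"
  shows "\<bar>Rker a b - Rlim a b\<bar> \<le> 152" "Rden a b > 0"
proof -
  define x y X Y where "x = 1 - cos a" and "y = 1 - cos b" and "X = a\<^sup>2 / 2" and "Y = b\<^sup>2 / 2"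
  have a2: "a\<^sup>2 \<le> pi\<^sup>2" using a by (intro abs_le_square_iff[THEN iffD1]) auto
  have b2: "b\<^sup>2 \<le> pi\<^sup>2" using b by (intro abs_le_square_iff[THEN iffD1]) auto
  have X: "0 \<le> X" "X \<le> 5" "X - X\<^sup>2 / 6 \<le> x" "x \<le> X"
    using a2 pi_squared_le cos_quartic_bounds[of a] unfolding X_def x_def by auto
  have Y: "0 \<le> Y" "Y \<le> 5" "Y - Y\<^sup>2 / 6 \<le> y" "y \<le> Y"
    using b2 pi_squared_le cos_quartic_bounds[of b] unfolding Y_def y_def by auto
  have "X > 0 \<or> Y > 0" using ab by (auto simp: X_def Y_def)
  then have P: "Y + 3 * X > 0" using X Y by linarith
  note h = homogeneous_perturbation[OF X Y P]
  have "cos a \<ge> 0" using a by (intro cos_ge_zero) auto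
  then have x: "0 \<le> x" "x \<le> 1" by (auto simp: x_def)
  have "cos b \<ge> -1" by simp
  then have y: "0 \<le> y" "y \<le> 2" unfolding y_def using cos_le_one[of b] by linarith+
  have den: "Rden a b = (y - x)\<^sup>2 + 4 * x * (2 - x) * (x + y - x * y)"
    unfolding Rden_def sin_squared_eq x_def y_def by (simp add: power2_eq_square algebra_simps)
  have num: "1 + (cos a)\<^sup>2 - 2 * cos a * cos b = x\<^sup>2 + 2 * y - 2 * x * y"
    unfolding x_def y_def by (simp add: power2_eq_square algebra_simps)
  note k = kernel_rational_bound[OF x y h(1)]
  have "(y + 3 * x)\<^sup>2 > 0" using h(1) by simp
  then show "Rden a b > 0" using k(1) unfolding den by linarith
  have "Rlim a b = 2 * Y / (Y + 3 * X)\<^sup>2"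
    using P by (simp add: Rlim_def X_def Y_def field_simps power2_eq_square)
  then show "\<bar>Rker a b - Rlim a b\<bar> \<le> 152"
    using k(2) h(2) unfolding Rker_def num den by linarith
qed

section \<open>Integrals of the leading part in one variable\<close>

lemma Rlim_nonneg: "Rlim a b \<ge> 0"
  by (simp add: Rlim_def)

lemma integrable_unif_bounded:
  fixes f :: "real \<Rightarrow> real"
  assumes [measurable]: "f \<in> borel_measurable borel" and "AE x in unif r. \<bar>f x\<bar> \<le> B"
  shows "integrable (unif r) f"
  using assms(2) by (intro unif.integrable_const_bound[where B = B]) auto

lemma abs_integral_unif_le:
  fixes f :: "real \<Rightarrow> real"
  assumes r: "r > 0" and f [measurable]: "f \<in> borel_measurable borel" and b: "AE x in unif r. \<bar>f x\<bar> \<le> B"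
  shows "\<bar>integral\<^sup>L (unif r) f\<bar> \<le> B"
proof -
  have i: "integrable (unif r) f" by (rule integrable_unif_bounded[OF f b])
  have "\<bar>integral\<^sup>L (unif r) f\<bar> \<le> (\<integral>x. \<bar>f x\<bar> \<partial>unif r)" using integral_norm_bound[of "unif r" f] by simp
  also have "\<dots> \<le> (\<integral>x. B \<partial>unif r)"
    using i b by (intro integral_mono_AE) auto
  also have "\<dots> = B" using r by simp
  finally show ?thesis .
qed

lemma measurable_Rlim:
  "(\<lambda>a. Rlim a b) \<in> borel_measurable borel" "(\<lambda>b. Rlim a b) \<in> borel_measurable borel"
  unfolding Rlim_def by measurable

lemma Rlim_le:
  "a \<noteq> 0 \<Longrightarrow> Rlim a b \<le> 2 / a\<^sup>2" "b \<noteq> 0 \<Longrightarrow> Rlim a b \<le> 4 / b\<^sup>2"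
proof -
  assume a: "a \<noteq> 0"
  have "(b\<^sup>2 + 3 * a\<^sup>2)\<^sup>2 = 2 * a\<^sup>2 * b\<^sup>2 + (b\<^sup>2 * b\<^sup>2 + 4 * (a\<^sup>2 * b\<^sup>2) + 9 * (a\<^sup>2 * a\<^sup>2))" by algebra
  moreover have "0 \<le> b\<^sup>2 * b\<^sup>2 + 4 * (a\<^sup>2 * b\<^sup>2) + 9 * (a\<^sup>2 * a\<^sup>2)" by (intro add_nonneg_nonneg mult_nonneg_nonneg) auto
  ultimately have "2 * a\<^sup>2 * b\<^sup>2 \<le> (b\<^sup>2 + 3 * a\<^sup>2)\<^sup>2" by linarith
  moreover have "(b\<^sup>2 + 3 * a\<^sup>2) > 0" using a by (intro add_nonneg_pos) auto
  ultimately show "Rlim a b \<le> 2 / a\<^sup>2" using a by (simp add: Rlim_def field_simps)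
next
  assume b: "b \<noteq> 0"
  have "b\<^sup>2 * b\<^sup>2 \<le> (b\<^sup>2 + 3 * a\<^sup>2)\<^sup>2"
    unfolding power2_eq_square[of "b\<^sup>2 + 3 * a\<^sup>2"] by (intro mult_mono) auto
  moreover have "(b\<^sup>2 + 3 * a\<^sup>2) > 0" using b by (intro add_pos_nonneg) auto
  ultimately show "Rlim a b \<le> 4 / b\<^sup>2" using b by (simp add: Rlim_def field_simps)
qed

text \<open>With \<open>q = b\<^sup>2 + 3 * a\<^sup>2\<close>, the arctangent in the primitive
  contributes \<open>2 / q\<close> and the rational term
  \<open>(2 q - 12 a\<^sup>2) / q\<^sup>2\<close>, which add up to
  \<open>4 b\<^sup>2 / q\<^sup>2\<close>.\<close>

lemma integral_Rlim_a:
  assumes b: "b \<noteq> 0"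
  shows "(\<integral>a. Rlim a b \<partial>unif (pi/2)) =
    (4 / (sqrt 3 * b) * arctan (sqrt 3 * (pi/2) / b) + 2 * pi / (b\<^sup>2 + 3 * (pi/2)\<^sup>2)) / pi"
proof -
  define F where "F a = 2 / (sqrt 3 * b) * arctan (sqrt 3 * a / b) + 2 * a / (b\<^sup>2 + 3 * a\<^sup>2)" for a
  have pos: "b\<^sup>2 + 3 * a\<^sup>2 \<noteq> 0" for a using b by (smt (verit) zero_less_power2 zero_le_power2)
  have D: "(F has_vector_derivative Rlim a b) (at a within S)" for a S
  proof -
    have q: "1 + (sqrt 3 * a / b)\<^sup>2 = (b\<^sup>2 + 3 * a\<^sup>2) / b\<^sup>2" using b by (simp add: field_simps power_mult_distrib)
    have "(F has_real_derivative 2 / (sqrt 3 * b) * (sqrt 3 / b * inverse (1 + (sqrt 3 * a / b)\<^sup>2)) +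
        (2 * (b\<^sup>2 + 3 * a\<^sup>2) - 2 * a * (6 * a)) / ((b\<^sup>2 + 3 * a\<^sup>2) * (b\<^sup>2 + 3 * a\<^sup>2))) (at a)"
      unfolding F_def
    proof (intro DERIV_add DERIV_cmult)
      show "((\<lambda>a. arctan (sqrt 3 * a / b)) has_real_derivative sqrt 3 / b * inverse (1 + (sqrt 3 * a / b)\<^sup>2)) (at a)"
        using b by (auto intro!: derivative_eq_intros)
      show "((\<lambda>a. 2 * a / (b\<^sup>2 + 3 * a\<^sup>2)) has_real_derivative
          (2 * (b\<^sup>2 + 3 * a\<^sup>2) - 2 * a * (6 * a)) / ((b\<^sup>2 + 3 * a\<^sup>2) * (b\<^sup>2 + 3 * a\<^sup>2))) (at a)"
        using pos[of a] by (auto intro!: derivative_eq_intros)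
    qed
    moreover have "2 / (sqrt 3 * b) * (sqrt 3 / b * inverse (1 + (sqrt 3 * a / b)\<^sup>2)) +
        (2 * (b\<^sup>2 + 3 * a\<^sup>2) - 2 * a * (6 * a)) / ((b\<^sup>2 + 3 * a\<^sup>2) * (b\<^sup>2 + 3 * a\<^sup>2)) = Rlim a b"
    proof -
      have "2 / (sqrt 3 * b) * (sqrt 3 / b * inverse (1 + (sqrt 3 * a / b)\<^sup>2)) = 2 / (b\<^sup>2 + 3 * a\<^sup>2)"
        unfolding q using b pos[of a] by (simp add: power2_eq_square)
      note 1 = this
      have 2: "2 / q + (2 * q - 2 * a * (6 * a)) / (q * q) = (4 * q - 12 * a\<^sup>2) / q\<^sup>2" if "q \<noteq> 0" for q
        using that by (simp add: field_simps power2_eq_square)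
      show ?thesis unfolding 1 2[OF pos] Rlim_def by simp
    qed
    ultimately show ?thesis
      by (simp add: has_real_derivative_iff_has_vector_derivative[symmetric] has_field_derivative_at_within)
  qed
  have "(\<integral>a. Rlim a b \<partial>unif (pi/2)) = (1 / (2 * (pi/2))) *\<^sub>R (F (pi/2) - F (-(pi/2)))"
  proof (rule integral_unif_FTC[OF _ measurable_Rlim(1) D])
    show "continuous_on {- (pi/2)..pi/2} (\<lambda>a. Rlim a b)"
      unfolding Rlim_def using pos by (intro continuous_intros) auto
  qed simp
  also have "F (pi/2) - F (-(pi/2)) = 4 / (sqrt 3 * b) * arctan (sqrt 3 * (pi/2) / b) + 2 * pi / (b\<^sup>2 + 3 * (pi/2)\<^sup>2)"
    by (simp add: F_def arctan_minus)
  finally show ?thesis by simp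
qed

lemma integral_Rlim_b:
  assumes a: "a \<noteq> 0"
  shows "(\<integral>b. Rlim a b \<partial>unif pi) =
    (4 / (sqrt 3 * a) * arctan (pi / (sqrt 3 * a)) - 4 * pi / (pi\<^sup>2 + 3 * a\<^sup>2)) / (2 * pi)"
proof -
  define F where "F b = 2 / (sqrt 3 * a) * arctan (b / (sqrt 3 * a)) - 2 * b / (b\<^sup>2 + 3 * a\<^sup>2)" for b
  have pos: "b\<^sup>2 + 3 * a\<^sup>2 \<noteq> 0" for b using a by (smt (verit) zero_less_power2 zero_le_power2)
  have D: "(F has_vector_derivative Rlim a b) (at b within S)" for b S
  proof -
    have q: "1 + (b / (sqrt 3 * a))\<^sup>2 = (b\<^sup>2 + 3 * a\<^sup>2) / (3 * a\<^sup>2)" using a by (simp add: field_simps power_mult_distrib)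
    have "(F has_real_derivative 2 / (sqrt 3 * a) * (1 / (sqrt 3 * a) * inverse (1 + (b / (sqrt 3 * a))\<^sup>2)) -
        (2 * (b\<^sup>2 + 3 * a\<^sup>2) - 2 * b * (2 * b)) / ((b\<^sup>2 + 3 * a\<^sup>2) * (b\<^sup>2 + 3 * a\<^sup>2))) (at b)"
      unfolding F_def
    proof (intro DERIV_diff DERIV_cmult)
      show "((\<lambda>b. arctan (b / (sqrt 3 * a))) has_real_derivative 1 / (sqrt 3 * a) * inverse (1 + (b / (sqrt 3 * a))\<^sup>2)) (at b)"
        using a by (auto intro!: derivative_eq_intros)
      show "((\<lambda>b. 2 * b / (b\<^sup>2 + 3 * a\<^sup>2)) has_real_derivative
          (2 * (b\<^sup>2 + 3 * a\<^sup>2) - 2 * b * (2 * b)) / ((b\<^sup>2 + 3 * a\<^sup>2) * (b\<^sup>2 + 3 * a\<^sup>2))) (at b)"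
        using pos[of b] by (auto intro!: derivative_eq_intros)
    qed
    moreover have "2 / (sqrt 3 * a) * (1 / (sqrt 3 * a) * inverse (1 + (b / (sqrt 3 * a))\<^sup>2)) -
        (2 * (b\<^sup>2 + 3 * a\<^sup>2) - 2 * b * (2 * b)) / ((b\<^sup>2 + 3 * a\<^sup>2) * (b\<^sup>2 + 3 * a\<^sup>2)) = Rlim a b"
    proof -
      have "2 / (sqrt 3 * a) * (1 / (sqrt 3 * a) * inverse (1 + (b / (sqrt 3 * a))\<^sup>2)) = 2 / (b\<^sup>2 + 3 * a\<^sup>2)"
        unfolding q using a pos[of b] by (simp add: power2_eq_square field_simps)
      note 1 = this
      have 2: "2 / q - (2 * q - 2 * b * (2 * b)) / (q * q) = 4 * b\<^sup>2 / q\<^sup>2" if "q \<noteq> 0" for q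
        using that by (simp add: field_simps power2_eq_square)
      show ?thesis unfolding 1 2[OF pos] Rlim_def by simp
    qed
    ultimately show ?thesis
      by (simp add: has_real_derivative_iff_has_vector_derivative[symmetric] has_field_derivative_at_within)
  qed
  have "(\<integral>b. Rlim a b \<partial>unif pi) = (1 / (2 * pi)) *\<^sub>R (F pi - F (-pi))"
  proof (rule integral_unif_FTC[OF _ measurable_Rlim(2) D])
    show "continuous_on {- pi..pi} (Rlim a)"
      unfolding Rlim_def using pos by (intro continuous_intros) auto
  qed simp
  also have "F pi - F (-pi) = 4 / (sqrt 3 * a) * arctan (pi / (sqrt 3 * a)) - 4 * pi / (pi\<^sup>2 + 3 * a\<^sup>2)"
    by (simp add: F_def arctan_minus)
  finally show ?thesis by simp
qed

text \<open>Twice the limit of \<open>Gker n b\<close> as n grows, the oscillating factor having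
  mean 1/2.\<close>

definition Jker :: "real \<Rightarrow> real" where
  "Jker b = (\<integral>a. Rker a b \<partial>unif (pi/2))"

lemma arctan_complement:
  assumes "z > 0"
  shows "\<exists>\<delta>. arctan z = pi / 2 - \<delta> \<and> 0 \<le> \<delta> \<and> \<delta> \<le> 1 / z"
  using assms arctan_inverse[of z] arctan_ubound[of z] arctan_le_self[of "1 / z"]
  by (intro exI[of _ "arctan (1 / z)"]) (auto simp: zero_le_arctan_iff inverse_eq_divide)

lemma AE_unif_good: "AE x in unif r. x \<noteq> 0 \<and> \<bar>x\<bar> \<le> r"
  using AE_unif_neq[of 0 r] AE_unif_bounds[of r] by eventually_elim auto

lemma integrable_Rlim_a: "b \<noteq> 0 \<Longrightarrow> integrable (unif r) (\<lambda>a. Rlim a b)"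
  by (rule integrable_unif_bounded[OF measurable_Rlim(1), of _ "4 / b\<^sup>2"]) (auto simp: Rlim_nonneg Rlim_le)

lemma integrable_Rlim_b: "a \<noteq> 0 \<Longrightarrow> integrable (unif r) (\<lambda>b. Rlim a b)"
  by (rule integrable_unif_bounded[OF measurable_Rlim(2), of _ "2 / a\<^sup>2"]) (auto simp: Rlim_nonneg Rlim_le)

text \<open>The case b = 0 is included: there \<open>Rlim\<close> vanishes and
  \<open>4 / b\<^sup>2\<close> is 0 by division by zero, so the bound is 152. This is what tames the
  node k = 0 of the grain boundary.\<close>

lemma Rker_bounded_AE:
  assumes "\<bar>b\<bar> \<le> pi"
  shows "AE a in unif (pi/2). \<bar>Rker a b\<bar> \<le> 4 / b\<^sup>2 + 152"
  using AE_unif_good[of "pi/2"]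
proof eventually_elim
  case (elim a)
  have "Rlim a b \<le> 4 / b\<^sup>2" using Rlim_le(2)[of b a] by (cases "b = 0") (auto simp: Rlim_def)
  then show ?case using elim Rker_Rlim(1)[of a b] Rker_nonneg[of a b] assms by auto
qed

lemma Jker_Rlim:
  assumes "b \<noteq> 0" "\<bar>b\<bar> \<le> pi"
  shows "\<bar>Jker b - (\<integral>a. Rlim a b \<partial>unif (pi/2))\<bar> \<le> 152"
proof -
  have i: "integrable (unif (pi/2)) (\<lambda>a. Rker a b)"
    by (rule integrable_unif_bounded[OF measurable_Rker(1) Rker_bounded_AE[OF assms(2)]])
  have "Jker b - (\<integral>a. Rlim a b \<partial>unif (pi/2)) = (\<integral>a. Rker a b - Rlim a b \<partial>unif (pi/2))"
    unfolding Jker_def by (rule Bochner_Integration.integral_diff[symmetric, OF i integrable_Rlim_a[OF assms(1)]])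
  moreover have "\<bar>\<integral>a. Rker a b - Rlim a b \<partial>unif (pi/2)\<bar> \<le> 152"
  proof (rule abs_integral_unif_le)
    show "(\<lambda>a. Rker a b - Rlim a b) \<in> borel_measurable borel"
      by (intro borel_measurable_diff measurable_Rker measurable_Rlim)
    show "AE a in unif (pi/2). \<bar>Rker a b - Rlim a b\<bar> \<le> 152"
      using AE_unif_good[of "pi/2"] by eventually_elim (rule Rker_Rlim, use assms in auto)
  qed simp
  ultimately show ?thesis by simp
qed

lemma Kker_Rlim:
  assumes "a \<noteq> 0" "\<bar>a\<bar> \<le> pi / 2"
  shows "\<bar>Kker a - (\<integral>b. Rlim a b \<partial>unif pi)\<bar> \<le> 152"
proof -
  have i: "integrable (unif pi) (\<lambda>b. Rker a b)"
  proof (rule integrable_unif_bounded[OF measurable_Rker(2)])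
    show "AE b in unif pi. \<bar>Rker a b\<bar> \<le> 2 / a\<^sup>2 + 152"
      using AE_unif_good[of pi]
    proof eventually_elim
      case (elim b)
      then show ?case using Rker_Rlim(1)[of a b] Rlim_le(1)[OF assms(1), of b] Rker_nonneg[of a b] assms by auto
    qed
  qed
  have "Kker a - (\<integral>b. Rlim a b \<partial>unif pi) = (\<integral>b. Rker a b - Rlim a b \<partial>unif pi)"
    unfolding Kker_def by (rule Bochner_Integration.integral_diff[symmetric, OF i integrable_Rlim_b[OF assms(1)]])
  moreover have "\<bar>\<integral>b. Rker a b - Rlim a b \<partial>unif pi\<bar> \<le> 152"
  proof (rule abs_integral_unif_le)
    show "(\<lambda>b. Rker a b - Rlim a b) \<in> borel_measurable borel"
      by (intro borel_measurable_diff measurable_Rker measurable_Rlim)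
    show "AE b in unif pi. \<bar>Rker a b - Rlim a b\<bar> \<le> 152"
      using AE_unif_good[of pi] by eventually_elim (rule Rker_Rlim, use assms in auto)
  qed simp
  ultimately show ?thesis by simp
qed

text \<open>For small b the arctangent tends to pi/2, which produces the main term; its complement
  and the rational term together contribute at most 1 on top of the 152 of
  \<open>Jker_Rlim\<close>.\<close>

lemma Jker_asymp:
  assumes "b \<noteq> 0" "\<bar>b\<bar> \<le> pi"
  shows "\<bar>Jker b - 2 / (sqrt 3 * \<bar>b\<bar>)\<bar> \<le> 153"
proof -
  define \<beta> where "\<beta> = \<bar>b\<bar>"
  have \<beta>: "\<beta> > 0" using assms by (simp add: \<beta>_def)
  have "Rlim a b = Rlim a \<beta>" for a by (simp add: Rlim_def \<beta>_def)
  then have I: "(\<integral>a. Rlim a b \<partial>unif (pi/2)) =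
      (4 / (sqrt 3 * \<beta>) * arctan (sqrt 3 * (pi/2) / \<beta>) + 2 * pi / (\<beta>\<^sup>2 + 3 * (pi/2)\<^sup>2)) / pi"
    using integral_Rlim_a[of \<beta>] \<beta> by simp
  have "sqrt 3 * (pi/2) / \<beta> > 0" using \<beta> by simp
  from arctan_complement[OF this] obtain \<delta> where \<delta>: "arctan (sqrt 3 * (pi/2) / \<beta>) = pi / 2 - \<delta>" "0 \<le> \<delta>"
    "\<delta> \<le> 1 / (sqrt 3 * (pi/2) / \<beta>)" by blast
  have main: "4 / (sqrt 3 * \<beta>) * (pi / 2) / pi = 2 / (sqrt 3 * \<beta>)" by simp
  have e1: "0 \<le> 4 / (sqrt 3 * \<beta>) * \<delta>" using \<beta> \<delta> by simp
  have "4 / (sqrt 3 * \<beta>) * \<delta> \<le> 4 / (sqrt 3 * \<beta>) * (1 / (sqrt 3 * (pi/2) / \<beta>))"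
    using \<beta> \<delta> by (intro mult_left_mono) auto
  also have "\<dots> = 8 / (3 * pi)" using \<beta> by (simp add: field_simps)
  finally have e2: "4 / (sqrt 3 * \<beta>) * \<delta> \<le> 8 / (3 * pi)" .
  have e3: "0 \<le> 2 * pi / (\<beta>\<^sup>2 + 3 * (pi/2)\<^sup>2)" by (intro divide_nonneg_nonneg add_nonneg_nonneg) auto
  have "2 * pi / (\<beta>\<^sup>2 + 3 * (pi/2)\<^sup>2) \<le> 2 * pi / (3 * (pi/2)\<^sup>2)"
    by (intro divide_left_mono mult_pos_pos add_nonneg_pos) auto
  also have "\<dots> = 8 / (3 * pi)" by (simp add: power2_eq_square)
  finally have e4: "2 * pi / (\<beta>\<^sup>2 + 3 * (pi/2)\<^sup>2) \<le> 8 / (3 * pi)" .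
  have p: "8 / (3 * pi) \<le> pi" using pi_gt3 mult_mono[of 3 pi 3 pi] by (simp add: field_simps)
  have "(\<integral>a. Rlim a b \<partial>unif (pi/2)) - 2 / (sqrt 3 * \<beta>) =
      (2 * pi / (\<beta>\<^sup>2 + 3 * (pi/2)\<^sup>2) - 4 / (sqrt 3 * \<beta>) * \<delta>) / pi"
    unfolding I \<delta>(1) main[symmetric] by (simp only: right_diff_distrib diff_divide_distrib add_divide_distrib)
  moreover have "\<bar>2 * pi / (\<beta>\<^sup>2 + 3 * (pi/2)\<^sup>2) - 4 / (sqrt 3 * \<beta>) * \<delta>\<bar> \<le> pi"
    using e1 e2 e3 e4 p by linarith
  ultimately have "\<bar>(\<integral>a. Rlim a b \<partial>unif (pi/2)) - 2 / (sqrt 3 * \<beta>)\<bar> \<le> 1"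
    by (simp only: abs_divide abs_of_pos[OF pi_gt_zero]) (simp add: divide_le_eq)
  then show ?thesis using Jker_Rlim[OF assms] unfolding \<beta>_def by linarith
qed

text \<open>Over the whole line the leading part integrates to
  \<open>2 pi / (sqrt 3 * \<bar>a\<bar>)\<close>, the same as in the other variable. The constant is
  half that of \<open>Jker_asymp\<close> because the average runs over length 2 pi instead of
  pi.\<close>

lemma Kker_asymp:
  assumes "a \<noteq> 0" "\<bar>a\<bar> \<le> pi / 2"
  shows "\<bar>Kker a - 1 / (sqrt 3 * \<bar>a\<bar>)\<bar> \<le> 153"
proof -
  define \<alpha> where "\<alpha> = \<bar>a\<bar>"
  have \<alpha>: "\<alpha> > 0" using assms by (simp add: \<alpha>_def)
  have "Rlim a b = Rlim \<alpha> b" for b by (simp add: Rlim_def \<alpha>_def)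
  then have I: "(\<integral>b. Rlim a b \<partial>unif pi) =
      (4 / (sqrt 3 * \<alpha>) * arctan (pi / (sqrt 3 * \<alpha>)) - 4 * pi / (pi\<^sup>2 + 3 * \<alpha>\<^sup>2)) / (2 * pi)"
    using integral_Rlim_b[of \<alpha>] \<alpha> by simp
  have "pi / (sqrt 3 * \<alpha>) > 0" using \<alpha> by simp
  from arctan_complement[OF this] obtain \<delta> where \<delta>: "arctan (pi / (sqrt 3 * \<alpha>)) = pi / 2 - \<delta>" "0 \<le> \<delta>"
    "\<delta> \<le> 1 / (pi / (sqrt 3 * \<alpha>))" by blast
  have main: "4 / (sqrt 3 * \<alpha>) * (pi / 2) / (2 * pi) = 1 / (sqrt 3 * \<alpha>)" by simp
  have e1: "0 \<le> 4 / (sqrt 3 * \<alpha>) * \<delta>" using \<alpha> \<delta> by simp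
  have "4 / (sqrt 3 * \<alpha>) * \<delta> \<le> 4 / (sqrt 3 * \<alpha>) * (1 / (pi / (sqrt 3 * \<alpha>)))"
    using \<alpha> \<delta> by (intro mult_left_mono) auto
  also have "\<dots> = 4 / pi" using \<alpha> by (simp add: field_simps)
  finally have e2: "4 / (sqrt 3 * \<alpha>) * \<delta> \<le> 4 / pi" .
  have e3: "0 \<le> 4 * pi / (pi\<^sup>2 + 3 * \<alpha>\<^sup>2)" by (intro divide_nonneg_nonneg add_nonneg_nonneg) auto
  have "4 * pi / (pi\<^sup>2 + 3 * \<alpha>\<^sup>2) \<le> 4 * pi / pi\<^sup>2" by (intro divide_left_mono) (auto intro!: mult_pos_pos add_pos_nonneg)
  also have "\<dots> = 4 / pi" by (simp add: power2_eq_square)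
  finally have e4: "4 * pi / (pi\<^sup>2 + 3 * \<alpha>\<^sup>2) \<le> 4 / pi" .
  have p: "4 / pi \<le> pi" using pi_gt3 mult_mono[of 3 pi 3 pi] by (simp add: field_simps)
  have "(\<integral>b. Rlim a b \<partial>unif pi) - 1 / (sqrt 3 * \<alpha>) =
      - (4 * pi / (pi\<^sup>2 + 3 * \<alpha>\<^sup>2) + 4 / (sqrt 3 * \<alpha>) * \<delta>) / (2 * pi)"
    unfolding I \<delta>(1) main[symmetric]
    by (simp only: right_diff_distrib diff_divide_distrib add_divide_distrib minus_divide_left[symmetric])
  moreover have "\<bar>- (4 * pi / (pi\<^sup>2 + 3 * \<alpha>\<^sup>2) + 4 / (sqrt 3 * \<alpha>) * \<delta>)\<bar> \<le> 2 * pi"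
  proof -
    have "\<bar>- (s + t)\<bar> \<le> 2 * pi" if "0 \<le> s" "s \<le> 4 / pi" "0 \<le> t" "t \<le> 4 / pi" for s t
      using that p by simp
    then show ?thesis using e1 e2 e3 e4 by blast
  qed
  moreover have "\<bar>2 * pi\<bar> = 2 * pi" by simp
  ultimately have "\<bar>(\<integral>b. Rlim a b \<partial>unif pi) - 1 / (sqrt 3 * \<alpha>)\<bar> \<le> 1"
    by (simp only: abs_divide) (simp add: divide_le_eq)
  then show ?thesis using Kker_Rlim[OF assms] unfolding \<alpha>_def by linarith
qed

section \<open>The dislocation dipole\<close>

text \<open>Subtracting from \<open>sin\<^sup>2 x / x\<close> the derivative of an explicit primitive of its average and of its
  leading oscillation leaves an integrable remainder.\<close>

definition sinc_prim :: "real \<Rightarrow> real" where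
  "sinc_prim x = ln (1 + x\<^sup>2) / 4 - x * sin (2 * x) / (4 * (1 + x\<^sup>2))"

definition sinc_main :: "real \<Rightarrow> real" where
  "sinc_main x = x * (sin x)\<^sup>2 / (1 + x\<^sup>2) - sin (2 * x) * (1 - x\<^sup>2) / (4 * (1 + x\<^sup>2)\<^sup>2)"

lemma one_plus_sq_pos: "1 + x\<^sup>2 > (0::real)"
  by (intro add_pos_nonneg) auto

lemma sinc_prim_deriv: "(sinc_prim has_real_derivative sinc_main x) (at x)"
proof -
  have p: "1 + x\<^sup>2 \<noteq> 0" using one_plus_sq_pos[of x] by simp
  have L: "((\<lambda>x. ln (1 + x\<^sup>2)) has_real_derivative 2 * x / (1 + x\<^sup>2)) (at x)"
    using one_plus_sq_pos[of x] by (auto intro!: derivative_eq_intros)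
  have N: "((\<lambda>x. x * sin (2 * x)) has_real_derivative sin (2 * x) + x * (cos (2 * x) * 2)) (at x)"
    by (auto intro!: derivative_eq_intros)
  have Q: "((\<lambda>x. 4 * (1 + x\<^sup>2)) has_real_derivative 4 * (2 * x)) (at x)"
    by (auto intro!: derivative_eq_intros)
  have p4: "4 * (1 + x\<^sup>2) \<noteq> 0" using p by simp
  have "(sinc_prim has_real_derivative 2 * x / (1 + x\<^sup>2) / 4 -
     ((sin (2 * x) + x * (cos (2 * x) * 2)) * (4 * (1 + x\<^sup>2)) - x * sin (2 * x) * (4 * (2 * x))) / ((4 * (1 + x\<^sup>2)) * (4 * (1 + x\<^sup>2)))) (at x)"
    using DERIV_diff[OF DERIV_cdivide[OF L, of 4] DERIV_divide[OF N Q p4]] unfolding sinc_prim_def[abs_def] .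
  moreover have "2 * x / q / 4 - ((s + x * (c * 2)) * (4 * q) - x * s * (4 * (2 * x))) / ((4 * q) * (4 * q)) =
      x * ((1 - c) / 2) / q - s * (q - 2 * x\<^sup>2) / (4 * q\<^sup>2)" if "q \<noteq> 0" for q s c :: real
    using that by (simp add: field_simps power2_eq_square)
  note this[OF p, of "sin (2 * x)" "cos (2 * x)"]
  moreover have "(1 - cos (2 * x)) / 2 = (sin x)\<^sup>2" by (simp add: cos_double_sin)
  moreover have "1 + x\<^sup>2 - 2 * x\<^sup>2 = 1 - x\<^sup>2" by simp
  ultimately show ?thesis unfolding sinc_main_def by metis
qed

text \<open>Replacing \<open>1 / x\<close> by \<open>x / (1 + x\<^sup>2)\<close>, which is regular
  at 0, costs at most \<open>1 / (1 + x\<^sup>2)\<close>; differentiating the amplitude of the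
  oscillating term costs at most a quarter of that.\<close>

lemma sinc_main_error:
  assumes "x > 0"
  shows "\<bar>(sin x)\<^sup>2 / x - sinc_main x\<bar> \<le> 5/4 / (1 + x\<^sup>2)"
proof -
  let ?q = "1 + x\<^sup>2"
  have q: "?q > 0" by (rule one_plus_sq_pos)
  have 1: "(sin x)\<^sup>2 / x - sinc_main x = (sin x)\<^sup>2 / x * (1 / ?q) + sin (2 * x) * (1 - x\<^sup>2) / ?q * (1 / (4 * ?q))"
  proof -
    have "u / x - x * u / ?q = u / x * (1 / ?q)" for u
    proof -
      have "u / x - x * u / ?q = (u * ?q - x * u * x) / (x * ?q)" using assms q by (intro diff_frac_eq) auto
      also have "u * ?q - x * u * x = u" by (simp add: power2_eq_square algebra_simps)
      finally show ?thesis by simp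
    qed
    note A = this[of "(sin x)\<^sup>2"]
    have B: "sin (2 * x) * (1 - x\<^sup>2) / (4 * ?q\<^sup>2) = sin (2 * x) * (1 - x\<^sup>2) / ?q * (1 / (4 * ?q))"
      by (simp only: power2_eq_square[of ?q] times_divide_times_eq mult_1_right mult.left_commute)
    show ?thesis unfolding sinc_main_def A[symmetric] B[symmetric] by (rule diff_diff_eq2[THEN trans]) simp
  qed
  have "\<bar>sin x\<bar> * \<bar>sin x\<bar> \<le> 1 * x" using abs_sin_x_le_abs_x[of x] assms by (intro mult_mono) auto
  then have "(sin x)\<^sup>2 / x \<le> 1" using assms by (simp add: divide_le_eq power2_eq_square)
  then have 2: "\<bar>(sin x)\<^sup>2 / x * (1 / ?q)\<bar> \<le> 1 * (1 / ?q)"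
    unfolding abs_mult using q assms by (intro mult_mono) auto
  have "\<bar>sin (2 * x)\<bar> * \<bar>1 - x\<^sup>2\<bar> \<le> 1 * ?q" by (intro mult_mono) (auto simp: abs_le_iff)
  then have "\<bar>sin (2 * x) * (1 - x\<^sup>2) / ?q\<bar> \<le> 1"
    using q by (simp add: abs_mult abs_divide divide_le_eq)
  then have 3: "\<bar>sin (2 * x) * (1 - x\<^sup>2) / ?q * (1 / (4 * ?q))\<bar> \<le> 1 * (1 / (4 * ?q))"
    unfolding abs_mult using q by (intro mult_mono) auto
  have 4: "1 * (1 / (4 * ?q)) = (1 / ?q) / 4" "5/4 / ?q = 5/4 * (1 / ?q)" by simp_all
  have "\<bar>u + v\<bar> \<le> 5/4 * w" if "\<bar>u\<bar> \<le> 1 * w" "\<bar>v\<bar> \<le> w / 4" for u v w :: real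
    using that by linarith
  from this[OF 2 3[unfolded 4(1)]] show ?thesis unfolding 1 4(2) .
qed

lemma integral_unif_even:
  fixes f :: "real \<Rightarrow> real"
  assumes r: "r > 0" and f [measurable]: "f \<in> borel_measurable borel" and even: "\<And>x. f (- x) = f x"
    and int: "integrable lborel (\<lambda>x. indicator {0..r} x * f x)"
  shows "integral\<^sup>L (unif r) f = (1 / r) * (\<integral>x. indicator {0..r} x * f x \<partial>lborel)"
proof -
  let ?g = "\<lambda>x. indicator {0..r} x * f x"
  have int': "integrable lborel (\<lambda>x. ?g (- x))"
    using lborel_integrable_real_affine[OF int, of "-1" 0] by simp
  have eq': "(\<integral>x. ?g (- x) \<partial>lborel) = (\<integral>x. ?g x \<partial>lborel)"
    using lborel_integral_real_affine[of "-1" ?g 0] by simp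
  have "(\<integral>x. indicator {-r..r} x *\<^sub>R f x \<partial>lborel) = (\<integral>x. ?g x + ?g (- x) \<partial>lborel)"
  proof (rule integral_cong_AE)
    show "AE x in lborel. indicator {-r..r} x *\<^sub>R f x = ?g x + ?g (- x)"
      using AE_lborel_singleton[of 0]
    proof eventually_elim
      case (elim x)
      then show ?case using even[of x] r by (auto simp: indicator_def)
    qed
  qed auto
  also have "\<dots> = 2 * (\<integral>x. ?g x \<partial>lborel)"
    using eq' by (simp only: Bochner_Integration.integral_add[OF int int'])
  finally show ?thesis using r by (subst integral_unif) auto
qed

text \<open>Rescaling by n turns the half-line integral into the increment of
  \<open>sinc_prim\<close> up to \<open>n * pi / 2\<close>, about \<open>ln n / 2\<close>, with an
  error below the integral of \<open>5/4 / (1 + x\<^sup>2)\<close>. Averaging over the symmetric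
  interval multiplies by 2 / pi.\<close>

lemma sin_sq_integral:
  assumes n: "n \<ge> 1"
  shows "\<bar>(\<integral>a. (sin (real n * a))\<^sup>2 / \<bar>a\<bar> \<partial>unif (pi/2)) - ln (real n) / pi\<bar> \<le> 4"
proof -
  let ?r = "pi/2" and ?n = "real n"
  have n0: "?n > 0" using n by simp
  define A B C where "A a = indicator {0..?r} a * ((sin (?n * a))\<^sup>2 / \<bar>a\<bar>)"
    and "B a = indicator {0..?r} a * (?n * sinc_main (?n * a))"
    and "C a = indicator {0..?r} a * (5/4 * (?n / (1 + (?n * a)\<^sup>2)))" for a
  have cm: "continuous_on UNIV sinc_main"
    unfolding sinc_main_def using one_plus_sq_pos by (intro continuous_intros) (auto simp: less_imp_neq[symmetric])
  have cB: "continuous_on S (\<lambda>a. ?n * sinc_main (?n * a))" for S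
    by (intro continuous_intros continuous_on_compose2[OF cm]) auto
  have cC: "continuous_on S (\<lambda>a. 5/4 * (?n / (1 + (?n * a)\<^sup>2)))" for S
    using one_plus_sq_pos by (intro continuous_intros) (auto simp: less_imp_neq[symmetric])
  have dB: "((\<lambda>a. sinc_prim (?n * a)) has_vector_derivative ?n * sinc_main (?n * a)) (at a within S)" for a S
  proof -
    have "((\<lambda>a. ?n * a) has_real_derivative ?n) (at a)" by (auto intro!: derivative_eq_intros)
    from DERIV_chain2[OF sinc_prim_deriv this] show ?thesis
      by (simp add: has_real_derivative_iff_has_vector_derivative[symmetric] has_field_derivative_at_within mult.commute)
  qed
  have dC: "((\<lambda>a. 5/4 * arctan (?n * a)) has_vector_derivative 5/4 * (?n / (1 + (?n * a)\<^sup>2))) (at a within S)" for a S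
  proof -
    have "((\<lambda>a. 5/4 * arctan (?n * a)) has_real_derivative 5/4 * (?n / (1 + (?n * a)\<^sup>2))) (at a)"
      by (intro DERIV_cmult) (auto intro!: derivative_eq_intros simp: inverse_eq_divide)
    then show ?thesis
      by (simp add: has_real_derivative_iff_has_vector_derivative[symmetric] has_field_derivative_at_within)
  qed
  have hB: "has_bochner_integral lborel B (sinc_prim (?n * ?r) - sinc_prim (?n * 0))"
    using has_bochner_integral_FTC_Icc[OF _ dB cB, of 0 ?r] by (simp add: B_def[abs_def])
  have hC: "has_bochner_integral lborel C (5/4 * arctan (?n * ?r) - 5/4 * arctan (?n * 0))"
    using has_bochner_integral_FTC_Icc[OF _ dC cC, of 0 ?r] by (simp add: C_def[abs_def])
  have AB: "\<bar>A a - B a\<bar> \<le> C a" for a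
  proof (cases "a \<in> {0..?r} \<and> a \<noteq> 0")
    case True
    then have a: "a > 0" by auto
    then have x: "?n * a > 0" using n0 by simp
    have "A a - B a = ?n * ((sin (?n * a))\<^sup>2 / (?n * a) - sinc_main (?n * a))"
      using True a n0 by (simp add: A_def B_def field_simps)
    then have "\<bar>A a - B a\<bar> = ?n * \<bar>(sin (?n * a))\<^sup>2 / (?n * a) - sinc_main (?n * a)\<bar>"
      using n0 by (simp add: abs_mult)
    also have "\<dots> \<le> ?n * (5/4 / (1 + (?n * a)\<^sup>2))"
      using n0 by (intro mult_left_mono sinc_main_error x) auto
    also have "\<dots> = C a" using True by (simp add: C_def)
    finally show ?thesis .
  next
    \<comment> \<open>At a = 0 both integrands are 0, the quotient in \<open>A\<close> by division
      by zero.\<close>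
    case False
    have "0 \<le> ?n / (1 + (?n * a)\<^sup>2)" using one_plus_sq_pos[of "?n * a"] n0 by (intro divide_nonneg_nonneg) auto
    then show ?thesis using False by (auto simp: A_def B_def C_def sinc_main_def indicator_def)
  qed
  have mA [measurable]: "A \<in> borel_measurable borel" unfolding A_def by measurable
  have iB: "integrable lborel B" "integrable lborel C" using hB hC by (auto simp: has_bochner_integral_iff)
  have iA: "integrable lborel A"
  proof (rule Bochner_Integration.integrable_bound)
    show "integrable lborel (\<lambda>a. \<bar>B a\<bar> + C a)" using iB by auto
    show "AE a in lborel. norm (A a) \<le> norm (\<bar>B a\<bar> + C a)"
      using AB by (intro AE_I2) (smt (verit) real_norm_def)
  qed simp
  have "\<bar>integral\<^sup>L lborel A - integral\<^sup>L lborel B\<bar> = \<bar>\<integral>a. A a - B a \<partial>lborel\<bar>"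
    using iA iB by simp
  also have "\<dots> \<le> (\<integral>a. \<bar>A a - B a\<bar> \<partial>lborel)" using integral_norm_bound[of lborel "\<lambda>a. A a - B a"] by simp
  also have "\<dots> \<le> integral\<^sup>L lborel C" using iA iB AB by (intro integral_mono) auto
  finally have AB': "\<bar>integral\<^sup>L lborel A - integral\<^sup>L lborel B\<bar> \<le> integral\<^sup>L lborel C" .
  have C2: "integral\<^sup>L lborel C \<le> 2"
    using hC arctan_bounded[of "?n * ?r"] pi_less_4 pi_approx by (auto simp: has_bochner_integral_iff)
  define y where "y = ?n * ?r"
  \<comment> \<open>The upper limit satisfies \<open>2 * y = n * pi\<close>, so the oscillating
    boundary term of the primitive vanishes.\<close>
  have s0: "sin (2 * y) = 0" using sin_npi[of n] by (simp add: y_def mult.commute)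
  have Bv: "integral\<^sup>L lborel B = ln (1 + y\<^sup>2) / 4"
    using hB s0 by (simp add: has_bochner_integral_iff sinc_prim_def y_def)
  have y1: "y \<ge> 1" using n pi_gt3 mult_mono[of 1 ?n 1 ?r] by (simp add: y_def)
  have ly: "ln (y\<^sup>2) = 2 * ln y" "ln (2 * y\<^sup>2) = ln 2 + 2 * ln y" using y1 by (simp_all add: ln_mult ln_realpow)
  have l1: "ln (y\<^sup>2) \<le> ln (1 + y\<^sup>2)" using y1 by (subst ln_le_cancel_iff) (auto intro: add_pos_nonneg)
  have "1 \<le> y\<^sup>2" using y1 by simp
  then have l2: "ln (1 + y\<^sup>2) \<le> ln (2 * y\<^sup>2)" using y1 by (subst ln_le_cancel_iff) (auto intro: add_pos_nonneg)
  have lr: "ln ?r \<ge> 0" "ln ?r \<le> 1" using pi_gt3 pi_less_4 ln_le_minus_one[of ?r] by auto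
  have ln2: "ln (2::real) \<le> 1" using ln_le_minus_one[of "2::real"] by simp
  have "ln y = ln ?n + ln ?r" unfolding y_def by (rule ln_mult_pos) (use n0 in auto)
  then have "\<bar>integral\<^sup>L lborel B - ln ?n / 2\<bar> \<le> 1" using l1 l2 ly lr ln2 unfolding Bv by linarith
  then have A3: "\<bar>integral\<^sup>L lborel A - ln ?n / 2\<bar> \<le> 3" using AB' C2 by linarith
  have "(\<integral>a. (sin (?n * a))\<^sup>2 / \<bar>a\<bar> \<partial>unif ?r) = (1 / ?r) * integral\<^sup>L lborel A"
    unfolding A_def by (rule integral_unif_even) (use iA in \<open>auto simp: A_def[abs_def]\<close>)
  then have "(\<integral>a. (sin (?n * a))\<^sup>2 / \<bar>a\<bar> \<partial>unif ?r) - ln ?n / pi = (2 / pi) * (integral\<^sup>L lborel A - ln ?n / 2)"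
    by (simp add: field_simps)
  then have "\<bar>(\<integral>a. (sin (?n * a))\<^sup>2 / \<bar>a\<bar> \<partial>unif ?r) - ln ?n / pi\<bar> = \<bar>2 / pi\<bar> * \<bar>integral\<^sup>L lborel A - ln ?n / 2\<bar>"
    by (simp only: abs_mult)
  also have "\<bar>2 / pi\<bar> = 2 / pi" by simp
  also have "2 / pi * \<bar>integral\<^sup>L lborel A - ln ?n / 2\<bar> \<le> (2 / 3) * 3" using A3 pi_gt3 by (intro mult_mono divide_left_mono) auto
  finally show ?thesis by simp
qed

text \<open>The pointwise error 153 of the kernel and the error 4 of the logarithmic integral are
  halved by the prefactor of the energy, hence 80.\<close>

lemma dipole_asymp:
  assumes n: "n \<ge> 1"
  shows "\<bar>thermo_energy (charge n {0}) - ln (real n) / (2 * pi * sqrt 3)\<bar> \<le> 80"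
proof -
  let ?r = "pi/2" and ?n = "real n"
  define I where "I = (\<integral>a. (sin (?n * a))\<^sup>2 / \<bar>a\<bar> \<partial>unif ?r)"
  have mK: "(\<lambda>a. (sin (?n * a))\<^sup>2 / (sqrt 3 * \<bar>a\<bar>)) \<in> borel_measurable borel" by measurable
  have iK: "integrable (unif ?r) (\<lambda>a. (sin (?n * a))\<^sup>2 / (sqrt 3 * \<bar>a\<bar>))"
  proof (rule integrable_unif_bounded[OF mK])
    show "AE a in unif ?r. \<bar>(sin (?n * a))\<^sup>2 / (sqrt 3 * \<bar>a\<bar>)\<bar> \<le> ?n"
      using AE_unif_good[of ?r]
    proof eventually_elim
      case (elim a)
      have "\<bar>sin (?n * a)\<bar> * \<bar>sin (?n * a)\<bar> \<le> 1 * (?n * \<bar>a\<bar>)"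
        using abs_sin_x_le_abs_x[of "?n * a"] by (intro mult_mono) (auto simp: abs_mult)
      also have "\<dots> \<le> ?n * (sqrt 3 * \<bar>a\<bar>)"
        by (simp add: mult_left_mono mult_le_cancel_right1)
      finally show ?case using elim by (simp add: abs_mult divide_le_eq power2_eq_square)
    qed
  qed
  have "(\<integral>a. (sin (?n * a))\<^sup>2 * Kker a \<partial>unif ?r) - (\<integral>a. (sin (?n * a))\<^sup>2 / (sqrt 3 * \<bar>a\<bar>) \<partial>unif ?r) =
      (\<integral>a. (sin (?n * a))\<^sup>2 * Kker a - (sin (?n * a))\<^sup>2 / (sqrt 3 * \<bar>a\<bar>) \<partial>unif ?r)" (is "?d = _")
    by (rule Bochner_Integration.integral_diff[symmetric, OF integrable_Kker iK])
  moreover have "\<bar>\<integral>a. (sin (?n * a))\<^sup>2 * Kker a - (sin (?n * a))\<^sup>2 / (sqrt 3 * \<bar>a\<bar>) \<partial>unif ?r\<bar> \<le> (\<integral>a. 153 \<partial>unif ?r)"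
  proof (rule order_trans)
    show "\<bar>\<integral>a. (sin (?n * a))\<^sup>2 * Kker a - (sin (?n * a))\<^sup>2 / (sqrt 3 * \<bar>a\<bar>) \<partial>unif ?r\<bar> \<le>
       (\<integral>a. \<bar>(sin (?n * a))\<^sup>2 * Kker a - (sin (?n * a))\<^sup>2 / (sqrt 3 * \<bar>a\<bar>)\<bar> \<partial>unif ?r)"
      using integral_norm_bound[of "unif ?r" "\<lambda>a. (sin (?n * a))\<^sup>2 * Kker a - (sin (?n * a))\<^sup>2 / (sqrt 3 * \<bar>a\<bar>)"]
      unfolding real_norm_def .
    show "(\<integral>a. \<bar>(sin (?n * a))\<^sup>2 * Kker a - (sin (?n * a))\<^sup>2 / (sqrt 3 * \<bar>a\<bar>)\<bar> \<partial>unif ?r) \<le> (\<integral>a. 153 \<partial>unif ?r)"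
    proof (rule integral_mono_AE)
      show "integrable (unif ?r) (\<lambda>a. \<bar>(sin (?n * a))\<^sup>2 * Kker a - (sin (?n * a))\<^sup>2 / (sqrt 3 * \<bar>a\<bar>)\<bar>)"
        using integrable_Kker[of n] iK by (intro integrable_abs Bochner_Integration.integrable_diff) auto
      show "AE a in unif ?r. \<bar>(sin (?n * a))\<^sup>2 * Kker a - (sin (?n * a))\<^sup>2 / (sqrt 3 * \<bar>a\<bar>)\<bar> \<le> 153"
        using AE_unif_good[of ?r]
      proof eventually_elim
        case (elim a)
        have "(sin (?n * a))\<^sup>2 * Kker a - (sin (?n * a))\<^sup>2 / (sqrt 3 * \<bar>a\<bar>) = (sin (?n * a))\<^sup>2 * (Kker a - 1 / (sqrt 3 * \<bar>a\<bar>))"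
          by (simp add: right_diff_distrib)
        then have "\<bar>(sin (?n * a))\<^sup>2 * Kker a - (sin (?n * a))\<^sup>2 / (sqrt 3 * \<bar>a\<bar>)\<bar> = (sin (?n * a))\<^sup>2 * \<bar>Kker a - 1 / (sqrt 3 * \<bar>a\<bar>)\<bar>"
          by (simp add: abs_mult)
        also have "\<dots> \<le> 1 * 153" using elim by (intro mult_mono Kker_asymp) (auto simp: abs_square_le_1)
        finally show ?case by simp
      qed
    qed simp
  qed
  ultimately have d: "\<bar>?d\<bar> \<le> 153" by simp
  have e: "(\<integral>a. (sin (?n * a))\<^sup>2 / (sqrt 3 * \<bar>a\<bar>) \<partial>unif ?r) = I / sqrt 3"
  proof -
    have "(\<integral>a. (sin (?n * a))\<^sup>2 / (sqrt 3 * \<bar>a\<bar>) \<partial>unif ?r) = (\<integral>a. 1 / sqrt 3 * ((sin (?n * a))\<^sup>2 / \<bar>a\<bar>) \<partial>unif ?r)"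
      by (intro Bochner_Integration.integral_cong) auto
    also have "\<dots> = 1 / sqrt 3 * I" unfolding I_def by (rule integral_mult_right_zero)
    finally show ?thesis by simp
  qed
  have s: "sqrt 3 \<ge> 1" by simp
  have "\<bar>I / sqrt 3 - ln ?n / pi / sqrt 3\<bar> = \<bar>I - ln ?n / pi\<bar> / sqrt 3"
    unfolding diff_divide_distrib[symmetric] abs_divide by simp
  also have "\<dots> \<le> 4 / 1" using sin_sq_integral[OF n] s unfolding I_def by (intro frac_le) auto
  finally have "\<bar>I / sqrt 3 - ln ?n / pi / sqrt 3\<bar> \<le> 4" by simp
  moreover have "ln ?n / (2 * pi * sqrt 3) = (ln ?n / pi / sqrt 3) / 2" by simp
  moreover have "thermo_energy (charge n {0}) = (\<integral>a. (sin (?n * a))\<^sup>2 * Kker a \<partial>unif ?r) / 2"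
    using thermo_charge_Kker[of n] by simp
  moreover have "\<bar>x / 2 - l / 2\<bar> \<le> 80" if "\<bar>i - l\<bar> \<le> 4" "\<bar>x - i\<bar> \<le> 153" for x i l :: real
    using that by linarith
  note this[OF _ d[unfolded e]]
  ultimately show ?thesis by metis
qed

section \<open>Riemann--Lebesgue and Fejer limits\<close>

lemma integral_unif_cos_phase:
  assumes r: "r > 0" and t: "t \<noteq> 0"
  shows "(\<integral>x. cos (t * x + \<phi>) \<partial>unif r) = cos \<phi> * sin (t * r) / (t * r)"
proof -
  have "(\<integral>x. cos (t * x + \<phi>) \<partial>unif r) = (1 / (2 * r)) *\<^sub>R (sin (t * r + \<phi>) / t - sin (t * (- r) + \<phi>) / t)"
  proof (rule integral_unif_FTC[OF r])
    fix x
    have "((\<lambda>x. sin (t * x + \<phi>) / t) has_real_derivative cos (t * x + \<phi>)) (at x)"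
      using t by (auto intro!: derivative_eq_intros)
    then show "((\<lambda>x. sin (t * x + \<phi>) / t) has_vector_derivative cos (t * x + \<phi>)) (at x within {-r..r})"
      by (simp add: has_real_derivative_iff_has_vector_derivative[symmetric] has_field_derivative_at_within)
  qed (auto intro!: continuous_intros)
  also have "\<dots> = cos \<phi> * sin (t * r) / (t * r)"
  proof -
    have "sin (t * r + \<phi>) - sin (t * (- r) + \<phi>) = 2 * cos \<phi> * sin (t * r)"
      using sin_add[of "t * r" \<phi>] sin_add[of "t * (- r)" \<phi>] by simp
    then have "sin (t * r + \<phi>) / t - sin (t * (- r) + \<phi>) / t = 2 * cos \<phi> * sin (t * r) / t"
      by (simp only: diff_divide_distrib[symmetric])
    then show ?thesis by simp
  qed
  finally show ?thesis .
qed

lemma integrable_unif_continuous: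
  fixes f :: "real \<Rightarrow> real"
  assumes "continuous_on UNIV f"
  shows "integrable (unif r) f"
proof -
  have "bounded (f ` {-r..r})"
    using assms by (intro compact_imp_bounded compact_continuous_image compact_Icc) (auto intro: continuous_on_subset)
  then obtain B where "\<forall>y\<in>f ` {-r..r}. norm y \<le> B" unfolding bounded_iff by blast
  then have B: "\<And>x. x \<in> {-r..r} \<Longrightarrow> \<bar>f x\<bar> \<le> B" by simp
  show ?thesis
  proof (rule integrable_unif_bounded)
    show "f \<in> borel_measurable borel" by (rule borel_measurable_continuous_onI[OF assms])
    show "AE x in unif r. \<bar>f x\<bar> \<le> B"
      using AE_unif_bounds[of r] by eventually_elim (rule B, auto)
  qed
qed

text \<open>By Bessel's inequality the coefficients are square summable.\<close>

lemma riemann_lebesgue_cos: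
  fixes f :: "real \<Rightarrow> real"
  assumes f [measurable]: "f \<in> borel_measurable borel" and B: "AE x in unif (pi/2). \<bar>f x\<bar> \<le> B"
  shows "(\<lambda>n. \<integral>a. f a * cos (2 * real n * a) \<partial>unif (pi/2)) \<longlonglongrightarrow> 0"
proof -
  let ?U = "unif (pi/2)"
  define c where "c n = (\<integral>a. f a * cos (2 * real n * a) \<partial>?U)" for n
  define e where "e n a = cos (2 * real n * a)" for n a
  have ci: "(\<integral>a. cos (2 * of_int j * a) \<partial>?U) = (if j = 0 then 1 else 0)" for j :: int
  proof (cases "j = 0")
    case False
    then have "sin (2 * of_int j * (pi/2)) = 0" by (auto simp: sin_zero_iff_int2)
    then show ?thesis using False integral_unif_cos_phase[of "pi/2" "2 * of_int j" 0] by simp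
  qed simp
  have ee: "(\<integral>a. e n a * e k a \<partial>?U) = (if n = k then 1/2 else 0)" if "n \<ge> 1" "k \<ge> 1" for n k
  proof -
    have "(\<integral>a. e n a * e k a \<partial>?U) = (\<integral>a. (cos (2 * of_int (int n - int k) * a) + cos (2 * of_int (int n + int k) * a)) / 2 \<partial>?U)"
    proof (intro Bochner_Integration.integral_cong refl)
      fix a
      have "2 * real n * a - 2 * real k * a = 2 * of_int (int n - int k) * a"
        "2 * real n * a + 2 * real k * a = 2 * of_int (int n + int k) * a"
        by (simp_all add: algebra_simps)
      then show "e n a * e k a = (cos (2 * of_int (int n - int k) * a) + cos (2 * of_int (int n + int k) * a)) / 2"
        unfolding e_def cos_times_cos by (simp only:)
    qed
    also have "\<dots> = ((\<integral>a. cos (2 * of_int (int n - int k) * a) \<partial>?U) + (\<integral>a. cos (2 * of_int (int n + int k) * a) \<partial>?U)) / 2"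
      by (subst integral_divide_zero, subst Bochner_Integration.integral_add)
         (auto intro!: integrable_unif_continuous continuous_intros)
    also have "\<dots> = (if n = k then 1/2 else 0)" using that unfolding ci by auto
    finally show ?thesis .
  qed
  have me [measurable]: "e n \<in> borel_measurable borel" for n unfolding e_def[abs_def] by measurable
  have ie: "integrable ?U (\<lambda>a. e n a * e k a)" for n k
    unfolding e_def by (intro integrable_unif_continuous continuous_intros)
  have ife: "integrable ?U (\<lambda>a. f a * e n a)" for n
  proof (rule integrable_unif_bounded)
    show "AE x in ?U. \<bar>f x * e n x\<bar> \<le> B"
      using B
    proof eventually_elim
      case (elim x)
      have "\<bar>f x\<bar> * \<bar>e n x\<bar> \<le> B * 1" using elim by (intro mult_mono) (auto simp: e_def)
      then show ?case by (simp add: abs_mult)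
    qed
  qed measurable
  have iff: "integrable ?U (\<lambda>a. f a * f a)"
  proof (rule integrable_unif_bounded)
    show "AE x in ?U. \<bar>f x * f x\<bar> \<le> B * B"
      using B
    proof eventually_elim
      case (elim x)
      have "\<bar>f x\<bar> * \<bar>f x\<bar> \<le> B * B" using elim by (intro mult_mono) auto
      then show ?case by (simp only: abs_mult)
    qed
  qed measurable
  have bound: "(\<Sum>n\<in>{1..K}. (c n)\<^sup>2) \<le> (\<integral>a. f a * f a \<partial>?U) / 2" for K
  proof -
    let ?S = "\<lambda>a. \<Sum>n\<in>{1..K}. c n * e n a"
    have 1: "(\<integral>a. f a * ?S a \<partial>?U) = (\<Sum>n\<in>{1..K}. (c n)\<^sup>2)" and i1: "integrable ?U (\<lambda>a. f a * ?S a)"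
    proof -
      have eq: "(\<lambda>a. f a * ?S a) = (\<lambda>a. \<Sum>n\<in>{1..K}. c n * (f a * e n a))"
        by (simp add: sum_distrib_left mult_ac)
      show "integrable ?U (\<lambda>a. f a * ?S a)"
        unfolding eq by (intro Bochner_Integration.integrable_sum integrable_mult_right ife)
      show "(\<integral>a. f a * ?S a \<partial>?U) = (\<Sum>n\<in>{1..K}. (c n)\<^sup>2)"
        unfolding eq by (subst Bochner_Integration.integral_sum)
          (auto intro!: integrable_mult_right ife simp: c_def[folded e_def, symmetric] power2_eq_square)
    qed
    have 2: "(\<integral>a. ?S a * ?S a \<partial>?U) = (\<Sum>n\<in>{1..K}. (c n)\<^sup>2) / 2" and i2: "integrable ?U (\<lambda>a. ?S a * ?S a)"
    proof -
      have eq: "(\<lambda>a. ?S a * ?S a) = (\<lambda>a. \<Sum>n\<in>{1..K}. \<Sum>k\<in>{1..K}. c n * c k * (e n a * e k a))"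
        by (simp add: sum_product mult_ac)
      show "integrable ?U (\<lambda>a. ?S a * ?S a)"
        unfolding eq by (intro Bochner_Integration.integrable_sum integrable_mult_right ie)
      have "(\<integral>a. ?S a * ?S a \<partial>?U) = (\<Sum>n\<in>{1..K}. \<Sum>k\<in>{1..K}. c n * c k * (\<integral>a. e n a * e k a \<partial>?U))"
        unfolding eq
        by (simp add: Bochner_Integration.integral_sum Bochner_Integration.integrable_sum integrable_mult_right ie)
      also have "\<dots> = (\<Sum>n\<in>{1..K}. \<Sum>k\<in>{1..K}. if n = k then c n * c k / 2 else 0)"
        by (intro sum.cong refl) (auto simp: ee)
      also have "\<dots> = (\<Sum>n\<in>{1..K}. (c n)\<^sup>2 / 2)"
        by (intro sum.cong refl) (simp add: power2_eq_square)
      finally show "(\<integral>a. ?S a * ?S a \<partial>?U) = (\<Sum>n\<in>{1..K}. (c n)\<^sup>2) / 2" by (simp add: sum_divide_distrib)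
    qed
    \<comment> \<open>On this interval the cosines of positive frequency have squared norm 1/2, so
      the projection has coefficients \<open>2 * c n\<close>.\<close>
    have "0 \<le> (\<integral>a. (f a - 2 * ?S a)\<^sup>2 \<partial>?U)" by simp
    also have "\<dots> = (\<integral>a. f a * f a - 4 * (f a * ?S a) + 4 * (?S a * ?S a) \<partial>?U)"
      by (intro Bochner_Integration.integral_cong refl) (simp add: power2_eq_square algebra_simps)
    also have "\<dots> = (\<integral>a. f a * f a \<partial>?U) - 4 * (\<integral>a. f a * ?S a \<partial>?U) + 4 * (\<integral>a. ?S a * ?S a \<partial>?U)"
      by (subst Bochner_Integration.integral_add, intro Bochner_Integration.integrable_diff iff integrable_mult_right i1,
          intro integrable_mult_right i2, subst Bochner_Integration.integral_diff[OF iff integrable_mult_right[OF i1]]) simp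
    finally show ?thesis unfolding 1 2 by simp
  qed
  have "summable (\<lambda>n. (c (Suc n))\<^sup>2)"
  proof (rule summableI_nonneg_bounded)
    fix K
    have "(\<Sum>n<K. (c (Suc n))\<^sup>2) = (\<Sum>n\<in>{1..K}. (c n)\<^sup>2)"
      by (rule sum.reindex_bij_witness[of _ "\<lambda>n. n - 1" Suc]) auto
    then show "(\<Sum>n<K. (c (Suc n))\<^sup>2) \<le> (\<integral>a. f a * f a \<partial>?U) / 2" using bound[of K] by simp
  qed simp
  from tendsto_real_sqrt[OF summable_LIMSEQ_zero[OF this]]
  have "(\<lambda>n. \<bar>c (Suc n)\<bar>) \<longlonglongrightarrow> 0" by simp
  then have "(\<lambda>n. c (Suc n)) \<longlonglongrightarrow> 0" by (simp only: tendsto_rabs_zero_iff)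
  then show ?thesis unfolding c_def[symmetric] by (simp only: filterlim_sequentially_Suc)
qed

text \<open>By \<open>sin\<^sup>2 x = (1 - cos (2 x)) / 2\<close>, half of the kernel integral stays
  and the rest oscillates. For each fixed b, including 0, the kernel is bounded almost everywhere in
  a, so the Riemann-Lebesgue lemma applies.\<close>

lemma Gker_limit:
  assumes "\<bar>b\<bar> \<le> pi"
  shows "(\<lambda>n. Gker n b) \<longlonglongrightarrow> Jker b / 2"
proof -
  let ?U = "unif (pi/2)"
  have iR: "integrable ?U (\<lambda>a. Rker a b)"
    by (rule integrable_unif_bounded[OF measurable_Rker(1) Rker_bounded_AE[OF assms]])
  have mc: "(\<lambda>a. Rker a b * cos (2 * real n * a)) \<in> borel_measurable borel" for n
  proof -
    have "(\<lambda>a. cos (2 * real n * a)) \<in> borel_measurable borel"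
      by (intro borel_measurable_continuous_onI continuous_intros)
    from borel_measurable_times[OF measurable_Rker(1) this] show ?thesis .
  qed
  have iC: "integrable ?U (\<lambda>a. Rker a b * cos (2 * real n * a))" for n
  proof (rule integrable_unif_bounded[OF mc])
    show "AE a in ?U. \<bar>Rker a b * cos (2 * real n * a)\<bar> \<le> 4 / b\<^sup>2 + 152"
      using Rker_bounded_AE[OF assms]
    proof eventually_elim
      case (elim a)
      have "\<bar>Rker a b\<bar> * \<bar>cos (2 * real n * a)\<bar> \<le> (4 / b\<^sup>2 + 152) * 1" using elim by (intro mult_mono) auto
      then show ?case by (simp add: abs_mult)
    qed
  qed
  have "Gker n b = Jker b / 2 - (\<integral>a. Rker a b * cos (2 * real n * a) \<partial>?U) / 2" for n
  proof -
    have "Gker n b = (\<integral>a. (Rker a b - Rker a b * cos (2 * real n * a)) / 2 \<partial>?U)"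
      unfolding Gker_def
    proof (intro Bochner_Integration.integral_cong refl)
      fix a
      have "(sin (real n * a))\<^sup>2 = (1 - cos (2 * real n * a)) / 2"
        using cos_double_sin[of "real n * a"] by (simp add: mult.assoc)
      then show "(sin (real n * a))\<^sup>2 * Rker a b = (Rker a b - Rker a b * cos (2 * real n * a)) / 2"
        by (simp only:) (simp add: left_diff_distrib diff_divide_distrib)
    qed
    also have "\<dots> = (\<integral>a. Rker a b - Rker a b * cos (2 * real n * a) \<partial>?U) / 2" by (rule integral_divide_zero)
    finally show ?thesis
      by (simp only: Jker_def Bochner_Integration.integral_diff[OF iR iC[of n]] diff_divide_distrib)
  qed
  moreover have "(\<lambda>n. Jker b / 2 - (\<integral>a. Rker a b * cos (2 * real n * a) \<partial>?U) / 2) \<longlonglongrightarrow> Jker b / 2 - 0 / 2"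
    by (intro tendsto_intros riemann_lebesgue_cos[OF measurable_Rker(1) Rker_bounded_AE[OF assms]]) simp
  ultimately show ?thesis by simp
qed

section \<open>Exponential sums over equidistant dipoles\<close>

definition wall :: "nat \<Rightarrow> nat \<Rightarrow> int set" where
  "wall m M = (\<lambda>j. int (j * m)) ` {1..M}"

lemma expsum_wall: "m \<ge> 1 \<Longrightarrow> expsum (wall m M) b = (\<Sum>j=1..M. cis (2 * real j * (real m * b)))"
  unfolding expsum_def wall_def
  by (subst sum.reindex) (auto simp: inj_on_def mult_ac)

text \<open>Localisation: the mean of the squared sum is \<open>M\<close>, yet away from the zeros
  of \<open>sin (m b)\<close> it is bounded uniformly in \<open>M\<close>.\<close>

lemma expsum_wall_sin:
  assumes "m \<ge> 1"
  shows "(norm (expsum (wall m M) b))\<^sup>2 * (sin (real m * b))\<^sup>2 \<le> 1"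
  unfolding expsum_wall[OF assms] norm_geometric_cis by (simp add: abs_square_le_1)

lemma integral_unif_pi_cos:
  "(\<integral>b. cos (of_int q * b + \<phi>) \<partial>unif pi) = (if q = 0 then cos \<phi> else 0)"
proof (cases "q = 0")
  case False
  then have "sin (of_int q * pi) = 0" by (auto simp: sin_zero_iff_int2)
  then show ?thesis using False integral_unif_cos_phase[of pi "of_int q" \<phi>] by simp
qed simp

lemma norm_expsum_wall_sq:
  assumes "m \<ge> 1"
  shows "(norm (expsum (wall m M) b))\<^sup>2 = (\<Sum>i=1..M. \<Sum>j=1..M. cos (of_int (2 * int m * (int i - int j)) * b))"
proof -
  have "(norm (expsum (wall m M) b))\<^sup>2 = (\<Sum>i=1..M. cos (2 * real i * (real m * b)))\<^sup>2 + (\<Sum>i=1..M. sin (2 * real i * (real m * b)))\<^sup>2"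
    unfolding expsum_wall[OF assms] by (simp add: cmod_power2)
  also have "\<dots> = (\<Sum>i=1..M. \<Sum>j=1..M. cos (2 * real i * (real m * b) - 2 * real j * (real m * b)))"
    by (simp add: power2_eq_square sum_product cos_diff sum.distrib)
  also have "\<dots> = (\<Sum>i=1..M. \<Sum>j=1..M. cos (of_int (2 * int m * (int i - int j)) * b))"
    by (intro sum.cong refl arg_cong[where f = cos]) (simp add: algebra_simps)
  finally show ?thesis .
qed

text \<open>The squared sum contains only frequencies divisible by 2m. A cosine of frequency p < 2m
  matches one of them only for p = 0, and then on the M diagonal pairs.\<close>

lemma integral_expsum_wall_cos:
  assumes m: "m \<ge> 1" and p: "p < 2 * m"
  shows "(\<integral>b. (norm (expsum (wall m M) b))\<^sup>2 * cos (real p * (b - \<theta>)) \<partial>unif pi) = (if p = 0 then real M else 0)"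
proof -
  let ?q = "\<lambda>i j. 2 * int m * (int i - int j)"
  let ?t = "\<lambda>i j b. (cos (of_int (?q i j - int p) * b + real p * \<theta>) + cos (of_int (?q i j + int p) * b + (- real p * \<theta>))) / 2"
  have "(\<integral>b. (norm (expsum (wall m M) b))\<^sup>2 * cos (real p * (b - \<theta>)) \<partial>unif pi) =
      (\<integral>b. (\<Sum>i=1..M. \<Sum>j=1..M. ?t i j b) \<partial>unif pi)"
    unfolding norm_expsum_wall_sq[OF m] sum_distrib_right
  proof (intro Bochner_Integration.integral_cong sum.cong refl)
    fix b i j
    have "of_int (?q i j) * b - real p * (b - \<theta>) = of_int (?q i j - int p) * b + real p * \<theta>"
      "of_int (?q i j) * b + real p * (b - \<theta>) = of_int (?q i j + int p) * b + (- real p * \<theta>)"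
      by (simp_all add: algebra_simps)
    then show "cos (of_int (?q i j) * b) * cos (real p * (b - \<theta>)) = ?t i j b"
      unfolding cos_times_cos by (simp only:)
  qed
  also have "\<dots> = (\<Sum>i=1..M. \<Sum>j=1..M. \<integral>b. ?t i j b \<partial>unif pi)"
    by (subst Bochner_Integration.integral_sum, intro integrable_unif_continuous continuous_intros,
        simp, intro sum.cong refl, subst Bochner_Integration.integral_sum, intro integrable_unif_continuous continuous_intros)
       simp_all
  also have "\<dots> = (\<Sum>i=1..M. \<Sum>j=1..M. if i = j then (if p = 0 then 1 else 0) else 0)"
  proof (intro sum.cong refl)
    fix i j
    have "(\<integral>b. ?t i j b \<partial>unif pi) = ((\<integral>b. cos (of_int (?q i j - int p) * b + real p * \<theta>) \<partial>unif pi) +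
       (\<integral>b. cos (of_int (?q i j + int p) * b + (- real p * \<theta>)) \<partial>unif pi)) / 2"
      by (subst integral_divide_zero, subst Bochner_Integration.integral_add)
         (intro integrable_unif_continuous continuous_intros refl)+
    moreover have "?q i j - int p = 0 \<longleftrightarrow> i = j \<and> p = 0" "?q i j + int p = 0 \<longleftrightarrow> i = j \<and> p = 0"
    proof -
      have *: "int p = 2 * int m * k \<longleftrightarrow> k = 0 \<and> p = 0" for k
      proof
        assume h: "int p = 2 * int m * k"
        have "k < 1"
        proof (rule ccontr)
          assume "\<not> k < 1"
          then have "2 * int m * 1 \<le> 2 * int m * k" by (intro mult_left_mono) auto
          then show False using h p by linarith
        qed
        moreover have "k \<ge> 0"
        proof (rule ccontr)
          assume "\<not> k \<ge> 0"
          then have "2 * int m * k < 0" using m by (simp add: mult_less_0_iff)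
          then show False using h by linarith
        qed
        ultimately have "k = 0" by linarith
        with h show "k = 0 \<and> p = 0" by simp
      qed simp
      show "?q i j - int p = 0 \<longleftrightarrow> i = j \<and> p = 0" using *[of "int i - int j"] by auto
      have "?q i j + int p = 0 \<longleftrightarrow> int p = 2 * int m * (int j - int i)" by (auto simp: algebra_simps)
      then show "?q i j + int p = 0 \<longleftrightarrow> i = j \<and> p = 0" using *[of "int j - int i"] by auto
    qed
    ultimately show "(\<integral>b. ?t i j b \<partial>unif pi) = (if i = j then (if p = 0 then 1 else 0) else 0)"
      unfolding integral_unif_pi_cos by auto
  qed
  also have "\<dots> = (\<Sum>i=1..M. if p = 0 then 1 else 0)" by (intro sum.cong refl) simp
  finally show ?thesis by simp
qed

text \<open>The real part of a geometric sum in the 2m-th root of unity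
  \<open>cis (pi j / m)\<close>.\<close>

lemma dirichlet_node_sum:
  assumes m: "m \<ge> 1"
  shows "(\<Sum>p<2*m. cos (real p * (pi * of_int j / real m))) = (if 2 * int m dvd j then 2 * real m else 0)"
proof (cases "2 * int m dvd j")
  case True
  then obtain n where n: "j = 2 * int m * n" by (auto simp: dvd_def)
  have "cos (real p * (pi * of_int j / real m)) = 1" for p
    unfolding cos_one_2pi_int using m by (intro exI[of _ "int p * n"]) (simp add: n)
  then show ?thesis using True by simp
next
  case False
  define x where "x = pi * of_int j / real m"
  have w: "cis x \<noteq> 1"
  proof
    assume "cis x = 1"
    then have "cos x = 1" by (simp add: complex_eq_iff)
    then obtain n :: int where "x = of_int n * 2 * pi" unfolding cos_one_2pi_int by blast
    then have "of_int j = (of_int (2 * int m * n) :: real)" using m by (simp add: x_def field_simps)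
    then have "j = 2 * int m * n" by (simp only: of_int_eq_iff)
    then show False using False by simp
  qed
  have "real (2 * m) * x = 2 * pi * of_int j" using m by (simp add: x_def)
  then have "cis x ^ (2 * m) = cis (2 * pi * of_int j)" by (simp only: Complex.DeMoivre)
  also have "\<dots> = 1" by (simp add: complex_eq_iff sin_zero_iff_int2 cos_one_2pi_int)
  finally have "(\<Sum>p<2*m. cis x ^ p) = 0" using w by (subst geometric_sum) auto
  then have "(\<Sum>p<2*m. cis (real p * x)) = 0" by (simp only: Complex.DeMoivre)
  then have "Re (\<Sum>p<2*m. cis (real p * x)) = 0" by simp
  then show ?thesis using False by (simp add: x_def)
qed

text \<open>Subtracting the trigonometric polynomial interpolating the function at the zeros of \<open>sin (m b)\<close>
  leaves a function which the squared exponential sum does not see in the limit.\<close>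

lemma fejer_limit:
  fixes G :: "real \<Rightarrow> real"
  assumes m: "m \<ge> 1" and G: "continuous_on UNIV G" and per: "G (- pi) = G pi"
  shows "(\<lambda>M. (\<integral>b. (norm (expsum (wall m M) b))\<^sup>2 * G b \<partial>unif pi) / real M)
    \<longlonglongrightarrow> (\<Sum>k\<in>{- int m..<int m}. G (pi * of_int k / real m)) / (2 * real m)"
proof -
  let ?\<theta> = "\<lambda>k. pi * of_int k / real m"
  let ?N = "{- int m..<int m}"
  let ?A = "(\<Sum>k\<in>?N. G (?\<theta> k)) / (2 * real m)"
  have m0: "real m > 0" using m by simp
  \<comment> \<open>Each inner sum is 2m at its own node and 0 at the others, so \<open>h\<close>
    interpolates \<open>G\<close> at the nodes. All its frequencies lie below 2m; hence its integral
    against the squared sum is exactly \<open>M\<close> times the average of the node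
    values.\<close>
  define h where "h b = (\<Sum>k\<in>?N. G (?\<theta> k) / (2 * real m) * (\<Sum>p<2*m. cos (real p * (b - ?\<theta> k))))" for b
  have ch: "continuous_on UNIV h" unfolding h_def by (intro continuous_intros)
  let ?E = "\<lambda>M b. (norm (expsum (wall m M) b))\<^sup>2"
  have cE: "continuous_on UNIV (?E M)" for M by (intro continuous_intros)
  have hint: "(\<integral>b. ?E M b * h b \<partial>unif pi) = real M * ?A" for M
  proof -
    have "(\<integral>b. ?E M b * h b \<partial>unif pi) =
       (\<integral>b. (\<Sum>k\<in>?N. \<Sum>p<2*m. G (?\<theta> k) / (2 * real m) * (?E M b * cos (real p * (b - ?\<theta> k)))) \<partial>unif pi)"
      by (intro Bochner_Integration.integral_cong refl) (simp add: h_def sum_distrib_left mult_ac)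
    also have "\<dots> = (\<Sum>k\<in>?N. \<Sum>p<2*m. \<integral>b. G (?\<theta> k) / (2 * real m) * (?E M b * cos (real p * (b - ?\<theta> k))) \<partial>unif pi)"
      by (subst Bochner_Integration.integral_sum, intro integrable_unif_continuous continuous_intros,
          intro sum.cong refl, subst Bochner_Integration.integral_sum, intro integrable_unif_continuous continuous_intros)
         simp
    also have "\<dots> = (\<Sum>k\<in>?N. \<Sum>p<2*m. if p = 0 then G (?\<theta> k) / (2 * real m) * real M else 0)"
      by (intro sum.cong refl) (simp add: integral_expsum_wall_cos[OF m])
    also have "\<dots> = (\<Sum>k\<in>?N. G (?\<theta> k) / (2 * real m) * real M)" using m by simp
    finally show ?thesis by (simp add: sum_divide_distrib sum_distrib_left mult_ac)
  qed
  have Eint: "(\<integral>b. ?E M b \<partial>unif pi) = real M" for M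
    using integral_expsum_wall_cos[OF m, of 0 M 0] m by simp
  have node: "h b = G b" if b: "\<bar>b\<bar> \<le> pi" "sin (real m * b) = 0" for b
  proof -
    obtain l :: int where l: "real m * b = of_int l * pi" using b(2) unfolding sin_zero_iff_int2 by blast
    then have bl: "b = ?\<theta> l" using m0 by (simp add: field_simps)
    have "\<bar>of_int l :: real\<bar> * pi = real m * \<bar>b\<bar>" using arg_cong[OF l, of abs] by (simp add: abs_mult)
    also have "\<dots> \<le> real m * pi" using b(1) by (intro mult_left_mono) auto
    finally have "\<bar>l\<bar> \<le> int m" by simp
    then have lm: "- int m \<le> l" "l \<le> int m" by auto
    \<comment> \<open>The zeros include both ends of the interval while the nodes omit k = m;
      periodicity of \<open>G\<close> identifies pi with -pi.\<close>
    define l' where "l' = (if l = int m then - int m else l)"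
    have l': "l' \<in> ?N" using lm m by (auto simp: l'_def)
    have Gl: "G (?\<theta> l') = G b" using per m0 by (auto simp: l'_def bl)
    have dv: "2 * int m dvd l - k \<longleftrightarrow> k = l'" if k: "k \<in> ?N" for k
    proof
      assume "2 * int m dvd l - k"
      moreover have "l' - k = l - k \<or> l' - k = l - k - 2 * int m" by (auto simp: l'_def)
      ultimately have "2 * int m dvd l' - k"
        by (metis dvd_diff dvd_refl)
      moreover have "\<bar>l' - k\<bar> < 2 * int m" using k l' by auto
      ultimately have "l' - k = 0" using zdvd_imp_le[of "2 * int m" "\<bar>l' - k\<bar>"] by (cases "l' - k = 0") auto
      then show "k = l'" by simp
    qed (auto simp: l'_def)
    have "h b = (\<Sum>k\<in>?N. if k = l' then G (?\<theta> k) else 0)"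
      unfolding h_def
    proof (intro sum.cong refl)
      fix k assume k: "k \<in> ?N"
      have "b - ?\<theta> k = ?\<theta> (l - k)" by (simp add: bl diff_divide_distrib right_diff_distrib)
      then have "(\<Sum>p<2*m. cos (real p * (b - ?\<theta> k))) = (if k = l' then 2 * real m else 0)"
        using dirichlet_node_sum[OF m, of "l - k"] dv[OF k] by simp
      then show "G (?\<theta> k) / (2 * real m) * (\<Sum>p<2*m. cos (real p * (b - ?\<theta> k))) = (if k = l' then G (?\<theta> k) else 0)"
        using m0 by simp
    qed
    also have "\<dots> = G (?\<theta> l')" using l' by simp
    finally show ?thesis using Gl by simp
  qed
  show ?thesis
  proof (rule LIMSEQ_I)
    fix \<epsilon> :: real assume \<epsilon>: "\<epsilon> > 0"
    define g where "g b = \<bar>G b - h b\<bar>" for b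
    have cg: "continuous_on S g" for S
      unfolding g_def using continuous_on_subset[OF G, of S] continuous_on_subset[OF ch, of S] by (intro continuous_intros) auto
    \<comment> \<open>By compactness \<open>sin (m b)\<close> stays away from 0 on the set where
      \<open>g\<close> exceeds the threshold, since \<open>g\<close> vanishes at all zeros of the
      sine. After multiplication by the squared sum the second term is at most \<open>C\<close>,
      which is lost on division by \<open>M\<close>.\<close>
    obtain C where C: "C \<ge> 0" "\<And>b. \<bar>b\<bar> \<le> pi \<Longrightarrow> g b \<le> \<epsilon> / 2 + C * (sin (real m * b))\<^sup>2"
    proof (cases "{b \<in> {-pi..pi}. \<epsilon> / 2 \<le> g b} = {}")
      case True
      have "g b \<le> \<epsilon> / 2 + 0 * (sin (real m * b))\<^sup>2" if "\<bar>b\<bar> \<le> pi" for b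
      proof -
        have "b \<in> {-pi..pi}" using that by (auto simp: abs_le_iff)
        with True have "\<not> \<epsilon> / 2 \<le> g b" by blast
        then show ?thesis by simp
      qed
      then show ?thesis using that[of 0] by blast
    next
      case False
      let ?K = "{b \<in> {-pi..pi}. \<epsilon> / 2 \<le> g b}"
      have "closed {b. \<epsilon> / 2 \<le> g b}" by (intro closed_Collect_le continuous_on_const cg)
      moreover have "?K = {-pi..pi} \<inter> {b. \<epsilon> / 2 \<le> g b}" by auto
      ultimately have K: "compact ?K" by (simp only: compact_Int_closed compact_Icc)
      have "continuous_on ?K (\<lambda>b. (sin (real m * b))\<^sup>2)" by (intro continuous_intros)
      from continuous_attains_inf[OF K False this] obtain b0 where
        b0: "b0 \<in> ?K" "\<And>b. b \<in> ?K \<Longrightarrow> (sin (real m * b0))\<^sup>2 \<le> (sin (real m * b))\<^sup>2" by blast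
      have "sin (real m * b0) \<noteq> 0"
      proof
        assume "sin (real m * b0) = 0"
        then have "g b0 = 0" using node[of b0] b0(1) by (auto simp: g_def abs_le_iff)
        then show False using b0(1) \<epsilon> by auto
      qed
      then have s0: "(sin (real m * b0))\<^sup>2 > 0" by simp
      have "bounded (g ` {-pi..pi})" by (intro compact_imp_bounded compact_continuous_image cg compact_Icc)
      then obtain D where D: "\<And>b. b \<in> {-pi..pi} \<Longrightarrow> g b \<le> D"
        unfolding bounded_iff by (metis abs_le_D1 image_eqI real_norm_def)
      have D0: "D \<ge> 0" using D[of b0] b0(1) by (auto simp: g_def)
      show ?thesis
      proof (rule that[of "D / (sin (real m * b0))\<^sup>2"])
        fix b assume "\<bar>b\<bar> \<le> pi"
        then have b: "b \<in> {-pi..pi}" by (auto simp: abs_le_iff)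
        show "g b \<le> \<epsilon> / 2 + D / (sin (real m * b0))\<^sup>2 * (sin (real m * b))\<^sup>2"
        proof (cases "b \<in> ?K")
          case True
          have "D * 1 \<le> D * ((sin (real m * b))\<^sup>2 / (sin (real m * b0))\<^sup>2)"
            using b0(2)[OF True] s0 D0 by (intro mult_left_mono) auto
          then show ?thesis using D[OF b] \<epsilon> by simp
        next
          case False
          then have "g b \<le> \<epsilon> / 2" using b by auto
          moreover have "0 \<le> D / (sin (real m * b0))\<^sup>2 * (sin (real m * b))\<^sup>2" using D0 by simp
          ultimately show ?thesis by linarith
        qed
      qed (use D0 in simp)
    qed
    obtain M0 :: nat where M0: "real M0 > 2 * C / \<epsilon>" using reals_Archimedean2 by blast
    show "\<exists>no. \<forall>M\<ge>no. norm ((\<integral>b. ?E M b * G b \<partial>unif pi) / real M - ?A) < \<epsilon>"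
    proof (intro exI[of _ "max 1 M0"] allI impI)
      fix M assume M: "M \<ge> max 1 M0"
      then have M1: "real M > 0" and MC: "real M > 2 * C / \<epsilon>" using M0 by (auto intro: less_le_trans)
      have i1: "integrable (unif pi) (\<lambda>b. ?E M b * G b)" "integrable (unif pi) (\<lambda>b. ?E M b * h b)"
        by (intro integrable_unif_continuous continuous_intros G ch)+
      have "(\<integral>b. ?E M b * G b \<partial>unif pi) - real M * ?A = (\<integral>b. ?E M b * G b - ?E M b * h b \<partial>unif pi)"
        unfolding hint[symmetric] by (rule Bochner_Integration.integral_diff[symmetric, OF i1])
      then have "\<bar>(\<integral>b. ?E M b * G b \<partial>unif pi) - real M * ?A\<bar> \<le> (\<integral>b. \<bar>?E M b * G b - ?E M b * h b\<bar> \<partial>unif pi)"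
        using integral_norm_bound[of "unif pi" "\<lambda>b. ?E M b * G b - ?E M b * h b"] by simp
      also have "\<dots> \<le> (\<integral>b. \<epsilon> / 2 * ?E M b + C \<partial>unif pi)"
      proof (rule integral_mono_AE)
        show "integrable (unif pi) (\<lambda>b. \<bar>?E M b * G b - ?E M b * h b\<bar>)"
          by (intro integrable_unif_continuous continuous_intros G ch)
        show "integrable (unif pi) (\<lambda>b. \<epsilon> / 2 * ?E M b + C)"
          by (intro integrable_unif_continuous continuous_intros)
        show "AE b in unif pi. \<bar>?E M b * G b - ?E M b * h b\<bar> \<le> \<epsilon> / 2 * ?E M b + C"
          using AE_unif_good[of pi]
        proof eventually_elim
          case (elim b)
          have "\<bar>?E M b * G b - ?E M b * h b\<bar> = ?E M b * g b"
            unfolding right_diff_distrib[symmetric] abs_mult g_def by simp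
          also have "\<dots> \<le> ?E M b * (\<epsilon> / 2 + C * (sin (real m * b))\<^sup>2)" using elim by (intro mult_left_mono C(2)) auto
          also have "\<dots> = \<epsilon> / 2 * ?E M b + C * (?E M b * (sin (real m * b))\<^sup>2)" by (simp add: algebra_simps)
          also have "\<dots> \<le> \<epsilon> / 2 * ?E M b + C * 1" using C(1) expsum_wall_sin[OF m] by (intro add_left_mono mult_left_mono) auto
          finally show ?case by simp
        qed
      qed
      also have "\<dots> = \<epsilon> / 2 * real M + C"
      proof -
        have "integrable (unif pi) (\<lambda>b. \<epsilon> / 2 * ?E M b)" by (intro integrable_unif_continuous continuous_intros)
        then have "(\<integral>b. \<epsilon> / 2 * ?E M b + C \<partial>unif pi) = (\<integral>b. \<epsilon> / 2 * ?E M b \<partial>unif pi) + (\<integral>b. C \<partial>unif pi)"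
          by (rule Bochner_Integration.integral_add) simp
        then show ?thesis using Eint[of M] by simp
      qed
      also have "\<dots> < \<epsilon> * real M" using MC \<epsilon> by (simp add: field_simps)
      finally have "\<bar>(\<integral>b. ?E M b * G b \<partial>unif pi) - real M * ?A\<bar> < \<epsilon> * real M" .
      moreover have "(\<integral>b. ?E M b * G b \<partial>unif pi) / real M - ?A = ((\<integral>b. ?E M b * G b \<partial>unif pi) - real M * ?A) / real M"
        using M1 by (simp add: diff_divide_distrib)
      ultimately show "norm ((\<integral>b. ?E M b * G b \<partial>unif pi) / real M - ?A) < \<epsilon>"
        using M1 unfolding real_norm_def by (simp add: divide_less_eq abs_divide)
    qed
  qed
qed

section \<open>The grain boundary\<close>

lemma q_dip_charge: "q_dip n = charge n {0}"
  by (rule ext) (simp add: charge_def shift_def case_prod_unfold)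

lemma q_grain_charge: "m \<ge> 1 \<Longrightarrow> q_grain M n m = charge n (wall m M)"
  by (rule ext) (simp add: q_grain_def charge_def wall_def sum.reindex inj_on_def)

lemma finite_wall: "finite (wall m M)"
  by (simp add: wall_def)

lemma grain_density_limit:
  assumes m: "m \<ge> 1"
  shows "(\<lambda>M. grain_density n m M) \<longlonglongrightarrow>
    (\<Sum>k\<in>{- int m..<int m}. Gker n (pi * of_int k / real m)) / (4 * sqrt 3 * (real m)\<^sup>2)"
proof -
  let ?I = "\<lambda>M. (\<integral>b. (norm (expsum (wall m M) b))\<^sup>2 * Gker n b \<partial>unif pi) / real M"
  let ?S = "\<Sum>k\<in>{- int m..<int m}. Gker n (pi * of_int k / real m)"
  have per: "Gker n (- pi) = Gker n pi" by (simp add: Gker_def Rker_def Rden_def)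
  have "(\<lambda>M. 1 / (2 * sqrt 3 * real m) * ?I M) \<longlonglongrightarrow> 1 / (2 * sqrt 3 * real m) * (?S / (2 * real m))"
    by (intro tendsto_mult_left fejer_limit[OF m continuous_Gker per])
  moreover have "grain_density n m M = 1 / (2 * sqrt 3 * real m) * ?I M" for M
    unfolding grain_density_def q_grain_charge[OF m] thermo_charge_Gker[OF finite_wall] by simp
  moreover have "1 / (2 * sqrt 3 * real m) * (?S / (2 * real m)) = ?S / (4 * sqrt 3 * (real m)\<^sup>2)"
    by (simp add: power2_eq_square)
  ultimately show ?thesis by (simp only:)
qed

lemma E_grain_eq:
  assumes "m \<ge> 1"
  shows "E_grain n m = (\<Sum>k\<in>{- int m..<int m}. Gker n (pi * of_int k / real m)) / (4 * sqrt 3 * (real m)\<^sup>2)"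
  unfolding E_grain_def by (rule limI[OF grain_density_limit[OF assms]])

text \<open>With m fixed there are 2m nodes, so n tends to infinity in each term.\<close>

lemma E_grain_limit:
  assumes m: "m \<ge> 1"
  shows "(\<lambda>n. E_grain n m) \<longlonglongrightarrow>
    (\<Sum>k\<in>{- int m..<int m}. Jker (pi * of_int k / real m) / 2) / (4 * sqrt 3 * (real m)\<^sup>2)"
  unfolding E_grain_eq[OF m]
proof (intro tendsto_divide tendsto_sum tendsto_const Gker_limit)
  fix k assume "k \<in> {- int m..<int m}"
  then have "\<bar>of_int k :: real\<bar> \<le> real m" by auto
  then have "pi * \<bar>of_int k\<bar> \<le> pi * real m" by (intro mult_left_mono) auto
  then show "\<bar>pi * of_int k / real m\<bar> \<le> pi" using m by (simp add: abs_mult divide_le_eq)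
qed (use m in auto)

text \<open>The term k = 0 is 0 by division by zero. The negative side runs up to m and gives
  \<open>harm m\<close>, the positive side stops at m - 1, hence the correction
  \<open>1 / m\<close>.\<close>

lemma sum_inverse_abs:
  "(\<Sum>k\<in>{- int m..<int m}. 1 / \<bar>of_int k :: real\<bar>) = 2 * harm m - 1 / real m"
proof -
  have "{- int m..<int m} = {- int m..<0} \<union> {0..<int m}" by auto
  then have "(\<Sum>k\<in>{- int m..<int m}. 1 / \<bar>of_int k :: real\<bar>) =
      (\<Sum>k\<in>{- int m..<0}. 1 / \<bar>of_int k\<bar>) + (\<Sum>k\<in>{0..<int m}. 1 / \<bar>of_int k\<bar>)"
    by (simp only:) (subst sum.union_disjoint, auto)
  moreover have "(\<Sum>k\<in>{- int m..<0}. 1 / \<bar>of_int k :: real\<bar>) = (\<Sum>k\<in>{1..m}. 1 / real k)"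
    by (rule sum.reindex_bij_witness[of _ "\<lambda>k. - int k" "\<lambda>k. nat (- k)"]) auto
  moreover have "(\<Sum>k\<in>{0..<int m}. 1 / \<bar>of_int k :: real\<bar>) = (\<Sum>k<m. 1 / real k)"
    by (rule sum.reindex_bij_witness[of _ int nat]) auto
  moreover have "(\<Sum>k<m. 1 / real k) + 1 / real m = (\<Sum>k\<in>{1..m}. 1 / real k)"
    by (induction m) auto
  moreover have "(\<Sum>k\<in>{1..m}. 1 / real k) = harm m"
    by (simp add: harm_def inverse_eq_divide)
  ultimately show ?thesis by simp
qed

lemma harm_ln_bounds:
  assumes "m \<ge> 1"
  shows "ln (real m) \<le> harm m" "harm m \<le> ln (real m) + 1"
proof -
  have "ln (real m) \<le> ln (real m + 1)" using assms by simp
  then show "ln (real m) \<le> harm m" using ln_le_harm[of m] by linarith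
  have "harm (Suc (m - 1)) - ln (real (Suc (m - 1))) \<le> harm (Suc 0) - ln (real (Suc 0))"
    using decseqD[OF decseq_harm_diff_ln, of 0 "m - 1"] by simp
  moreover have "harm (Suc 0) = (1::real)" by (simp add: harm_def)
  ultimately show "harm m \<le> ln (real m) + 1" using assms by simp
qed

text \<open>Each of the 2m nodes contributes an error of at most \<open>B\<close>, which the
  prefactor of order \<open>1 / m\<^sup>2\<close> turns into O(1/m). The factor \<open>g\<close> is
  the coefficient of \<open>Jker_asymp\<close> at \<open>pi k / m\<close>, and the harmonic sum
  counts both signs of k.\<close>

lemma grain_boundary_asymp:
  assumes m: "m \<ge> 1"
  shows "\<bar>(\<Sum>k\<in>{- int m..<int m}. Jker (pi * of_int k / real m) / 2) / (4 * sqrt 3 * (real m)\<^sup>2)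
    - ln (real m) / (6 * pi * real m)\<bar> \<le> (\<bar>Jker 0\<bar> + 200) / real m"
proof -
  let ?N = "{- int m..<int m}" and ?m = "real m"
  have m0: "?m > 0" "?m \<ge> 1" using m by auto
  define B where "B = \<bar>Jker 0\<bar> + 153"
  define g where "g = 2 * ?m / (sqrt 3 * pi)"
  have t: "\<bar>Jker (pi * of_int k / ?m) - g * (1 / \<bar>of_int k\<bar>)\<bar> \<le> B" if k: "k \<in> ?N" for k
  proof (cases "k = 0")
    \<comment> \<open>Here \<open>1 / 0 = 0\<close>, so \<open>Jker 0\<close> is compared with 0 and
      enters \<open>B\<close> as a constant independent of m.\<close>
    case True
    then show ?thesis by (simp add: B_def)
  next
    case False
    have "\<bar>of_int k :: real\<bar> \<le> ?m" using k by auto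
    then have "pi * \<bar>of_int k\<bar> \<le> pi * ?m" by (intro mult_left_mono) auto
    then have "\<bar>pi * of_int k / ?m\<bar> \<le> pi" using m0 by (simp add: abs_mult divide_le_eq)
    from Jker_asymp[OF _ this] False m0
    have "\<bar>Jker (pi * of_int k / ?m) - 2 / (sqrt 3 * \<bar>pi * of_int k / ?m\<bar>)\<bar> \<le> 153" by simp
    moreover have "2 / (sqrt 3 * \<bar>pi * of_int k / ?m\<bar>) = g * (1 / \<bar>of_int k\<bar>)"
      by (simp add: g_def abs_mult)
    ultimately show ?thesis by (simp add: B_def)
  qed
  let ?S = "\<Sum>k\<in>?N. Jker (pi * of_int k / ?m)"
  have "?S - g * (2 * harm m - 1 / ?m) = (\<Sum>k\<in>?N. Jker (pi * of_int k / ?m) - g * (1 / \<bar>of_int k\<bar>))"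
    by (simp only: sum_subtractf sum_distrib_left[symmetric] sum_inverse_abs)
  also have "\<bar>\<dots>\<bar> \<le> (\<Sum>k\<in>?N. B)"
    by (rule order_trans[OF sum_abs sum_mono]) (rule t)
  finally have S: "\<bar>?S - g * (2 * harm m - 1 / ?m)\<bar> \<le> 2 * ?m * B" by simp
  have "1 / ?m \<le> 1" "0 \<le> 1 / ?m" using m0 by auto
  then have h: "\<bar>(2 * harm m - 1 / ?m) - 2 * ln ?m\<bar> \<le> 2" using harm_ln_bounds[OF m] by linarith
  have s3: "sqrt 3 \<ge> 1" by simp
  have "1 * 2 \<le> sqrt 3 * pi" using s3 pi_gt3 by (intro mult_mono) auto
  then have "2 * ?m \<le> ?m * (sqrt 3 * pi)" using m0 by simp
  then have g: "0 \<le> g" "g \<le> ?m" using m0 by (simp_all add: g_def divide_le_eq mult.commute)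
  have "\<bar>g * (2 * harm m - 1 / ?m) - g * (2 * ln ?m)\<bar> = g * \<bar>(2 * harm m - 1 / ?m) - 2 * ln ?m\<bar>"
    unfolding right_diff_distrib[symmetric] abs_mult using g by simp
  also have "\<dots> \<le> ?m * 2" using g h by (intro mult_mono) auto
  finally have S2: "\<bar>g * (2 * harm m - 1 / ?m) - g * (2 * ln ?m)\<bar> \<le> ?m * 2" .
  have S3: "\<bar>?S - g * (2 * ln ?m)\<bar> \<le> 2 * ?m * (B + 1)"
  proof -
    have "\<bar>a - c\<bar> \<le> x + y" if "\<bar>a - b\<bar> \<le> x" "\<bar>b - c\<bar> \<le> y" for a b c x y :: real using that by linarith
    from this[OF S S2] show ?thesis by (simp add: algebra_simps)
  qed
  have e1: "(\<Sum>k\<in>?N. Jker (pi * of_int k / ?m) / 2) / (4 * sqrt 3 * ?m\<^sup>2) = ?S / (8 * sqrt 3 * ?m\<^sup>2)"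
    by (simp add: sum_divide_distrib[symmetric])
  have e2: "ln ?m / (6 * pi * ?m) = g * (2 * ln ?m) / (8 * sqrt 3 * ?m\<^sup>2)"
    using m0 by (simp add: g_def power2_eq_square field_simps)
  have "\<bar>?S / (8 * sqrt 3 * ?m\<^sup>2) - g * (2 * ln ?m) / (8 * sqrt 3 * ?m\<^sup>2)\<bar> = \<bar>?S - g * (2 * ln ?m)\<bar> / (8 * sqrt 3 * ?m\<^sup>2)"
    unfolding diff_divide_distrib[symmetric] abs_divide by simp
  also have "\<dots> \<le> 2 * ?m * (B + 1) / (2 * ?m\<^sup>2)"
  proof (intro frac_le S3)
    have "2 \<le> 8 * sqrt 3" using s3 by linarith
    then show "2 * ?m\<^sup>2 \<le> 8 * sqrt 3 * ?m\<^sup>2" by (intro mult_right_mono) auto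
  qed (use m0 in \<open>auto simp: B_def\<close>)
  also have "\<dots> = (B + 1) / ?m" using m0 by (simp add: power2_eq_square)
  also have "\<dots> \<le> (\<bar>Jker 0\<bar> + 200) / ?m" using m0 by (intro divide_right_mono) (auto simp: B_def)
  finally show ?thesis unfolding e1 e2 .
qed

theorem theorem3p3:
  shows "(\<forall>n \<ge> 1. has_thermo_limit (q_dip n)) \<and>
    (\<lambda>n. E_dip n - ln (real n) / (2 * pi * sqrt 3)) \<in> O(\<lambda>n. 1) \<and>
    (\<forall>n \<ge> 1. \<forall>m \<ge> 1. \<forall>M \<ge> 1. has_thermo_limit (q_grain M n m)) \<and>
    (\<forall>n \<ge> 1. \<forall>m \<ge> 1. convergent (\<lambda>M. grain_density n m M)) \<and>
    (\<forall>m \<ge> 1. convergent (\<lambda>n. E_grain n m)) \<and>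
    (\<lambda>m. lim (\<lambda>n. E_grain n m) - ln (real m) / (6 * pi * real m)) \<in> O(\<lambda>m. 1 / real m)"
proof (intro conjI allI impI)
  show "has_thermo_limit (q_dip n)" for n
    unfolding q_dip_charge by (rule thermo_charge(1)) simp
  show "(\<lambda>n. E_dip n - ln (real n) / (2 * pi * sqrt 3)) \<in> O(\<lambda>n. 1)"
  proof (rule bigoI)
    show "\<forall>\<^sub>F n in sequentially. norm (E_dip n - ln (real n) / (2 * pi * sqrt 3)) \<le> 80 * norm (1::real)"
      using eventually_ge_at_top[of 1]
      by eventually_elim (use dipole_asymp in \<open>simp add: E_dip_def q_dip_charge\<close>)
  qed
  show "has_thermo_limit (q_grain M n m)" if "m \<ge> 1" for n m M
    unfolding q_grain_charge[OF that] by (rule thermo_charge(1)[OF finite_wall])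
  show "convergent (\<lambda>M. grain_density n m M)" if "m \<ge> 1" for n m
    using grain_density_limit[OF that] by (auto simp: convergent_def)
  show "convergent (\<lambda>n. E_grain n m)" if "m \<ge> 1" for m
    using E_grain_limit[OF that] by (auto simp: convergent_def)
  show "(\<lambda>m. lim (\<lambda>n. E_grain n m) - ln (real m) / (6 * pi * real m)) \<in> O(\<lambda>m. 1 / real m)"
  proof (rule bigoI)
    show "\<forall>\<^sub>F m in sequentially. norm (lim (\<lambda>n. E_grain n m) - ln (real m) / (6 * pi * real m))
        \<le> (\<bar>Jker 0\<bar> + 200) * norm (1 / real m)"
      using eventually_ge_at_top[of 1]
    proof eventually_elim
      case (elim m)
      then show ?case
        using grain_boundary_asymp[of m] unfolding limI[OF E_grain_limit[OF elim]] by simp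
    qed
  qed
qed

end
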